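(* There exists a signature $\Sigma=(\{\mathsf C\},\mathfrak I,\mathfrak P)$ with a single component type and a fixed finite set $\mathfrak I$ of interaction types of arities $1$ and $2$ such that the following two problems are undecidable: (LinearDeadlock) given a SID $\Delta$, a behavior map $\beta$ for $\Sigma$, and a sentence $\phi$ which is linear over $\Delta$, decide $\mathit{deadlock}(\phi,\Delta,\beta)$; (LinearReachability) given a SID $\Delta$, a behavior map $\beta$, a sentence $\phi$ linear over $\Delta$ and a state $q_1$, decide $\mathit{reach}(\phi,\langle q_1\rangle,\Delta,\beta)$.
   Context: Signatures, architectures, behavior maps, the Petri net $\mathsf N(\Sigma,\alpha,\beta)$, precise markings, configurations and the configuration logic CL with its semantics $\models_\Delta$ over a SID (set of inductive definitions) $\Delta$ are as follows. A signature $\Sigma=(\mathfrak C,\mathfrak I,\mathfrak P)$ has component types $\mathfrak C$, interaction types $\mathfrak I$ with arities $\#(\mathsf I)\ge1$, and port interface $\mathfrak P$ ($\mathfrak P(\mathsf C)$ pairwise disjoint finite port sets, $\mathfrak P(\mathsf I)=\langle p_1,\dots,p_{\#(\mathsf I)}\rangle$, $\mathrm{comp}(p)$ the type owning $p$). An architecture $\alpha$ gives sets $\alpha(\mathsf C)\subseteq\mathbb U$ and relations $\alpha(\mathsf I)\subseteq\mathbb U^{\#(\mathsf I)}$ over a countably infinite set $\mathbb U$. A behavior map $\beta$ gives each $\mathsf C$ a finite state machine with states $Q_{\mathsf C}$ (pairwise disjoint), transitions $q\xrightarrow{p}q'$ with $p\in\mathfrak P(\mathsf C)$. $\mathsf N(\Sigma,\alpha,\beta)$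 has places $q[u]$ ($q\in Q_{\mathsf C}$, $u\in\alpha(\mathsf C)$) and transitions $(\mathsf I[u_1..u_k],\langle t_1..t_k\rangle)$ for $\langle u_i\rangle\in\alpha(\mathsf I)$, $t_i=(q_i\xrightarrow{p_i}q_i')$ a transition of $\beta(\mathrm{comp}(p_i))$, $\mathfrak P(\mathsf I)=\langle p_1..p_k\rangle$, with $u_i\neq u_j$ or $\mathrm{comp}(p_i)\neq\mathrm{comp}(p_j)$ for $i\ne j$; its pre-set is $\{q_i[u_i]\}$ and post-set $\{q_i'[u_i]\}$. Firing and reachability are standard; markings are sets of places; $\mathrm{Dead}(\mathsf N)$ is the set of markings enabling no transition. A marking is precise if each component $u\in\alpha(\mathsf C)$ has exactly one marked place $q[u]$. A configuration is $(\alpha,m)$ with $m$ precise. CL formulas: $\phi::=\mathsf{emp}\mid\mathsf C(x)\mid\mathsf C^q(x)\mid\mathsf I(x_1..x_{\#(\mathsf I)})\mid\mathsf A(x_1..x_{\#(\mathsf A)})\mid\phi*\phi\mid\exists x.\phi$; a SID is a finite set of rules $\mathsf A(x_1..x_n)\leftarrow\phi$ with $\mathrm{fv}(\phi)=\{x_1..x_n\}$; $(\alpha,m)\models^s_\Delta\phi$ is the least relation where $\mathsf{emp}$ means empty architecture and empty marking, $\mathsf C(x)$ (resp. $\mathsf C^q(x)$) means the architecture has only the component $\mathsf C[s(x)]$ and $m=\{q[s(x)]\}$ for some $q$ (resp. that $q$), $\mathsf I(\vec x)$ means the architecture has only the interaction $\mathsf I[s(\vec x)]$ and $m=\emptyset$,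 predicate atoms are unfolded by rules of $\Delta$, $*$ splits the configuration into two parts with disjoint architectures (pointwise disjoint component sets and interaction relations), and $\exists$ is existential choice of the store value. $\phi\models_\Delta\psi$ for sentences means every model of $\phi$ is a model of $\psi$. Decision problems: $\mathit{deadlock}(\phi,\Delta,\beta)$ asks whether there is a configuration $(\alpha,m)\models_\Delta\phi$ with $\mathrm{Reach}(\mathsf N(\Sigma,\alpha,\beta),m)\cap\mathrm{Dead}(\mathsf N(\Sigma,\alpha,\beta))\neq\emptyset$. $\mathit{reach}(\phi,\langle q_1,\dots,q_k\rangle,\Delta,\beta)$ asks whether there exist $(\alpha,m)\models_\Delta\phi$, $m'\in\mathrm{Reach}(\mathsf N(\Sigma,\alpha,\beta),m)$ and indices $u_1,\dots,u_k$ with $q_1[u_1],\dots,q_k[u_k]$ pairwise distinct and all in $m'$. Linearity: for $\Sigma=(\{\mathsf C\},\mathfrak I,\mathfrak P)$ let $\mathfrak I^{(k)}$ be the interaction types of arity $k$ and let $\Lambda$ consist of the rules $\mathsf L(x,x)\leftarrow\mathsf C(x)*\mathop{\ast}_{\mathsf I\in\mathfrak I^{(1)}}\mathsf I(x)$ and $\mathsf L(x,y)\leftarrow\exists z.\ \mathsf C(x)*\mathop{\ast}_{\mathsf I\in\mathfrak I^{(1)}}\mathsf I(x)*\mathop{\ast}_{\mathsf I\in\mathfrak I^{(2)}}\mathsf I(x,z)*\mathsf L(z,y)$, with $\mathsf L$ a binary predicate symbol not used in $\Delta$. A sentence $\phi$ is linear over $\Delta$ iff $\phi\models_{\Delta\cup\Lambda}\exists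 x\exists y.\ \mathsf L(x,y)$. *)

theory Defs
  imports Main "HOL-Library.Nat_Bijection"
begin

datatype recf = RZero | RSucc | RProj nat | RComp recf "recf list"
  | RPrimRec recf recf | RMin recf

text \<open>Graph of a partial recursive function (arguments given as a list;
  superfluous arguments are ignored).\<close>
inductive recf_eval :: "recf \<Rightarrow> nat list \<Rightarrow> nat \<Rightarrow> bool" where
  zero: "recf_eval RZero xs 0"
| succ: "recf_eval RSucc (x # xs) (Suc x)"
| proj: "i < length xs \<Longrightarrow> recf_eval (RProj i) xs (xs ! i)"
| comp: "length ys = length gs \<Longrightarrow> (\<forall>i < length gs. recf_eval (gs ! i) xs (ys ! i))
          \<Longrightarrow> recf_eval f ys z \<Longrightarrow> recf_eval (RComp f gs) xs z"
| prim0: "recf_eval f xs z \<Longrightarrow> recf_eval (RPrimRec f g) (0 # xs) z"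
| primS: "recf_eval (RPrimRec f g) (n # xs) y \<Longrightarrow> recf_eval g (y # n # xs) z
          \<Longrightarrow> recf_eval (RPrimRec f g) (Suc n # xs) z"
| mini: "recf_eval f (n # xs) 0 \<Longrightarrow> (\<forall>i < n. \<exists>y. recf_eval f (i # xs) (Suc y))
          \<Longrightarrow> recf_eval (RMin f) xs n"

text \<open>A property P of instances (encoded into nat by enc) is decidable on the
  set D of admissible instances (promise problem): some partial recursive
  function answers 1/0 correctly on the code of every admissible instance.\<close>
definition decidable_on :: "'a set \<Rightarrow> ('a \<Rightarrow> bool) \<Rightarrow> ('a \<Rightarrow> nat) \<Rightarrow> bool" where
  "decidable_on D P enc \<longleftrightarrow>
     (\<exists>f. \<forall>x \<in> D. recf_eval f [enc x] (if P x then 1 else 0))"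

text \<open>Ports are naturals; the port set P(C) is a finite set of naturals.
  Interaction types are the indices 0..<length itys; interaction type k
  has port list itys ! k (arity = length).  All ports belong to C.\<close>
definition sig_ok :: "nat set \<Rightarrow> nat list list \<Rightarrow> bool" where
  "sig_ok ports itys \<longleftrightarrow> finite ports \<and>
     (\<forall>ps \<in> set itys. (length ps = 1 \<or> length ps = 2) \<and> set ps \<subseteq> ports)"

text \<open>Universe U = nat.  An architecture: the set alpha(C) and, for each
  interaction type index k, the relation alpha(I_k) (tuples as lists).\<close>
type_synonym arch = "nat set \<times> (nat \<Rightarrow> nat list set)"

text \<open>Behavior of C: finite state machine given by its list of states and its
  list of transitions (q, p, q').  States are naturals.\<close>
type_synonym behavior = "nat list \<times> (nat \<times> nat \<times> nat) list"

definition beh_ok :: "nat set \<Rightarrow> behavior \<Rightarrow> bool" where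
  "beh_ok ports beta \<longleftrightarrow>
     (\<forall>(q, p, q') \<in> set (snd beta). q \<in> set (fst beta) \<and> p \<in> ports \<and> q' \<in> set (fst beta))"

text \<open>Places q[u] are pairs (q,u); markings are sets of places.\<close>
type_synonym marking = "(nat \<times> nat) set"

definition net_trans :: "nat list list \<Rightarrow> arch \<Rightarrow> behavior
    \<Rightarrow> (nat \<times> nat list \<times> (nat \<times> nat \<times> nat) list) set" where
  "net_trans itys A beta = {(k, us, ts). k < length itys \<and> us \<in> snd A k \<and>
      length us = length (itys ! k) \<and> length ts = length us \<and>
      set us \<subseteq> fst A \<and> distinct us \<and>
      (\<forall>i < length ts. ts ! i \<in> set (snd beta) \<and> fst (snd (ts ! i)) = itys ! k ! i)}"

definition pre_set :: "nat \<times> nat list \<times> (nat \<times> nat \<times> nat) list \<Rightarrow> marking" where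
  "pre_set t = (case t of (k, us, ts) \<Rightarrow> {(fst (ts ! i), us ! i) | i. i < length ts})"

definition post_set :: "nat \<times> nat list \<times> (nat \<times> nat \<times> nat) list \<Rightarrow> marking" where
  "post_set t = (case t of (k, us, ts) \<Rightarrow> {(snd (snd (ts ! i)), us ! i) | i. i < length ts})"

definition fire_step :: "nat list list \<Rightarrow> arch \<Rightarrow> behavior \<Rightarrow> marking \<Rightarrow> marking \<Rightarrow> bool" where
  "fire_step itys A beta m m' \<longleftrightarrow>
     (\<exists>t \<in> net_trans itys A beta. pre_set t \<subseteq> m \<and> m' = (m - pre_set t) \<union> post_set t)"

definition reachable :: "nat list list \<Rightarrow> arch \<Rightarrow> behavior \<Rightarrow> marking \<Rightarrow> marking \<Rightarrow> bool" where
  "reachable itys A beta = (fire_step itys A beta)\<^sup>*\<^sup>*"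

definition dead :: "nat list list \<Rightarrow> arch \<Rightarrow> behavior \<Rightarrow> marking \<Rightarrow> bool" where
  "dead itys A beta m \<longleftrightarrow> (\<forall>t \<in> net_trans itys A beta. \<not> pre_set t \<subseteq> m)"

definition precise :: "arch \<Rightarrow> behavior \<Rightarrow> marking \<Rightarrow> bool" where
  "precise A beta m \<longleftrightarrow> m \<subseteq> set (fst beta) \<times> fst A \<and>
     (\<forall>u \<in> fst A. \<exists>!q. (q, u) \<in> m)"

text \<open>Variables, states, interaction type indices and predicate symbols are naturals.\<close>
datatype form = Emp | CAtom nat | CStAtom nat nat | IAtom nat "nat list"
  | PAtom nat "nat list" | Star form form | Ex nat form

primrec fv :: "form \<Rightarrow> nat set" where
  "fv Emp = {}"
| "fv (CAtom x) = {x}"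
| "fv (CStAtom x q) = {x}"
| "fv (IAtom k xs) = set xs"
| "fv (PAtom a xs) = set xs"
| "fv (Star f g) = fv f \<union> fv g"
| "fv (Ex x f) = fv f - {x}"

primrec preds :: "form \<Rightarrow> nat set" where
  "preds Emp = {}"
| "preds (CAtom x) = {}"
| "preds (CStAtom x q) = {}"
| "preds (IAtom k xs) = {}"
| "preds (PAtom a xs) = {a}"
| "preds (Star f g) = preds f \<union> preds g"
| "preds (Ex x f) = preds f"

primrec wf_form :: "nat list list \<Rightarrow> nat set \<Rightarrow> form \<Rightarrow> bool" where
  "wf_form itys Q Emp = True"
| "wf_form itys Q (CAtom x) = True"
| "wf_form itys Q (CStAtom x q) = (q \<in> Q)"
| "wf_form itys Q (IAtom k xs) = (k < length itys \<and> length xs = length (itys ! k))"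
| "wf_form itys Q (PAtom a xs) = True"
| "wf_form itys Q (Star f g) = (wf_form itys Q f \<and> wf_form itys Q g)"
| "wf_form itys Q (Ex x f) = wf_form itys Q f"

text \<open>A rule A(x1..xn) <- body is (A, [x1..xn], body); an SID is a finite list of rules.\<close>
type_synonym rule = "nat \<times> nat list \<times> form"
type_synonym sid = "rule list"

definition sid_ok :: "nat list list \<Rightarrow> nat set \<Rightarrow> sid \<Rightarrow> bool" where
  "sid_ok itys Q D \<longleftrightarrow>
     (\<forall>(a, ps, b) \<in> set D. distinct ps \<and> fv b = set ps \<and> wf_form itys Q b) \<and>
     (\<forall>(a, ps, b) \<in> set D. \<forall>(a', ps', b') \<in> set D. a = a' \<longrightarrow> length ps = length ps')"

definition sid_preds :: "sid \<Rightarrow> nat set" where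
  "sid_preds D = (\<Union>(a, ps, b) \<in> set D. {a} \<union> preds b)"

definition arch_empty :: arch where
  "arch_empty = ({}, \<lambda>k. {})"

definition arch_disj :: "arch \<Rightarrow> arch \<Rightarrow> bool" where
  "arch_disj A B \<longleftrightarrow> fst A \<inter> fst B = {} \<and> (\<forall>k. snd A k \<inter> snd B k = {})"

definition arch_union :: "arch \<Rightarrow> arch \<Rightarrow> arch" where
  "arch_union A B = (fst A \<union> fst B, \<lambda>k. snd A k \<union> snd B k)"

inductive sat :: "nat list list \<Rightarrow> sid \<Rightarrow> nat set \<Rightarrow> (nat \<Rightarrow> nat) \<Rightarrow> form \<Rightarrow> arch \<Rightarrow> marking \<Rightarrow> bool"
  for itys :: "nat list list" and D :: sid and Q :: "nat set" where
  sat_emp: "sat itys D Q s Emp arch_empty {}"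
| sat_comp: "q \<in> Q \<Longrightarrow> sat itys D Q s (CAtom x) ({s x}, \<lambda>k. {}) {(q, s x)}"
| sat_compst: "q \<in> Q \<Longrightarrow> sat itys D Q s (CStAtom x q) ({s x}, \<lambda>k. {}) {(q, s x)}"
| sat_inter: "k < length itys \<Longrightarrow> length xs = length (itys ! k) \<Longrightarrow>
     sat itys D Q s (IAtom k xs) ({}, \<lambda>j. if j = k then {map s xs} else {}) {}"
| sat_pred: "(a, ps, b) \<in> set D \<Longrightarrow> length ps = length xs \<Longrightarrow>
     (\<forall>i < length ps. s' (ps ! i) = s (xs ! i)) \<Longrightarrow> sat itys D Q s' b A m \<Longrightarrow>
     sat itys D Q s (PAtom a xs) A m"
| sat_star: "sat itys D Q s f A1 m1 \<Longrightarrow> sat itys D Q s g A2 m2 \<Longrightarrow> arch_disj A1 A2 \<Longrightarrow>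
     sat itys D Q s (Star f g) (arch_union A1 A2) (m1 \<union> m2)"
| sat_ex: "sat itys D Q (s(x := u)) f A m \<Longrightarrow> sat itys D Q s (Ex x f) A m"

definition models :: "nat list list \<Rightarrow> sid \<Rightarrow> nat set \<Rightarrow> form \<Rightarrow> arch \<Rightarrow> marking \<Rightarrow> bool" where
  "models itys D Q phi A m \<longleftrightarrow> (\<exists>s. sat itys D Q s phi A m)"

definition entails :: "nat list list \<Rightarrow> sid \<Rightarrow> nat set \<Rightarrow> form \<Rightarrow> form \<Rightarrow> bool" where
  "entails itys D Q phi psi \<longleftrightarrow> (\<forall>A m. models itys D Q phi A m \<longrightarrow> models itys D Q psi A m)"

primrec stars :: "form list \<Rightarrow> form" where
  "stars [] = Emp"
| "stars (f # fs) = Star f (stars fs)"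

definition itypes_of_arity :: "nat list list \<Rightarrow> nat \<Rightarrow> nat list" where
  "itypes_of_arity itys n = filter (\<lambda>k. length (itys ! k) = n) [0..<length itys]"

text \<open>The rules Lambda for predicate symbol L, using variables x=0, y=1, z=2.\<close>
definition lin_rules :: "nat list list \<Rightarrow> nat \<Rightarrow> sid" where
  "lin_rules itys L =
    [ (L, [0, 0], Star (CAtom 0) (stars (map (\<lambda>k. IAtom k [0]) (itypes_of_arity itys 1)))),
      (L, [0, 1], Ex 2 (Star (CAtom 0)
                   (Star (stars (map (\<lambda>k. IAtom k [0]) (itypes_of_arity itys 1)))
                   (Star (stars (map (\<lambda>k. IAtom k [0, 2]) (itypes_of_arity itys 2)))
                         (PAtom L [2, 1]))))) ]"

definition linear :: "nat list list \<Rightarrow> nat set \<Rightarrow> sid \<Rightarrow> form \<Rightarrow> bool" where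
  "linear itys Q D phi \<longleftrightarrow>
     (\<forall>L. L \<notin> sid_preds D \<and> L \<notin> preds phi \<longrightarrow>
        entails itys (D @ lin_rules itys L) Q phi (Ex 0 (Ex 1 (PAtom L [0, 1]))))"

definition deadlock :: "nat list list \<Rightarrow> form \<Rightarrow> sid \<Rightarrow> behavior \<Rightarrow> bool" where
  "deadlock itys phi D beta \<longleftrightarrow>
     (\<exists>A m m'. models itys D (set (fst beta)) phi A m \<and> precise A beta m \<and>
        reachable itys A beta m m' \<and> dead itys A beta m')"

definition reach1 :: "nat list list \<Rightarrow> form \<Rightarrow> nat \<Rightarrow> sid \<Rightarrow> behavior \<Rightarrow> bool" where
  "reach1 itys phi q1 D beta \<longleftrightarrow>
     (\<exists>A m m' u. models itys D (set (fst beta)) phi A m \<and> precise A beta m \<and>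
        reachable itys A beta m m' \<and> (q1, u) \<in> m')"

primrec enc_form :: "form \<Rightarrow> nat" where
  "enc_form Emp = list_encode [0]"
| "enc_form (CAtom x) = list_encode [1, x]"
| "enc_form (CStAtom x q) = list_encode [2, x, q]"
| "enc_form (IAtom k xs) = list_encode [3, k, list_encode xs]"
| "enc_form (PAtom a xs) = list_encode [4, a, list_encode xs]"
| "enc_form (Star f g) = list_encode [5, enc_form f, enc_form g]"
| "enc_form (Ex x f) = list_encode [6, x, enc_form f]"

definition enc_sid :: "sid \<Rightarrow> nat" where
  "enc_sid D = list_encode (map (\<lambda>(a, ps, b). list_encode [a, list_encode ps, enc_form b]) D)"

definition enc_beh :: "behavior \<Rightarrow> nat" where
  "enc_beh beta = list_encode [list_encode (fst beta),
     list_encode (map (\<lambda>(q, p, q'). list_encode [q, p, q']) (snd beta))]"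

definition lin_instances :: "nat set \<Rightarrow> nat list list \<Rightarrow> (sid \<times> behavior \<times> form) set" where
  "lin_instances ports itys = {(D, beta, phi).
     sid_ok itys (set (fst beta)) D \<and> beh_ok ports beta \<and>
     fv phi = {} \<and> wf_form itys (set (fst beta)) phi \<and>
     linear itys (set (fst beta)) D phi}"

definition reach_instances :: "nat set \<Rightarrow> nat list list \<Rightarrow> ((sid \<times> behavior \<times> form) \<times> nat) set" where
  "reach_instances ports itys = {((D, beta, phi), q1).
     (D, beta, phi) \<in> lin_instances ports itys \<and> q1 \<in> set (fst beta)}"

definition enc_dl :: "sid \<times> behavior \<times> form \<Rightarrow> nat" where
  "enc_dl x = (case x of (D, beta, phi) \<Rightarrow> list_encode [enc_sid D, enc_beh beta, enc_form phi])"

definition enc_reach :: "(sid \<times> behavior \<times> form) \<times> nat \<Rightarrow> nat" where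
  "enc_reach x = (case x of ((D, beta, phi), q) \<Rightarrow>
     list_encode [enc_sid D, enc_beh beta, enc_form phi, q])"

end

theory Submission
  imports Defs "HOL-Library.Countable"
begin

text \<open>A partial recursive function is compiled into a program on counters, and the program into a
  nondeterministic head that walks on a bounded tape whose cells store single units of the counters.
  A chain of components simulates the tape: adjacent components hand over the head by sending its
  state in unary, so that the interaction types do not depend on the program. Each component that
  takes part in carrying the head can idle forever; hence a dead marking is reachable, for some
  length of the chain, iff the program halts, iff the state \<open>0\<close> is reachable. The two inputs \<open>a\<close>
  and \<open>b\<close> of the program occur only in the sentence, as the numbers of cells of two kinds.

  Given a decider \<open>f\<close>, let the program halt on \<open>a\<close>, \<open>b\<close> iff \<open>f\<close> answers \<open>0\<close> on the instance with the
  SID coded by \<open>a\<close>, the behavior coded by \<open>b\<close> and the sentence for the inputs \<open>a\<close>, \<open>b\<close>. On the codes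
  of its own SID and behavior it halts iff \<open>f\<close> claims that it does not.\<close>

section \<open>Counter programs\<close>

text \<open>The signature is fixed first, while the decider to be refuted, and with it the program,
  may be arbitrarily large; all dependence on the program must therefore sit in the behavior and the
  SID. No program computes the code of its own SID and behavior: it receives these two numbers as
  inputs, and only the code of the sentence, which grows with the inputs, has to be shown
  computable. Hence the numbering of states and the lists that make up the behavior may be chosen
  non-constructively, and neither a universal function nor a fixed-point theorem occurs. Programs
  are nondeterministic and only the existence of a complete run counts. A wrong guess, such as
  leaving a loop too early, is caught by a later \<open>Zero\<close>; on the net it becomes a run
  that idles forever instead of a deadlock. A tape of fixed length bounds the registers, but the
  recursive rule of predicate \<open>0\<close> offers chains with any number of free cells, and a
  complete run of \<open>n\<close> small steps needs at most \<open>n\<close> of them.\<close>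

datatype prog = Skip | Inc nat | Dec nat | Zero nat | Seq prog prog | Loop prog

instance prog :: countable
  by countable_datatype

type_synonym store = "nat \<Rightarrow> nat"

primrec sem :: "prog \<Rightarrow> store \<Rightarrow> store \<Rightarrow> bool" where
  "sem Skip \<sigma> \<tau> \<longleftrightarrow> \<tau> = \<sigma>"
| "sem (Inc x) \<sigma> \<tau> \<longleftrightarrow> \<tau> = \<sigma>(x := Suc (\<sigma> x))"
| "sem (Dec x) \<sigma> \<tau> \<longleftrightarrow> 0 < \<sigma> x \<and> \<tau> = \<sigma>(x := \<sigma> x - 1)"
| "sem (Zero x) \<sigma> \<tau> \<longleftrightarrow> \<sigma> x = 0 \<and> \<tau> = \<sigma>"
| "sem (Seq p q) \<sigma> \<tau> \<longleftrightarrow> (\<exists>\<rho>. sem p \<sigma> \<rho> \<and> sem q \<rho> \<tau>)"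
| "sem (Loop p) \<sigma> \<tau> \<longleftrightarrow> (sem p)\<^sup>*\<^sup>* \<sigma> \<tau>"

text \<open>\<open>Loop\<close> may be left at any time; the final \<open>Zero x\<close> discards
  the runs that leave it before \<open>x\<close> is empty. With no targets this clears
  \<open>x\<close>, with two it duplicates the value.\<close>

definition Move :: "nat \<Rightarrow> nat list \<Rightarrow> prog" where
  "Move x ys = Seq (Loop (Seq (Dec x) (fold (\<lambda>y p. Seq p (Inc y)) ys Skip))) (Zero x)"

text \<open>A program without runs, the translation of functions that are nowhere defined on the
  given number of arguments.\<close>

definition Fail :: prog where
  "Fail = Seq (Inc 0) (Zero 0)"

lemma sem_Fail [simp]: "\<not> sem Fail \<sigma> \<tau>"
  by (auto simp: Fail_def)

lemma sem_while: "sem (Seq (Loop p) (Zero x)) \<sigma> \<tau> \<longleftrightarrow> (sem p)\<^sup>*\<^sup>* \<sigma> \<tau> \<and> \<tau> x = 0"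
  by auto

lemma Loop_invariant:
  assumes "(sem p)\<^sup>*\<^sup>* \<sigma> \<rho>" "\<And>a b. sem p a b \<Longrightarrow> I b = I a"
  shows "I \<rho> = I \<sigma>"
  using assms by (induction rule: rtranclp_induct) auto

text \<open>The invariant is the final store as predicted from the current one, which no round of
  the loop changes. Conversely, induction on the value of \<open>x\<close> constructs the run. The
  lemmas for one and two targets follow the same pattern.\<close>

lemma sem_Move_nil [simp]: "sem (Move x []) \<sigma> \<tau> \<longleftrightarrow> \<tau> = \<sigma>(x := 0)"
proof
  let ?b = "Seq (Dec x) Skip"
  have step: "b(x := 0) = a(x := 0)" if "sem ?b a b" for a b
  proof -
    have "b = a(x := a x - 1)" using that by auto
    then show ?thesis by simp
  qed
  have inv: "(sem ?b)\<^sup>*\<^sup>* \<sigma> \<rho> \<Longrightarrow> \<rho>(x := 0) = \<sigma>(x := 0)" for \<rho>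
    by (rule Loop_invariant[where I = "\<lambda>s. s(x := 0)"]) (auto dest: step simp del: sem.simps)
  show "\<tau> = \<sigma>(x := 0)" if "sem (Move x []) \<sigma> \<tau>"
  proof -
    have "(sem ?b)\<^sup>*\<^sup>* \<sigma> \<tau>" and zero: "\<tau> x = 0"
      using that by (simp_all only: Move_def sem_while fold.simps id_apply comp_apply)
    from this(1) have "\<tau>(x := 0) = \<sigma>(x := 0)" by (rule inv)
    moreover have "\<tau>(x := 0) = \<tau>" using zero by auto
    ultimately show ?thesis by simp
  qed
  have "\<sigma> x = n \<Longrightarrow> (sem ?b)\<^sup>*\<^sup>* \<sigma> (\<sigma>(x := 0))" for n
  proof (induction n arbitrary: \<sigma>)
    case 0
    then show ?case by (metis fun_upd_triv rtranclp.rtrancl_refl)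
  next
    case (Suc n)
    then have "sem ?b \<sigma> (\<sigma>(x := n))" by auto
    moreover have "(sem ?b)\<^sup>*\<^sup>* (\<sigma>(x := n)) (\<sigma>(x := 0))"
      using Suc.IH[of "\<sigma>(x := n)"] by (simp only: fun_upd_same fun_upd_upd)
    ultimately show ?case by (rule converse_rtranclp_into_rtranclp)
  qed
  then show "sem (Move x []) \<sigma> \<tau>" if "\<tau> = \<sigma>(x := 0)"
    using that by (auto simp: Move_def)
qed

lemma sem_Move_one [simp]:
  assumes "x \<noteq> y"
  shows "sem (Move x [y]) \<sigma> \<tau> \<longleftrightarrow> \<tau> = \<sigma>(x := 0, y := \<sigma> y + \<sigma> x)"
proof
  let ?b = "Seq (Dec x) (Seq Skip (Inc y))"
  have step: "b(x := 0, y := b y + b x) = a(x := 0, y := a y + a x)" if "sem ?b a b" for a b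
  proof -
    have "b = a(x := a x - 1, y := Suc (a y))" "0 < a x" using that assms by auto
    then show ?thesis using assms by auto
  qed
  have inv: "(sem ?b)\<^sup>*\<^sup>* \<sigma> \<rho> \<Longrightarrow> \<rho>(x := 0, y := \<rho> y + \<rho> x) = \<sigma>(x := 0, y := \<sigma> y + \<sigma> x)" for \<rho>
    by (rule Loop_invariant[where I = "\<lambda>s. s(x := 0, y := s y + s x)"]) (auto dest: step simp del: sem.simps)
  show "\<tau> = \<sigma>(x := 0, y := \<sigma> y + \<sigma> x)" if "sem (Move x [y]) \<sigma> \<tau>"
  proof -
    have "(sem ?b)\<^sup>*\<^sup>* \<sigma> \<tau>" and zero: "\<tau> x = 0"
      using that by (simp_all only: Move_def sem_while fold.simps id_apply comp_apply)
    from this(1) have "\<tau>(x := 0, y := \<tau> y + \<tau> x) = \<sigma>(x := 0, y := \<sigma> y + \<sigma> x)" by (rule inv)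
    moreover have "\<tau>(x := 0, y := \<tau> y + \<tau> x) = \<tau>" using zero by auto
    ultimately show ?thesis by simp
  qed
  have "\<sigma> x = n \<Longrightarrow> (sem ?b)\<^sup>*\<^sup>* \<sigma> (\<sigma>(x := 0, y := \<sigma> y + \<sigma> x))" for n
  proof (induction n arbitrary: \<sigma>)
    case 0
    then have "\<sigma>(x := 0, y := \<sigma> y + \<sigma> x) = \<sigma>" by auto
    then show ?case by (simp del: sem.simps fun_upd_apply)
  next
    case (Suc n)
    let ?s = "\<sigma>(x := n, y := Suc (\<sigma> y))"
    have "sem ?b \<sigma> ?s" using Suc.prems assms by auto
    moreover have "(sem ?b)\<^sup>*\<^sup>* ?s (?s(x := 0, y := ?s y + ?s x))"
      by (rule Suc.IH) (use assms in simp)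
    moreover have "?s(x := 0, y := ?s y + ?s x) = \<sigma>(x := 0, y := \<sigma> y + \<sigma> x)"
      using Suc.prems assms by auto
    ultimately show ?case by (simp only: converse_rtranclp_into_rtranclp)
  qed
  then show "sem (Move x [y]) \<sigma> \<tau>" if "\<tau> = \<sigma>(x := 0, y := \<sigma> y + \<sigma> x)"
    using that assms by (auto simp: Move_def)
qed

lemma sem_Move_two [simp]:
  assumes "x \<noteq> y" "x \<noteq> z" "y \<noteq> z"
  shows "sem (Move x [y, z]) \<sigma> \<tau> \<longleftrightarrow> \<tau> = \<sigma>(x := 0, y := \<sigma> y + \<sigma> x, z := \<sigma> z + \<sigma> x)"
proof
  let ?b = "Seq (Dec x) (Seq (Seq Skip (Inc y)) (Inc z))"
  have step: "b(x := 0, y := b y + b x, z := b z + b x) = a(x := 0, y := a y + a x, z := a z + a x)"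
    if "sem ?b a b" for a b
  proof -
    have "b = a(x := a x - 1, y := Suc (a y), z := Suc (a z))" "0 < a x" using that assms by auto
    then show ?thesis using assms by auto
  qed
  have inv: "(sem ?b)\<^sup>*\<^sup>* \<sigma> \<rho> \<Longrightarrow> \<rho>(x := 0, y := \<rho> y + \<rho> x, z := \<rho> z + \<rho> x)
      = \<sigma>(x := 0, y := \<sigma> y + \<sigma> x, z := \<sigma> z + \<sigma> x)" for \<rho>
    by (rule Loop_invariant[where I = "\<lambda>s. s(x := 0, y := s y + s x, z := s z + s x)"]) (auto dest: step simp del: sem.simps)
  show "\<tau> = \<sigma>(x := 0, y := \<sigma> y + \<sigma> x, z := \<sigma> z + \<sigma> x)" if "sem (Move x [y, z]) \<sigma> \<tau>"
  proof -
    have "(sem ?b)\<^sup>*\<^sup>* \<sigma> \<tau>" and zero: "\<tau> x = 0"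
      using that by (simp_all only: Move_def sem_while fold.simps id_apply comp_apply)
    from this(1) have "\<tau>(x := 0, y := \<tau> y + \<tau> x, z := \<tau> z + \<tau> x) = \<sigma>(x := 0, y := \<sigma> y + \<sigma> x, z := \<sigma> z + \<sigma> x)" by (rule inv)
    moreover have "\<tau>(x := 0, y := \<tau> y + \<tau> x, z := \<tau> z + \<tau> x) = \<tau>" using zero by auto
    ultimately show ?thesis by simp
  qed
  have "\<sigma> x = n \<Longrightarrow> (sem ?b)\<^sup>*\<^sup>* \<sigma> (\<sigma>(x := 0, y := \<sigma> y + \<sigma> x, z := \<sigma> z + \<sigma> x))" for n
  proof (induction n arbitrary: \<sigma>)
    case 0
    then have "\<sigma>(x := 0, y := \<sigma> y + \<sigma> x, z := \<sigma> z + \<sigma> x) = \<sigma>" by auto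
    then show ?case by (simp del: sem.simps fun_upd_apply)
  next
    case (Suc n)
    let ?s = "\<sigma>(x := n, y := Suc (\<sigma> y), z := Suc (\<sigma> z))"
    have "sem ?b \<sigma> ?s" using Suc.prems assms by auto
    moreover have "(sem ?b)\<^sup>*\<^sup>* ?s (?s(x := 0, y := ?s y + ?s x, z := ?s z + ?s x))"
      by (rule Suc.IH) (use assms in simp)
    moreover have "?s(x := 0, y := ?s y + ?s x, z := ?s z + ?s x)
        = \<sigma>(x := 0, y := \<sigma> y + \<sigma> x, z := \<sigma> z + \<sigma> x)"
      using Suc.prems assms by auto
    ultimately show ?case by (simp only: converse_rtranclp_into_rtranclp)
  qed
  then show "sem (Move x [y, z]) \<sigma> \<tau>" if "\<tau> = \<sigma>(x := 0, y := \<sigma> y + \<sigma> x, z := \<sigma> z + \<sigma> x)"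
    using that assms by (auto simp: Move_def)
qed

text \<open>Moving destroys the source, so a second copy is parked in the scratch register
  \<open>Suc y\<close> and moved back.\<close>

definition Copy :: "nat \<Rightarrow> nat \<Rightarrow> prog" where
  "Copy x y = Seq (Move x [y, Suc y]) (Move (Suc y) [x])"

lemma sem_Copy:
  assumes "x < y" "\<sigma> y = 0" "\<sigma> (Suc y) = 0"
  shows "sem (Copy x y) \<sigma> \<tau> \<longleftrightarrow> \<tau> = \<sigma>(y := \<sigma> x)"
proof -
  have "\<sigma>(x := 0, y := \<sigma> y + \<sigma> x, Suc y := \<sigma> (Suc y) + \<sigma> x, Suc y := 0, x := \<sigma> x) = \<sigma>(y := \<sigma> x)"
    using assms by auto
  then show ?thesis using assms by (auto simp: Copy_def)
qed

text \<open>The register \<open>N\<close> receives the result; the registers above it are scratch space, zero on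
  entry and on exit.\<close>

definition implements :: "recf \<Rightarrow> nat list \<Rightarrow> nat \<Rightarrow> prog \<Rightarrow> bool" where
  "implements f xs N p \<longleftrightarrow> (\<forall>\<sigma> \<tau>. (\<forall>r\<ge>N. \<sigma> r = 0) \<longrightarrow>
     (sem p \<sigma> \<tau> \<longleftrightarrow> (\<exists>v. recf_eval f (map \<sigma> xs) v \<and> \<tau> = \<sigma>(N := v))))"

lemma implementsD:
  "implements f xs N p \<Longrightarrow> (\<And>r. r \<ge> N \<Longrightarrow> \<sigma> r = 0) \<Longrightarrow>
    sem p \<sigma> \<tau> \<longleftrightarrow> (\<exists>v. recf_eval f (map \<sigma> xs) v \<and> \<tau> = \<sigma>(N := v))"
  by (auto simp: implements_def)

section \<open>Compilation of partial recursive functions\<close>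

inductive_cases eval_ZeroE: "recf_eval RZero xs v"
inductive_cases eval_SuccE: "recf_eval RSucc xs v"
inductive_cases eval_ProjE: "recf_eval (RProj i) xs v"
inductive_cases eval_CompE: "recf_eval (RComp f gs) xs v"
inductive_cases eval_PrimE: "recf_eval (RPrimRec f g) xs v"
inductive_cases eval_MinE: "recf_eval (RMin f) xs v"

lemma map_upd_ge:
  fixes N :: nat
  assumes "set xs \<subseteq> {..<N}" "N \<le> r"
  shows "map (\<sigma>(r := v)) xs = map \<sigma> xs"
proof (rule map_cong[OF refl])
  fix x assume "x \<in> set xs"
  then have "x < N" using assms(1) by blast
  then have "x \<noteq> r" using assms(2) by simp
  then show "(\<sigma>(r := v)) x = \<sigma> x" by simp
qed

text \<open>The result register is zero on entry, so nothing is left to do.\<close>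

lemma implements_Zero: "implements RZero xs N Skip"
proof -
  have "recf_eval RZero ys v \<longleftrightarrow> v = 0" for ys v
    by (auto intro: recf_eval.zero elim: eval_ZeroE)
  moreover have "\<sigma>(N := 0) = \<sigma>" if "\<forall>r\<ge>N. \<sigma> r = 0" for \<sigma> :: store
    using that by auto
  ultimately show ?thesis by (simp add: implements_def)
qed

lemma implements_Fail: "(\<And>\<sigma> v. \<not> recf_eval f (map \<sigma> xs) v) \<Longrightarrow> implements f xs N Fail"
  by (auto simp: implements_def)

lemma implements_Succ:
  assumes "x < N"
  shows "implements RSucc (x # xs) N (Seq (Copy x N) (Inc N))"
proof -
  have "recf_eval RSucc (map \<sigma> (x # xs)) v \<longleftrightarrow> v = Suc (\<sigma> x)" for \<sigma> v
    by (auto intro: recf_eval.succ elim: eval_SuccE)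
  then show ?thesis using assms by (simp add: implements_def sem_Copy)
qed

lemma implements_Proj:
  assumes "set xs \<subseteq> {..<N}" "i < length xs"
  shows "implements (RProj i) xs N (Copy (xs ! i) N)"
proof -
  have "xs ! i < N" using assms by (meson lessThan_iff nth_mem subsetD)
  moreover have "recf_eval (RProj i) (map \<sigma> xs) v \<longleftrightarrow> v = \<sigma> (xs ! i)" for \<sigma> v
    using assms recf_eval.proj[of i "map \<sigma> xs"] by (auto elim: eval_ProjE)
  ultimately show ?thesis by (auto simp: implements_def sem_Copy)
qed

primrec Eval_all :: "prog list \<Rightarrow> prog" where
  "Eval_all [] = Skip"
| "Eval_all (p # ps) = Seq p (Eval_all ps)"

definition store_put :: "nat \<Rightarrow> nat list \<Rightarrow> store \<Rightarrow> store" where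
  "store_put M ys \<sigma> = (\<lambda>r. if M \<le> r \<and> r < M + length ys then ys ! (r - M) else \<sigma> r)"

lemma store_put_Cons: "store_put M (y # ys) \<sigma> = store_put (Suc M) ys (\<sigma>(M := y))"
proof
  fix r
  show "store_put M (y # ys) \<sigma> r = store_put (Suc M) ys (\<sigma>(M := y)) r"
    by (cases "M < r") (auto simp: store_put_def Suc_diff_Suc[symmetric])
qed

lemma store_put_Nil [simp]: "store_put M [] \<sigma> = \<sigma>"
  by (auto simp: store_put_def)

text \<open>The results obtained so far lie below the target \<open>M + j\<close> of the next
  program, hence outside its scratch space, and by \<open>N \<le> M\<close> they do not touch the
  argument registers.\<close>

lemma sem_Eval_all:
  assumes "set xs \<subseteq> {..<N}" "N \<le> M" "length ps = length gs"
    and "\<And>j. j < length gs \<Longrightarrow> implements (gs ! j) xs (M + j) (ps ! j)"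
    and "\<And>r. r \<ge> M \<Longrightarrow> \<sigma> r = 0"
  shows "sem (Eval_all ps) \<sigma> \<tau> \<longleftrightarrow>
    (\<exists>ys. length ys = length gs \<and> (\<forall>i<length gs. recf_eval (gs ! i) (map \<sigma> xs) (ys ! i)) \<and>
      \<tau> = store_put M ys \<sigma>)"
  using assms
proof (induction gs arbitrary: ps M \<sigma>)
  case Nil
  from Nil.prems(3) show ?case by simp
next
  case (Cons g gs)
  from Cons.prems(3) obtain p ps' where ps: "ps = p # ps'" by (cases ps) auto
  have p: "implements g xs M p" using Cons.prems(4)[of 0] ps by auto
  have IH: "sem (Eval_all ps') (\<sigma>(M := y)) \<tau> \<longleftrightarrow>
    (\<exists>ys. length ys = length gs \<and> (\<forall>i<length gs. recf_eval (gs ! i) (map \<sigma> xs) (ys ! i)) \<and>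
      \<tau> = store_put (Suc M) ys (\<sigma>(M := y)))" for y
  proof -
    have "map (\<sigma>(M := y)) xs = map \<sigma> xs" using Cons.prems(1,2) by (rule map_upd_ge)
    moreover have "implements (gs ! j) xs (Suc M + j) (ps' ! j)" if "j < length gs" for j
      using Cons.prems(4)[of "Suc j"] ps that by auto
    moreover have "N \<le> Suc M" "length ps' = length gs" using Cons.prems(2,3) ps by simp_all
    moreover have "(\<sigma>(M := y)) r = 0" if "Suc M \<le> r" for r
      using Cons.prems(5)[of r] that by simp
    ultimately show ?thesis
      using Cons.IH[OF Cons.prems(1), of "Suc M" ps' "\<sigma>(M := y)"] by (simp only:)
  qed
  have "sem (Eval_all ps) \<sigma> \<tau> \<longleftrightarrow> (\<exists>y. recf_eval g (map \<sigma> xs) y \<and> sem (Eval_all ps') (\<sigma>(M := y)) \<tau>)"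
    using implementsD[OF p Cons.prems(5)] by (simp add: ps) blast
  also have "\<dots> \<longleftrightarrow> (\<exists>y ys. recf_eval g (map \<sigma> xs) y \<and> length ys = length gs \<and>
      (\<forall>i<length gs. recf_eval (gs ! i) (map \<sigma> xs) (ys ! i)) \<and> \<tau> = store_put M (y # ys) \<sigma>)"
    by (auto simp: IH store_put_Cons)
  also have "\<dots> \<longleftrightarrow> (\<exists>ys. length ys = length (g # gs) \<and>
      (\<forall>i<length (g # gs). recf_eval ((g # gs) ! i) (map \<sigma> xs) (ys ! i)) \<and> \<tau> = store_put M ys \<sigma>)"
    (is "?L \<longleftrightarrow> ?R")
  proof
    assume ?L
    then obtain y ys where "recf_eval g (map \<sigma> xs) y" "length ys = length gs"
      "\<forall>i<length gs. recf_eval (gs ! i) (map \<sigma> xs) (ys ! i)" "\<tau> = store_put M (y # ys) \<sigma>" by blast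
    then show ?R by (intro exI[of _ "y # ys"]) (auto simp: nth_Cons split: nat.splits)
  next
    assume ?R
    then obtain zs where "length zs = length (g # gs)"
      "\<forall>i<length (g # gs). recf_eval ((g # gs) ! i) (map \<sigma> xs) (zs ! i)" "\<tau> = store_put M zs \<sigma>" by blast
    moreover then obtain z zs' where "zs = z # zs'" by (cases zs) auto
    ultimately show ?L by (intro exI[of _ z] exI[of _ zs']) (auto simp: All_less_Suc2)
  qed
  finally show ?case .
qed

lemma sem_clear:
  "sem (Eval_all (map (\<lambda>r. Move r []) rs)) \<sigma> \<tau> \<longleftrightarrow> \<tau> = (\<lambda>r. if r \<in> set rs then 0 else \<sigma> r)"
proof (induction rs arbitrary: \<sigma>)
  case (Cons a rs)
  have "(\<lambda>r. if r \<in> set rs then 0 else (\<sigma>(a := 0)) r) = (\<lambda>r. if r \<in> set (a # rs) then 0 else \<sigma> r)"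
    by auto
  then show ?case by (simp only: list.map Eval_all.simps sem.simps(5) sem_Move_nil Cons.IH) simp
qed auto

text \<open>Arguments must lie below the result register, so the values of \<open>gs\<close> go to
  the registers from \<open>Suc N\<close> on and the value of \<open>f\<close> above them. Clearing
  the values and moving the result down to \<open>N\<close> restores the zero scratch space.\<close>

lemma implements_Comp:
  assumes xs: "set xs \<subseteq> {..<N}" and len: "length ps = length gs"
    and ps: "\<And>j. j < length gs \<Longrightarrow> implements (gs ! j) xs (Suc N + j) (ps ! j)"
    and p: "implements f [Suc N..<Suc N + length gs] (Suc N + length gs) p"
  shows "implements (RComp f gs) xs N
    (Seq (Eval_all ps) (Seq p (Seq (Eval_all (map (\<lambda>r. Move r []) [Suc N..<Suc N + length gs]))
       (Move (Suc N + length gs) [N]))))"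
  unfolding implements_def
proof (intro allI impI)
  fix \<sigma> \<tau> :: store
  let ?m = "length gs"
  let ?c = "Seq (Eval_all (map (\<lambda>r. Move r []) [Suc N..<Suc N + ?m])) (Move (Suc N + ?m) [N])"
  assume "\<forall>r\<ge>N. \<sigma> r = 0"
  then have z: "\<And>r. r \<ge> N \<Longrightarrow> \<sigma> r = 0" by blast
  have 1: "sem (Eval_all ps) \<sigma> \<rho> \<longleftrightarrow>
    (\<exists>ys. length ys = ?m \<and> (\<forall>i<?m. recf_eval (gs ! i) (map \<sigma> xs) (ys ! i)) \<and>
      \<rho> = store_put (Suc N) ys \<sigma>)" for \<rho>
    by (rule sem_Eval_all[OF xs _ len ps]) (simp_all add: z)
  have 2: "sem (Seq p ?c) (store_put (Suc N) ys \<sigma>) \<tau> \<longleftrightarrow> (\<exists>v. recf_eval f ys v \<and> \<tau> = \<sigma>(N := v))"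
    if l: "length ys = ?m" for ys
  proof -
    have "map (store_put (Suc N) ys \<sigma>) [Suc N..<Suc N + ?m] = ys"
      using l by (intro nth_equalityI) (auto simp: store_put_def simp del: upt_Suc)
    then have "sem p (store_put (Suc N) ys \<sigma>) \<rho> \<longleftrightarrow>
      (\<exists>v. recf_eval f ys v \<and> \<rho> = (store_put (Suc N) ys \<sigma>)(Suc N + ?m := v))" for \<rho>
      by (subst implementsD[OF p]) (use l in \<open>simp_all add: z store_put_def\<close>)
    moreover have "sem ?c ((store_put (Suc N) ys \<sigma>)(Suc N + ?m := v)) \<tau> \<longleftrightarrow> \<tau> = \<sigma>(N := v)" for v
    proof -
      let ?s = "(store_put (Suc N) ys \<sigma>)(Suc N + ?m := v)"
      let ?s' = "\<lambda>r. if r \<in> {Suc N..<Suc N + ?m} then 0 else ?s r"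
      have "?s'(Suc N + ?m := 0, N := ?s' N + ?s' (Suc N + ?m)) = \<sigma>(N := v)"
        using l z by (intro ext) (simp add: store_put_def)
      moreover have "sem ?c ?s \<tau> \<longleftrightarrow> \<tau> = ?s'(Suc N + ?m := 0, N := ?s' N + ?s' (Suc N + ?m))"
        by (simp only: sem.simps sem_clear set_upt sem_Move_one) simp
      ultimately show ?thesis by simp
    qed
    ultimately show ?thesis by (simp only: sem.simps(5)[of p]) blast
  qed
  have 3: "recf_eval (RComp f gs) (map \<sigma> xs) v \<longleftrightarrow> (\<exists>ys. length ys = ?m \<and>
    (\<forall>i<?m. recf_eval (gs ! i) (map \<sigma> xs) (ys ! i)) \<and> recf_eval f ys v)" for v
  proof
    assume "recf_eval (RComp f gs) (map \<sigma> xs) v"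
    then show "\<exists>ys. length ys = ?m \<and>
      (\<forall>i<?m. recf_eval (gs ! i) (map \<sigma> xs) (ys ! i)) \<and> recf_eval f ys v"
      by (rule eval_CompE) blast
  qed (metis recf_eval.comp)
  show "sem (Seq (Eval_all ps) (Seq p ?c)) \<sigma> \<tau> \<longleftrightarrow>
     (\<exists>v. recf_eval (RComp f gs) (map \<sigma> xs) v \<and> \<tau> = \<sigma>(N := v))"
    unfolding sem.simps(5)[of "Eval_all ps"] 1 3 using 2 by metis
qed

text \<open>Register \<open>N\<close> holds the value computed so far, \<open>N + 1\<close> the
  number of rounds left, \<open>N + 2\<close> the number of rounds done, which is the second
  argument of \<open>g\<close>, and \<open>N + 3\<close> receives the value of
  \<open>g\<close>.\<close>

lemma implements_Prim:
  assumes "x < N" and xs: "set xs \<subseteq> {..<N}" and p: "implements f xs N p"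
    and q: "implements g (N # (N + 2) # xs) (N + 3) q"
  shows "implements (RPrimRec f g) (x # xs) N
    (Seq p (Seq (Copy x (N + 1))
      (Seq (Seq (Loop (Seq (Dec (N + 1)) (Seq q (Seq (Move N []) (Seq (Move (N + 3) [N]) (Inc (N + 2)))))))
        (Zero (N + 1))) (Move (N + 2) []))))"
    (is "implements _ _ _ (Seq p (Seq ?copy (Seq (Seq (Loop ?b) ?zero) ?clear)))")
  unfolding implements_def
proof (intro allI impI)
  fix \<sigma> \<tau> :: store
  assume "\<forall>r\<ge>N. \<sigma> r = 0"
  then have z: "\<And>r. r \<ge> N \<Longrightarrow> \<sigma> r = 0" by blast
  define S where "S a r c = \<sigma>(N := a, N + 1 := r, N + 2 := c)" for a r c :: nat
  have map_S: "map (S a r c) xs = map \<sigma> xs" for a r c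
    using xs by (simp add: S_def map_upd_ge)
  have body: "sem ?b (S a r c) \<rho> \<longleftrightarrow>
    0 < r \<and> (\<exists>y. recf_eval g (a # c # map \<sigma> xs) y \<and> \<rho> = S y (r - 1) (Suc c))" for a r c \<rho>
  proof -
    have upd: "(S a r c)(N + 1 := r - 1) = S a (r - 1) c" by (auto simp: S_def)
    have q': "sem q (S a (r - 1) c) \<rho>' \<longleftrightarrow>
      (\<exists>y. recf_eval g (a # c # map \<sigma> xs) y \<and> \<rho>' = (S a (r - 1) c)(N + 3 := y))" for \<rho>'
      by (subst implementsD[OF q]) (simp_all add: S_def z map_upd_ge[OF xs])
    let ?t = "\<lambda>y. (S a (r - 1) c)(N + 3 := y)"
    have t: "(?t y)(N := 0, N + 3 := 0, N := ((?t y)(N := 0)) N + ((?t y)(N := 0)) (N + 3))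
        = S y (r - 1) c" for y
      by (intro ext) (simp add: S_def z)
    have tail: "sem (Seq (Move N []) (Seq (Move (N + 3) [N]) (Inc (N + 2)))) (?t y) \<rho> \<longleftrightarrow>
      \<rho> = S y (r - 1) (Suc c)" for y
    proof -
      have "sem (Seq (Move N []) (Seq (Move (N + 3) [N]) (Inc (N + 2)))) (?t y) \<rho> \<longleftrightarrow>
        sem (Inc (N + 2)) (S y (r - 1) c) \<rho>"
        by (simp only: sem.simps(5) sem_Move_nil sem_Move_one simp_thms t add_eq_self_zero add_left_cancel)
      also have "\<dots> \<longleftrightarrow> \<rho> = S y (r - 1) (Suc c)" by (simp add: S_def)
      finally show ?thesis .
    qed
    have "sem ?b (S a r c) \<rho> \<longleftrightarrow> 0 < r \<and>
      sem (Seq q (Seq (Move N []) (Seq (Move (N + 3) [N]) (Inc (N + 2))))) (S a (r - 1) c) \<rho>"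
      unfolding sem.simps(5)[of "Dec (N + 1)"] sem.simps(3) using upd by (auto simp: S_def)
    also have "\<dots> \<longleftrightarrow> 0 < r \<and> (\<exists>y. recf_eval g (a # c # map \<sigma> xs) y \<and> \<rho> = S y (r - 1) (Suc c))"
      unfolding sem.simps(5)[of q] q' using tail by blast
    finally show ?thesis .
  qed
  have fwd: "\<exists>k y. k \<le> n \<and> recf_eval (RPrimRec f g) (k # map \<sigma> xs) y \<and> \<rho> = S y (n - k) k"
    if "(sem ?b)\<^sup>*\<^sup>* (S a n 0) \<rho>" "recf_eval f (map \<sigma> xs) a" for a n \<rho>
    using that(1)
  proof (induction rule: rtranclp_induct)
    case base
    show ?case using recf_eval.prim0[OF that(2)] by (metis diff_zero le0)
  next
    case (step \<rho> \<rho>')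
    then obtain k y where k: "k \<le> n" "recf_eval (RPrimRec f g) (k # map \<sigma> xs) y" "\<rho> = S y (n - k) k"
      by blast
    with step.hyps(2) obtain y' where y': "0 < n - k" "recf_eval g (y # k # map \<sigma> xs) y'"
      "\<rho>' = S y' (n - k - 1) (Suc k)"
      by (auto simp only: body)
    have "recf_eval (RPrimRec f g) (Suc k # map \<sigma> xs) y'" using k(2) y'(2) by (rule recf_eval.primS)
    moreover have "Suc k \<le> n" "n - k - 1 = n - Suc k" using y'(1) by auto
    ultimately show ?case using y'(3) by metis
  qed
  \<comment> \<open>The start value \<open>a\<close> is not given but extracted from the derivation
    of the value at \<open>k\<close>, hence the existential.\<close>
  have bwd: "\<exists>a. recf_eval f (map \<sigma> xs) a \<and> (sem ?b)\<^sup>*\<^sup>* (S a n 0) (S y (n - k) k)"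
    if "recf_eval (RPrimRec f g) (k # map \<sigma> xs) y" "k \<le> n" for n k y
    using that
  proof (induction k arbitrary: y)
    case 0
    then show ?case by (auto elim!: eval_PrimE)
  next
    case (Suc k)
    from Suc.prems(1) obtain y' where y': "recf_eval (RPrimRec f g) (k # map \<sigma> xs) y'"
      "recf_eval g (y' # k # map \<sigma> xs) y" by (auto elim: eval_PrimE)
    with Suc.IH Suc.prems(2) obtain a where a: "recf_eval f (map \<sigma> xs) a"
      "(sem ?b)\<^sup>*\<^sup>* (S a n 0) (S y' (n - k) k)" by fastforce
    have "sem ?b (S y' (n - k) k) (S y (n - Suc k) (Suc k))"
      using Suc.prems(2) y'(2) by (subst body) auto
    with a show ?case using rtranclp.rtrancl_into_rtrancl[of "sem ?b"] by blast
  qed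
  have copy: "sem ?copy (\<sigma>(N := a)) \<rho> \<longleftrightarrow> \<rho> = S a (\<sigma> x) 0" for a \<rho>
  proof -
    have "(\<sigma>(N := a))(N + 1 := (\<sigma>(N := a)) x) = S a (\<sigma> x) 0"
      using assms(1) by (auto simp: S_def z)
    moreover have "sem ?copy (\<sigma>(N := a)) \<rho> \<longleftrightarrow> \<rho> = (\<sigma>(N := a))(N + 1 := (\<sigma>(N := a)) x)"
      by (rule sem_Copy) (use assms(1) in \<open>simp_all add: z\<close>)
    ultimately show ?thesis by simp
  qed
  have clear: "sem ?clear (S y 0 c) \<tau> \<longleftrightarrow> \<tau> = \<sigma>(N := y)" for y c
  proof -
    have "(S y 0 c)(N + 2 := 0) = \<sigma>(N := y)" by (auto simp: S_def z)
    then show ?thesis by simp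
  qed
  have p': "sem p \<sigma> \<rho> \<longleftrightarrow> (\<exists>v. recf_eval f (map \<sigma> xs) v \<and> \<rho> = \<sigma>(N := v))" for \<rho>
    by (rule implementsD[OF p z])
  have "sem (Seq p (Seq ?copy (Seq (Seq (Loop ?b) ?zero) ?clear))) \<sigma> \<tau> \<longleftrightarrow>
    (\<exists>a \<rho>. recf_eval f (map \<sigma> xs) a \<and> (sem ?b)\<^sup>*\<^sup>* (S a (\<sigma> x) 0) \<rho> \<and> \<rho> (N + 1) = 0 \<and> sem ?clear \<rho> \<tau>)"
    unfolding sem.simps(5)[of p] sem.simps(5)[of ?copy] sem.simps(5)[of _ ?clear] sem_while
      p' by (metis copy)
  also have "\<dots> \<longleftrightarrow> (\<exists>v. recf_eval (RPrimRec f g) (map \<sigma> (x # xs)) v \<and> \<tau> = \<sigma>(N := v))"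
  proof
    assume "\<exists>a \<rho>. recf_eval f (map \<sigma> xs) a \<and> (sem ?b)\<^sup>*\<^sup>* (S a (\<sigma> x) 0) \<rho> \<and> \<rho> (N + 1) = 0 \<and> sem ?clear \<rho> \<tau>"
    then obtain a \<rho> where "recf_eval f (map \<sigma> xs) a" "(sem ?b)\<^sup>*\<^sup>* (S a (\<sigma> x) 0) \<rho>"
      and \<rho>: "\<rho> (N + 1) = 0" "sem ?clear \<rho> \<tau>" by blast
    then obtain k y where k: "k \<le> \<sigma> x" "recf_eval (RPrimRec f g) (k # map \<sigma> xs) y"
      "\<rho> = S y (\<sigma> x - k) k" using fwd by blast
    then have "k = \<sigma> x" using \<rho>(1) by (simp add: S_def)
    then show "\<exists>v. recf_eval (RPrimRec f g) (map \<sigma> (x # xs)) v \<and> \<tau> = \<sigma>(N := v)"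
      using k \<rho>(2) clear by auto
  next
    assume "\<exists>v. recf_eval (RPrimRec f g) (map \<sigma> (x # xs)) v \<and> \<tau> = \<sigma>(N := v)"
    then obtain v where v: "recf_eval (RPrimRec f g) (\<sigma> x # map \<sigma> xs) v" "\<tau> = \<sigma>(N := v)" by auto
    from bwd[OF v(1), of "\<sigma> x"] obtain a where "recf_eval f (map \<sigma> xs) a"
      "(sem ?b)\<^sup>*\<^sup>* (S a (\<sigma> x) 0) (S v 0 (\<sigma> x))" by auto
    moreover have "S v 0 (\<sigma> x) (N + 1) = 0" by (simp add: S_def)
    ultimately show "\<exists>a \<rho>. recf_eval f (map \<sigma> xs) a \<and> (sem ?b)\<^sup>*\<^sup>* (S a (\<sigma> x) 0) \<rho> \<and>
      \<rho> (N + 1) = 0 \<and> sem ?clear \<rho> \<tau>"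
      using clear v(2) by blast
  qed
  finally show "sem (Seq p (Seq ?copy (Seq (Seq (Loop ?b) ?zero) ?clear))) \<sigma> \<tau> \<longleftrightarrow>
    (\<exists>v. recf_eval (RPrimRec f g) (map \<sigma> (x # xs)) v \<and> \<tau> = \<sigma>(N := v))" .
qed

text \<open>\<open>N\<close> holds the candidate and \<open>N + 1\<close> the value of
  \<open>f\<close> there. \<open>Dec\<close> blocks if this value is zero and the final
  \<open>Zero\<close> blocks if it is positive, so a complete run ends at a zero of \<open>f\<close>
  all of whose predecessors gave positive values.\<close>

lemma implements_Min:
  assumes xs: "set xs \<subseteq> {..<N}" and p: "implements f (N # xs) (N + 1) p"
  shows "implements (RMin f) xs N
    (Seq (Loop (Seq p (Seq (Dec (N + 1)) (Seq (Move (N + 1) []) (Inc N))))) (Seq p (Zero (N + 1))))"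
    (is "implements _ _ _ (Seq (Loop ?b) ?test)")
  unfolding implements_def
proof (intro allI impI)
  fix \<sigma> \<tau> :: store
  assume "\<forall>r\<ge>N. \<sigma> r = 0"
  then have z: "\<And>r. r \<ge> N \<Longrightarrow> \<sigma> r = 0" by blast
  have p': "sem p (\<sigma>(N := i)) \<rho> \<longleftrightarrow>
    (\<exists>y. recf_eval f (i # map \<sigma> xs) y \<and> \<rho> = \<sigma>(N := i, N + 1 := y))" for i \<rho>
    by (subst implementsD[OF p]) (simp_all add: z map_upd_ge[OF xs])
  have tail: "sem (Seq (Dec (N + 1)) (Seq (Move (N + 1) []) (Inc N))) (\<sigma>(N := i, N + 1 := y)) \<rho> \<longleftrightarrow>
    0 < y \<and> \<rho> = \<sigma>(N := Suc i)" for i y \<rho>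
  proof -
    have "\<sigma>(N := i, N + 1 := y, N + 1 := y - 1, N + 1 := 0, N := Suc i) = \<sigma>(N := Suc i)"
      by (auto simp: z)
    then show ?thesis by simp
  qed
  have body: "sem ?b (\<sigma>(N := i)) \<rho> \<longleftrightarrow>
    (\<exists>y. recf_eval f (i # map \<sigma> xs) (Suc y) \<and> \<rho> = \<sigma>(N := Suc i))" for i \<rho>
  proof -
    have "sem ?b (\<sigma>(N := i)) \<rho> \<longleftrightarrow>
      (\<exists>y. recf_eval f (i # map \<sigma> xs) y \<and> 0 < y \<and> \<rho> = \<sigma>(N := Suc i))"
      unfolding sem.simps(5)[of p] p' using tail by blast
    then show ?thesis by (metis gr0_conv_Suc)
  qed
  have fwd: "\<exists>i. \<rho> = \<sigma>(N := i) \<and> (\<forall>j<i. \<exists>y. recf_eval f (j # map \<sigma> xs) (Suc y))"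
    if "(sem ?b)\<^sup>*\<^sup>* \<sigma> \<rho>" for \<rho>
    using that
  proof (induction rule: rtranclp_induct)
    case base
    have "\<sigma> = \<sigma>(N := 0)" by (auto simp: z)
    then show ?case by blast
  next
    case (step \<rho> \<rho>')
    then show ?case using body by (metis less_Suc_eq)
  qed
  have bwd: "(sem ?b)\<^sup>*\<^sup>* \<sigma> (\<sigma>(N := i))" if "\<forall>j<i. \<exists>y. recf_eval f (j # map \<sigma> xs) (Suc y)" for i
    using that
  proof (induction i)
    case 0
    have "\<sigma>(N := 0) = \<sigma>" by (auto simp: z)
    then show ?case by simp
  next
    case (Suc i)
    have "(sem ?b)\<^sup>*\<^sup>* \<sigma> (\<sigma>(N := i))" using Suc.IH Suc.prems less_Suc_eq by blast
    moreover have "sem ?b (\<sigma>(N := i)) (\<sigma>(N := Suc i))" using Suc.prems body by blast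
    ultimately show ?case by (rule rtranclp.rtrancl_into_rtrancl[of "sem ?b"])
  qed
  have test: "sem ?test (\<sigma>(N := i)) \<tau> \<longleftrightarrow> recf_eval f (i # map \<sigma> xs) 0 \<and> \<tau> = \<sigma>(N := i)" for i
  proof -
    have "\<sigma>(N := i, N + 1 := 0) = \<sigma>(N := i)" by (auto simp: z)
    then show ?thesis unfolding sem.simps(5)[of p] p' by (auto simp: z)
  qed
  have "sem (Seq (Loop ?b) ?test) \<sigma> \<tau> \<longleftrightarrow>
    (\<exists>i. (\<forall>j<i. \<exists>y. recf_eval f (j # map \<sigma> xs) (Suc y)) \<and> sem ?test (\<sigma>(N := i)) \<tau>)"
    unfolding sem.simps(5)[of "Loop ?b"] sem.simps(6) using fwd bwd by metis
  also have "\<dots> \<longleftrightarrow> (\<exists>v. recf_eval (RMin f) (map \<sigma> xs) v \<and> \<tau> = \<sigma>(N := v))"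
    unfolding test using recf_eval.mini[of f _ "map \<sigma> xs"] by (blast elim: eval_MinE)
  finally show "sem (Seq (Loop ?b) ?test) \<sigma> \<tau> \<longleftrightarrow>
    (\<exists>v. recf_eval (RMin f) (map \<sigma> xs) v \<and> \<tau> = \<sigma>(N := v))" .
qed

text \<open>The argument registers and \<open>N\<close> are general in the induction, since
  subprograms run on other arguments and with a higher base. Where arguments are missing, the
  function has no value and \<open>Fail\<close> implements it.\<close>

theorem implements_ex:
  "set xs \<subseteq> {..<N} \<Longrightarrow> \<exists>p. implements f xs N p"
proof (induction f arbitrary: xs N)
  case RZero
  show ?case using implements_Zero by blast
next
  case RSucc
  show ?case
  proof (cases xs)
    case Nil
    then show ?thesis by (intro exI[of _ Fail] implements_Fail) (auto elim: eval_SuccE)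
  next
    case (Cons x ys)
    then show ?thesis using RSucc implements_Succ[of x N ys] by auto
  qed
next
  case (RProj i)
  show ?case
  proof (cases "i < length xs")
    case True
    then show ?thesis using implements_Proj[OF RProj] by blast
  next
    case False
    then show ?thesis by (intro exI[of _ Fail] implements_Fail) (auto elim: eval_ProjE)
  qed
next
  case (RComp f gs)
  have "set [Suc N..<Suc N + length gs] \<subseteq> {..<Suc N + length gs}"
    by (metis atLeastLessThan_upt atLeastLessThan_iff lessThan_iff subsetI)
  then obtain p where p: "implements f [Suc N..<Suc N + length gs] (Suc N + length gs) p"
    using RComp.IH(1) by blast
  have "\<exists>q. implements (gs ! j) xs (Suc N + j) q" if "j < length gs" for j
  proof (rule RComp.IH(2)[OF nth_mem[OF that]])
    show "set xs \<subseteq> {..<Suc N + j}"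
    proof
      fix x assume "x \<in> set xs"
      then have "x < N" using RComp.prems by blast
      then show "x \<in> {..<Suc N + j}" by simp
    qed
  qed
  then obtain q where q: "\<And>j. j < length gs \<Longrightarrow> implements (gs ! j) xs (Suc N + j) (q j)" by metis
  show ?case
    using implements_Comp[OF RComp.prems, of "map q [0..<length gs]" gs f p] p q
    by (auto simp del: upt_Suc)
next
  case (RPrimRec f g)
  show ?case
  proof (cases xs)
    case Nil
    then show ?thesis by (intro exI[of _ Fail] implements_Fail) (auto elim: eval_PrimE)
  next
    case (Cons x ys)
    then have x: "x < N" and ys: "set ys \<subseteq> {..<N}" using RPrimRec.prems by auto
    then have "set (N # (N + 2) # ys) \<subseteq> {..<N + 3}" by auto
    then obtain p q where "implements f ys N p" "implements g (N # (N + 2) # ys) (N + 3) q"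
      using RPrimRec.IH ys by meson
    from implements_Prim[OF x ys this] show ?thesis using Cons by blast
  qed
next
  case (RMin f)
  then have "set (N # xs) \<subseteq> {..<N + 1}" by auto
  then obtain p where "implements f (N # xs) (N + 1) p" using RMin.IH by meson
  from implements_Min[OF RMin.prems this] show ?case by blast
qed

definition input :: "nat \<Rightarrow> nat \<Rightarrow> store" where
  "input a b = (\<lambda>r. if r = 0 then a else if r = 1 then b else 0)"

text \<open>A concluding test of the result register turns the value 0 into the existence of a run;
  another value and divergence both leave none.\<close>

lemma accepting_prog_ex:
  "\<exists>p. \<forall>a b. (\<exists>\<tau>. sem p (input a b) \<tau>) \<longleftrightarrow> recf_eval h [a, b] 0"
proof -
  obtain p where p: "implements h [0, 1] 2 p" using implements_ex[of "[0, 1]" 2 h] by auto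
  have "(\<exists>\<tau>. sem (Seq p (Zero 2)) (input a b) \<tau>) \<longleftrightarrow> recf_eval h [a, b] 0" for a b
  proof -
    have "\<And>r. r \<ge> 2 \<Longrightarrow> input a b r = 0" "map (input a b) [0, 1] = [a, b]"
      by (auto simp: input_def)
    then show ?thesis by (simp add: implementsD[OF p]) auto
  qed
  then show ?thesis by blast
qed

text \<open>For \<open>RMin\<close>, the smaller of two different results would have to yield both
  zero and a positive value.\<close>

lemma recf_eval_deterministic: "recf_eval f xs y \<Longrightarrow> recf_eval f xs z \<Longrightarrow> y = z"
proof (induction arbitrary: z rule: recf_eval.induct)
  case (zero xs)
  then show ?case by (auto elim: eval_ZeroE)
next
  case (succ x xs)
  then show ?case by (auto elim: eval_SuccE)
next
  case (proj i xs)
  then show ?case by (auto elim: eval_ProjE)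
next
  case (comp ys gs xs f y)
  from comp.prems obtain ys' where ys': "length ys' = length gs"
    "\<forall>i<length gs. recf_eval (gs ! i) xs (ys' ! i)" "recf_eval f ys' z"
    by (rule eval_CompE) blast
  have "ys = ys'" using comp.hyps(1) comp.IH(1) ys'(1,2) by (intro nth_equalityI) auto
  then show ?case using comp.IH(2) ys'(3) by blast
next
  case (prim0 f xs y g)
  from prim0.prems show ?case by (rule eval_PrimE) (use prim0.IH in auto)
next
  case (primS f g n xs y y')
  from primS.prems show ?case by (rule eval_PrimE) (use primS.IH in auto)
next
  case (mini f n xs)
  from mini.prems have z: "recf_eval f (z # xs) 0" "\<forall>i<z. \<exists>y. recf_eval f (i # xs) (Suc y)"
    by (auto elim: eval_MinE)
  show ?case
  proof (rule linorder_cases[of n z])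
    assume "n < z"
    then show ?thesis using mini.IH(1) z(2) by force
  next
    assume "z < n"
    then show ?thesis using mini.IH(2) z(1) by force
  qed
qed

section \<open>Continuations\<close>

type_synonym cont = "prog list"

text \<open>A head stores only finitely much control, so the recursive semantics is replaced by
  small steps on the list of programs still to be run.\<close>

inductive pstep :: "cont \<times> store \<Rightarrow> cont \<times> store \<Rightarrow> bool" where
  "pstep (Skip # k, \<sigma>) (k, \<sigma>)"
| "pstep (Inc x # k, \<sigma>) (k, \<sigma>(x := Suc (\<sigma> x)))"
| "0 < \<sigma> x \<Longrightarrow> pstep (Dec x # k, \<sigma>) (k, \<sigma>(x := \<sigma> x - Suc 0))"
| "\<sigma> x = 0 \<Longrightarrow> pstep (Zero x # k, \<sigma>) (k, \<sigma>)"
| "pstep (Seq p q # k, \<sigma>) (p # q # k, \<sigma>)"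
| "pstep (Loop p # k, \<sigma>) (k, \<sigma>)"
| "pstep (Loop p # k, \<sigma>) (p # Loop p # k, \<sigma>)"

lemma sem_imp_psteps: "sem p \<sigma> \<tau> \<Longrightarrow> pstep\<^sup>*\<^sup>* (p # k, \<sigma>) (k, \<tau>)"
proof (induction p arbitrary: k \<sigma> \<tau>)
  case (Seq p q)
  then obtain \<rho> where "sem p \<sigma> \<rho>" "sem q \<rho> \<tau>" by auto
  then have "pstep\<^sup>*\<^sup>* (p # q # k, \<sigma>) (q # k, \<rho>)" "pstep\<^sup>*\<^sup>* (q # k, \<rho>) (k, \<tau>)"
    using Seq.IH by blast+
  moreover have "pstep (Seq p q # k, \<sigma>) (p # q # k, \<sigma>)" by (rule pstep.intros)
  ultimately show ?case by (meson converse_rtranclp_into_rtranclp rtranclp_trans)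
next
  case (Loop p)
  then have "(sem p)\<^sup>*\<^sup>* \<sigma> \<tau>" by simp
  then show ?case
  proof (induction rule: converse_rtranclp_induct)
    case base
    show ?case by (auto intro: pstep.intros)
  next
    case (step \<sigma> \<rho>)
    have "pstep (Loop p # k, \<sigma>) (p # Loop p # k, \<sigma>)" by (rule pstep.intros)
    moreover have "pstep\<^sup>*\<^sup>* (p # Loop p # k, \<sigma>) (Loop p # k, \<rho>)"
      using Loop.IH step.hyps(1) by blast
    ultimately show ?case using step.IH
      by (meson converse_rtranclp_into_rtranclp rtranclp_trans)
  qed
qed (auto intro!: r_into_rtranclp pstep.intros)

primrec sem_cont :: "cont \<Rightarrow> store \<Rightarrow> store \<Rightarrow> bool" where
  "sem_cont [] \<sigma> \<tau> \<longleftrightarrow> \<tau> = \<sigma>"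
| "sem_cont (p # k) \<sigma> \<tau> \<longleftrightarrow> (\<exists>\<rho>. sem p \<sigma> \<rho> \<and> sem_cont k \<rho> \<tau>)"

lemma pstep_sem_cont:
  assumes "pstep (k, \<sigma>) (k', \<sigma>')" "sem_cont k' \<sigma>' \<tau>"
  shows "sem_cont k \<sigma> \<tau>"
  using assms(1)
proof cases
  \<comment> \<open>Unfolding a loop puts one run of its body in front of the remaining
    iterations.\<close>
  case (7 p l)
  then obtain \<rho> \<rho>' where "sem p \<sigma> \<rho>" "(sem p)\<^sup>*\<^sup>* \<rho> \<rho>'" "sem_cont l \<rho>' \<tau>"
    using assms(2) by auto
  then show ?thesis using 7 converse_rtranclp_into_rtranclp[of "sem p"] by auto
qed (use assms(2) in auto)

lemma psteps_imp_sem_cont: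
  "pstep\<^sup>*\<^sup>* (k, \<sigma>) ([], \<tau>) \<Longrightarrow> sem_cont k \<sigma> \<tau>"
  by (induction "(k, \<sigma>)" arbitrary: k \<sigma> rule: converse_rtranclp_induct)
    (auto intro: pstep_sem_cont)

lemma psteps_iff_sem: "pstep\<^sup>*\<^sup>* ([p], \<sigma>) ([], \<tau>) \<longleftrightarrow> sem p \<sigma> \<tau>"
  using sem_imp_psteps[of p \<sigma> \<tau> "[]"] psteps_imp_sem_cont[of "[p]" \<sigma> \<tau>] by auto

text \<open>A bound on the continuations that arise while \<open>p\<close> runs in front of
  \<open>k\<close>, up to the moment when \<open>k\<close> itself is reached. It is finite because
  the body of a loop always returns to the same \<open>Loop p # k\<close>.\<close>

primrec conts :: "prog \<Rightarrow> cont \<Rightarrow> cont set" where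
  "conts Skip k = {Skip # k}"
| "conts (Inc x) k = {Inc x # k}"
| "conts (Dec x) k = {Dec x # k}"
| "conts (Zero x) k = {Zero x # k}"
| "conts (Seq p q) k = insert (Seq p q # k) (conts p (q # k) \<union> conts q k)"
| "conts (Loop p) k = insert (Loop p # k) (conts p (Loop p # k))"

lemma finite_conts: "finite (conts p k)"
  by (induction p arbitrary: k) auto

lemma conts_start: "p # k \<in> conts p k"
  by (cases p) auto

lemma conts_closed: "pstep (l, \<sigma>) (l', \<sigma>') \<Longrightarrow> l \<in> conts p k \<Longrightarrow> l' = k \<or> l' \<in> conts p k"
proof (induction p arbitrary: k)
  case (Seq p q)
  from Seq.prems(2) consider "l = Seq p q # k" | "l \<in> conts p (q # k)" | "l \<in> conts q k" by auto
  then show ?case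
  proof cases
    case 1
    then have "l' = p # q # k" using Seq.prems(1) by (auto elim: pstep.cases)
    then show ?thesis using conts_start by auto
  next
    case 2
    then show ?thesis using Seq.IH(1)[OF Seq.prems(1) 2] conts_start by auto
  next
    case 3
    then show ?thesis using Seq.IH(2)[OF Seq.prems(1) 3] by auto
  qed
next
  case (Loop p)
  from Loop.prems(2) consider "l = Loop p # k" | "l \<in> conts p (Loop p # k)" by auto
  then show ?case
  proof cases
    case 1
    then have "l' = k \<or> l' = p # Loop p # k" using Loop.prems(1) by (auto elim: pstep.cases)
    then show ?thesis using conts_start by auto
  next
    case 2
    then show ?thesis using Loop.IH[OF Loop.prems(1) 2] by auto
  qed
qed (auto elim: pstep.cases)

section \<open>A nondeterministic head on a bounded tape\<close>

text \<open>A cell holds \<open>0\<close> (free), \<open>1\<close> or \<open>2\<close> (left and right end marker), or \<open>x + 3\<close>: one unit of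
  register \<open>x\<close>. The value of a register is the number of its units, wherever they are, so that the
  head may wander about freely between two operations; only a test for zero prescribes a walk,
  from one end marker to the other.\<close>

datatype head = Run cont | Scan nat cont

instance head :: countable
  by countable_datatype

text \<open>The last argument is the move: \<open>None\<close> stays, \<open>Some True\<close> goes
  right, \<open>Some False\<close> goes left. A scan has no rule for a unit of its own register, so
  it gets stuck if the register is not zero; \<open>Run []\<close> has no rule at all.\<close>

inductive delta :: "head \<Rightarrow> nat \<Rightarrow> head \<Rightarrow> nat \<Rightarrow> bool option \<Rightarrow> bool" where
  walk: "k \<noteq> [] \<Longrightarrow> delta (Run k) c (Run k) c (Some d)"
| skip: "delta (Run (Skip # k)) c (Run k) c None"
| inc: "delta (Run (Inc x # k)) 0 (Run k) (x + 3) None"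
| dec: "delta (Run (Dec x # k)) (x + 3) (Run k) 0 None"
| zero: "delta (Run (Zero x # k)) 1 (Scan x k) 1 (Some True)"
| scan: "c \<noteq> x + 3 \<Longrightarrow> c \<noteq> 2 \<Longrightarrow> delta (Scan x k) c (Scan x k) c (Some True)"
| scanned: "delta (Scan x k) 2 (Run k) 2 None"
| seq: "delta (Run (Seq p q # k)) c (Run (p # q # k)) c None"
| exit: "delta (Run (Loop p # k)) c (Run k) c None"
| iter: "delta (Run (Loop p # k)) c (Run (p # Loop p # k)) c None"

type_synonym tape_conf = "head \<times> (nat \<Rightarrow> nat) \<times> nat"

inductive tstep :: "nat \<Rightarrow> tape_conf \<Rightarrow> tape_conf \<Rightarrow> bool" for N where
  stay: "delta s (cs p) s' c None \<Longrightarrow> tstep N (s, cs, p) (s', cs(p := c), p)"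
| right: "delta s (cs p) s' c (Some True) \<Longrightarrow> Suc p < N \<Longrightarrow> tstep N (s, cs, p) (s', cs(p := c), Suc p)"
| left: "delta s (cs (Suc p)) s' c (Some False) \<Longrightarrow> tstep N (s, cs, Suc p) (s', cs(Suc p := c), p)"

section \<open>Soundness of the tape\<close>

definition units :: "nat \<Rightarrow> (nat \<Rightarrow> nat) \<Rightarrow> nat \<Rightarrow> nat" where
  "units N cs c = card {i. i < N \<and> cs i = c}"

definition tape_store :: "nat \<Rightarrow> (nat \<Rightarrow> nat) \<Rightarrow> store" where
  "tape_store N cs = (\<lambda>x. units N cs (x + 3))"

definition tape_ok :: "nat \<Rightarrow> (nat \<Rightarrow> nat) \<Rightarrow> bool" where
  "tape_ok N cs \<longleftrightarrow> 2 \<le> N \<and> (\<forall>i<N. (cs i = 1 \<longleftrightarrow> i = 0) \<and> (cs i = 2 \<longleftrightarrow> Suc i = N))"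

lemma units_upd:
  assumes "p < N" "cs p = c" "c \<noteq> c'"
  shows "units N (cs(p := c')) = (units N cs)(c := units N cs c - 1, c' := Suc (units N cs c'))"
    and "0 < units N cs c"
proof -
  have "{i. i < N \<and> (cs(p := c')) i = c} = {i. i < N \<and> cs i = c} - {p}"
    "{i. i < N \<and> (cs(p := c')) i = c'} = insert p {i. i < N \<and> cs i = c'}"
    using assms by auto
  moreover have "{i. i < N \<and> (cs(p := c')) i = d} = {i. i < N \<and> cs i = d}" if "d \<noteq> c" "d \<noteq> c'" for d
    using assms that by auto
  ultimately show "units N (cs(p := c')) = (units N cs)(c := units N cs c - 1, c' := Suc (units N cs c'))"
    using assms by (auto simp: units_def fun_eq_iff)
  have "p \<in> {i. i < N \<and> cs i = c}" using assms by simp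
  then show "0 < units N cs c" unfolding units_def by (subst card_gt_0_iff) auto
qed

lemma units_pos: "0 < units N cs c \<Longrightarrow> \<exists>p<N. cs p = c"
  by (auto simp: units_def card_gt_0_iff)

lemma units_zero: "units N cs c = 0 \<longleftrightarrow> (\<forall>i<N. cs i \<noteq> c)"
  by (auto simp: units_def)

lemma tape_store_inc:
  assumes "p < N" "cs p = 0"
  shows "tape_store N (cs(p := x + 3)) = (tape_store N cs)(x := Suc (tape_store N cs x))"
  using units_upd(1)[of p N cs 0 "x + 3"] assms by (auto simp: tape_store_def)

lemma tape_store_dec:
  assumes "p < N" "cs p = x + 3"
  shows "tape_store N (cs(p := 0)) = (tape_store N cs)(x := tape_store N cs x - Suc 0)"
    and "0 < tape_store N cs x"
  using units_upd[of p N cs "x + 3" 0] assms by (auto simp: tape_store_def)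

lemma tape_ok_upd:
  "tape_ok N cs \<Longrightarrow> p < N \<Longrightarrow> cs p \<noteq> 1 \<Longrightarrow> cs p \<noteq> 2 \<Longrightarrow> c \<noteq> 1 \<Longrightarrow> c \<noteq> 2 \<Longrightarrow> tape_ok N (cs(p := c))"
  by (auto simp: tape_ok_def)

text \<open>During a scan the program state is still the one before the test, and the cells already
  passed hold no unit of \<open>x\<close>. At the right end marker this covers the whole tape, which
  justifies the test.\<close>

fun tape_inv :: "nat \<Rightarrow> cont \<times> store \<Rightarrow> tape_conf \<Rightarrow> bool" where
  "tape_inv N P (Run k, cs, p) \<longleftrightarrow> tape_ok N cs \<and> p < N \<and> pstep\<^sup>*\<^sup>* P (k, tape_store N cs)"
| "tape_inv N P (Scan x k, cs, p) \<longleftrightarrow> tape_ok N cs \<and> p < N \<and>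
    pstep\<^sup>*\<^sup>* P (Zero x # k, tape_store N cs) \<and> (\<forall>j<p. cs j \<noteq> x + 3)"

lemma tape_inv_Run:
  assumes "tape_inv N P (Run l, cs, p)" "tape_ok N cs'"
    and "pstep (l, tape_store N cs) (k, tape_store N cs')"
  shows "tape_inv N P (Run k, cs', p)"
  using assms rtranclp.rtrancl_into_rtrancl[of pstep P "(l, tape_store N cs)" "(k, tape_store N cs')"]
  by simp

lemma tape_inv_stay:
  assumes "tape_inv N P (s, cs, p)" "delta s (cs p) s' c None"
  shows "tape_inv N P (s', cs(p := c), p)"
  using assms(2)
proof cases
  case (inc x k)
  with assms(1) have "tape_ok N cs" "p < N" by simp_all
  with inc have "tape_ok N (cs(p := c))" by (simp add: tape_ok_upd)
  moreover have "tape_store N (cs(p := c)) = (tape_store N cs)(x := Suc (tape_store N cs x))"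
    using inc tape_store_inc[of p N cs x] \<open>p < N\<close> by simp
  ultimately show ?thesis
    using tape_inv_Run[of N P "Inc x # k" cs p "cs(p := c)" k] pstep.intros(2) assms(1) inc by simp
next
  case (dec x k)
  with assms(1) have "tape_ok N cs" "p < N" by simp_all
  with dec have "tape_ok N (cs(p := c))" by (simp add: tape_ok_upd)
  moreover have "tape_store N (cs(p := c)) = (tape_store N cs)(x := tape_store N cs x - Suc 0)"
    "0 < tape_store N cs x"
    using dec tape_store_dec[of p N cs x] \<open>p < N\<close> by simp_all
  ultimately show ?thesis
    using tape_inv_Run[of N P "Dec x # k" cs p "cs(p := c)" k] pstep.intros(3) assms(1) dec by simp
next
  case (scanned x k)
  then have *: "tape_ok N cs" "p < N" "pstep\<^sup>*\<^sup>* P (Zero x # k, tape_store N cs)" "\<forall>j<p. cs j \<noteq> x + 3"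
    using assms(1) by simp_all
  then have "Suc p = N" using scanned by (simp add: tape_ok_def)
  then have "cs i \<noteq> x + 3" if "i < N" for i
    using *(4) that scanned(2) by (cases "i = p") auto
  then have "tape_store N cs x = 0" by (simp add: tape_store_def units_zero)
  then have "pstep (Zero x # k, tape_store N cs) (k, tape_store N cs)" by (rule pstep.intros)
  then show ?thesis
    using tape_inv_Run[of N P "Zero x # k" cs p cs k] * scanned by (simp add: fun_upd_idem)
next
  case (skip k)
  then show ?thesis
    using assms(1) tape_inv_Run[of N P "Skip # k" cs p cs k] pstep.intros(1) by (simp add: fun_upd_idem)
next
  case (seq q r k)
  then show ?thesis
    using assms(1) tape_inv_Run[of N P "Seq q r # k" cs p cs "q # r # k"] pstep.intros(5)
    by (simp add: fun_upd_idem)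
next
  case (exit q k)
  then show ?thesis
    using assms(1) tape_inv_Run[of N P "Loop q # k" cs p cs k] pstep.intros(6)
    by (simp add: fun_upd_idem)
next
  case (iter q k)
  then show ?thesis
    using assms(1) tape_inv_Run[of N P "Loop q # k" cs p cs "q # Loop q # k"] pstep.intros(7)
    by (simp add: fun_upd_idem)
qed

text \<open>Only for a right move is the target fixed: left moves occur in \<open>Run\<close> states
  alone, whose invariant says nothing about the position beyond \<open>p < N\<close>.\<close>

lemma tape_inv_move:
  assumes "tape_inv N P (s, cs, p)" "delta s (cs p) s' c (Some d)" "p' < N"
    and "d \<Longrightarrow> p' = Suc p"
  shows "tape_inv N P (s', cs(p := c), p')"
  using assms(2)
  by cases (use assms(1,3,4) in \<open>auto simp: fun_upd_idem less_Suc_eq tape_ok_def\<close>)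

lemma tape_inv_steps:
  assumes "(tstep N)\<^sup>*\<^sup>* a b" "tape_inv N P a"
  shows "tape_inv N P b"
  using assms
proof (induction rule: rtranclp_induct)
  case (step b b')
  from step.hyps(2) step.IH[OF step.prems] show ?case
  proof (cases rule: tstep.cases)
    case (left s cs p s' c)
    moreover have "Suc p < N" using step.IH[OF step.prems] left by (cases s) auto
    ultimately show ?thesis using step.IH[OF step.prems] tape_inv_move[of N P s cs "Suc p" s' c False p]
      by auto
  qed (auto intro: tape_inv_stay tape_inv_move)
qed

lemma tape_sound:
  assumes "tape_ok N cs" "p < N" "(tstep N)\<^sup>*\<^sup>* (Run k, cs, p) (Run [], cs', p')"
  shows "\<exists>\<tau>. pstep\<^sup>*\<^sup>* (k, tape_store N cs) ([], \<tau>)"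
  using tape_inv_steps[OF assms(3), of "(k, tape_store N cs)"] assms(1,2) by auto

section \<open>Completeness of the tape\<close>

lemma walk_left: "k \<noteq> [] \<Longrightarrow> (tstep N)\<^sup>*\<^sup>* (Run k, cs, p + d) (Run k, cs, p)"
proof (induction d)
  case (Suc d)
  have "tstep N (Run k, cs, Suc (p + d)) (Run k, cs(Suc (p + d) := cs (Suc (p + d))), p + d)"
    using Suc.prems by (intro tstep.left delta.walk)
  then show ?case using Suc by (auto intro: converse_rtranclp_into_rtranclp)
qed auto

lemma walk_right: "k \<noteq> [] \<Longrightarrow> p + d < N \<Longrightarrow> (tstep N)\<^sup>*\<^sup>* (Run k, cs, p) (Run k, cs, p + d)"
proof (induction d)
  case (Suc d)
  have "tstep N (Run k, cs, p + d) (Run k, cs(p + d := cs (p + d)), Suc (p + d))"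
    using Suc.prems by (intro tstep.right delta.walk) auto
  then show ?case using Suc by (auto intro: rtranclp.rtrancl_into_rtrancl)
qed auto

lemma walk_any:
  assumes "k \<noteq> []" "p' < N"
  shows "(tstep N)\<^sup>*\<^sup>* (Run k, cs, p) (Run k, cs, p')"
proof (cases "p \<le> p'")
  case True
  then show ?thesis using walk_right[of k p "p' - p" N cs] assms by auto
next
  case False
  then show ?thesis using walk_left[of k N cs p' "p - p'"] assms by auto
qed

lemma scan_right:
  assumes "p + d < N" "\<And>j. p \<le> j \<Longrightarrow> j < p + d \<Longrightarrow> cs j \<noteq> 2 \<and> cs j \<noteq> x + 3"
  shows "(tstep N)\<^sup>*\<^sup>* (Scan x k, cs, p) (Scan x k, cs, p + d)"
  using assms
proof (induction d)
  case (Suc d)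
  have "tstep N (Scan x k, cs, p + d) (Scan x k, cs(p + d := cs (p + d)), Suc (p + d))"
    using Suc.prems by (intro tstep.right delta.scan) auto
  then show ?case using Suc by (auto intro: rtranclp.rtrancl_into_rtrancl)
qed auto

lemma zero_test:
  assumes "tape_ok N cs" "tape_store N cs x = 0"
  shows "(tstep N)\<^sup>*\<^sup>* (Run (Zero x # k), cs, p) (Run k, cs, N - 1)"
proof -
  have N: "2 \<le> N" and cs: "cs 0 = 1" "cs (N - 1) = 2" "\<And>j. Suc j < N \<Longrightarrow> cs j \<noteq> 2"
    using assms(1) by (auto simp: tape_ok_def)
  have x: "\<And>j. j < N \<Longrightarrow> cs j \<noteq> x + 3" using assms(2) by (simp add: tape_store_def units_zero)
  have "(tstep N)\<^sup>*\<^sup>* (Run (Zero x # k), cs, p) (Run (Zero x # k), cs, 0)"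
    using N by (intro walk_any) auto
  also have "tstep N (Run (Zero x # k), cs, 0) (Scan x k, cs(0 := 1), Suc 0)"
    using cs N delta.zero[of x k] by (intro tstep.right) auto
  also have "cs(0 := 1) = cs" using cs by auto
  also have "(tstep N)\<^sup>*\<^sup>* (Scan x k, cs, Suc 0) (Scan x k, cs, Suc 0 + (N - 2))"
    using N cs(3) x by (intro scan_right) auto
  also have "Suc 0 + (N - 2) = N - 1" using N by simp
  also have "tstep N (Scan x k, cs, N - 1) (Run k, cs(N - 1 := 2), N - 1)"
    using cs delta.scanned[of x k] by (intro tstep.stay) auto
  also have "cs(N - 1 := 2) = cs" using cs by auto
  finally show ?thesis .
qed

text \<open>The head walks to a suitable cell and works there. Only \<open>Inc\<close> consumes a
  free cell, and just one; the last conjunct records this so that free cells can be budgeted by the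
  number of steps.\<close>

lemma tape_simulates_pstep:
  assumes "pstep (k, tape_store N cs) (k', \<sigma>)" "tape_ok N cs" "p < N" "0 < units N cs 0"
  shows "\<exists>cs' p'. (tstep N)\<^sup>*\<^sup>* (Run k, cs, p) (Run k', cs', p') \<and> tape_ok N cs' \<and> p' < N \<and>
    tape_store N cs' = \<sigma> \<and> units N cs 0 \<le> Suc (units N cs' 0)"
  using assms(1)
proof cases
  case (2 x)
  obtain j where j: "j < N" "cs j = 0" using units_pos[OF assms(4)] by blast
  have "(tstep N)\<^sup>*\<^sup>* (Run k, cs, p) (Run k, cs, j)" using 2 j by (intro walk_any) auto
  moreover have "tstep N (Run k, cs, j) (Run k', cs(j := x + 3), j)"
    using 2 j delta.inc[of x k'] by (intro tstep.stay) auto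
  ultimately have "(tstep N)\<^sup>*\<^sup>* (Run k, cs, p) (Run k', cs(j := x + 3), j)" by simp
  moreover have "tape_ok N (cs(j := x + 3))" using assms(2) j by (auto intro: tape_ok_upd)
  moreover have "tape_store N (cs(j := x + 3)) = \<sigma>" using tape_store_inc[of j N cs x] j 2 by simp
  moreover have "units N cs 0 \<le> Suc (units N (cs(j := x + 3)) 0)"
    using units_upd(1)[of j N cs 0 "x + 3"] j by simp
  ultimately show ?thesis using j(1) by blast
next
  case (3 x)
  then obtain j where j: "j < N" "cs j = x + 3"
    using units_pos[of N cs "x + 3"] by (auto simp: tape_store_def)
  have "(tstep N)\<^sup>*\<^sup>* (Run k, cs, p) (Run k, cs, j)" using 3 j by (intro walk_any) auto
  moreover have "tstep N (Run k, cs, j) (Run k', cs(j := 0), j)"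
    using 3 j delta.dec[of x k'] by (intro tstep.stay) auto
  ultimately have "(tstep N)\<^sup>*\<^sup>* (Run k, cs, p) (Run k', cs(j := 0), j)" by simp
  moreover have "tape_ok N (cs(j := 0))" using assms(2) j by (auto intro: tape_ok_upd)
  moreover have "tape_store N (cs(j := 0)) = \<sigma>" using tape_store_dec[of j N cs x] j 3 by simp
  moreover have "units N cs 0 \<le> Suc (units N (cs(j := 0)) 0)"
    using units_upd(1)[of j N cs "x + 3" 0] j by simp
  ultimately show ?thesis using j(1) by blast
next
  case (4 x)
  have "(tstep N)\<^sup>*\<^sup>* (Run k, cs, p) (Run k', cs, N - 1)"
    using 4 assms(2) zero_test[of N cs x k' p] by simp
  moreover have "N - 1 < N" using assms(3) by simp
  ultimately show ?thesis using 4 assms(2) by (metis le_SucI order_refl)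
next
  case 1
  then have "tstep N (Run k, cs, p) (Run k', cs(p := cs p), p)"
    by (auto intro!: tstep.stay delta.intros simp del: fun_upd_triv)
  then show ?thesis using 1 assms(2,3) by (intro exI[of _ cs] exI[of _ p]) auto
next
  case (5 a b)
  then have "tstep N (Run k, cs, p) (Run k', cs(p := cs p), p)"
    by (auto intro!: tstep.stay delta.intros simp del: fun_upd_triv)
  then show ?thesis using 5 assms(2,3) by (intro exI[of _ cs] exI[of _ p]) auto
next
  case (6 a)
  then have "tstep N (Run k, cs, p) (Run k', cs(p := cs p), p)"
    by (auto intro!: tstep.stay delta.intros simp del: fun_upd_triv)
  then show ?thesis using 6 assms(2,3) by (intro exI[of _ cs] exI[of _ p]) auto
next
  case (7 a)
  then have "tstep N (Run k, cs, p) (Run k', cs(p := cs p), p)"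
    by (auto intro!: tstep.stay delta.intros simp del: fun_upd_triv)
  then show ?thesis using 7 assms(2,3) by (intro exI[of _ cs] exI[of _ p]) auto
qed

lemma tape_complete:
  assumes "(pstep ^^ n) (k, tape_store N cs) ([], \<tau>)" "tape_ok N cs" "p < N" "n \<le> units N cs 0"
  shows "\<exists>cs' p'. (tstep N)\<^sup>*\<^sup>* (Run k, cs, p) (Run [], cs', p') \<and> p' < N"
  using assms
proof (induction n arbitrary: k cs p)
  case 0
  then show ?case by auto
next
  case (Suc n)
  from Suc.prems(1) obtain k' \<sigma> where k': "pstep (k, tape_store N cs) (k', \<sigma>)"
    "(pstep ^^ n) (k', \<sigma>) ([], \<tau>)" by (metis relpowp_Suc_D2 surj_pair)
  obtain cs1 p1 where 1: "(tstep N)\<^sup>*\<^sup>* (Run k, cs, p) (Run k', cs1, p1)" "tape_ok N cs1" "p1 < N"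
    "tape_store N cs1 = \<sigma>" "units N cs 0 \<le> Suc (units N cs1 0)"
    using tape_simulates_pstep[OF k'(1)] Suc.prems by force
  obtain cs' p' where "(tstep N)\<^sup>*\<^sup>* (Run k', cs1, p1) (Run [], cs', p')" "p' < N"
    using Suc.IH[of k' cs1 p1] k'(2) 1 Suc.prems(4) by auto
  with 1(1) show ?case by (meson rtranclp_trans)
qed

section \<open>Finiteness of the control and of the alphabet\<close>

definition heads :: "prog \<Rightarrow> head set" where
  "heads p = Run ` insert [] (conts p []) \<union>
     case_prod Scan ` ((\<lambda>(x, k). Zero x # k) -` conts p [])"

text \<open>New units are written by \<open>Inc\<close> only, so its registers bound the alphabet;
  the inserted \<open>1\<close> accounts for the input registers 0 and 1. As register
  \<open>x\<close> has symbol \<open>x + 3\<close>, all symbols are below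
  \<open>max_reg p + 4\<close>.\<close>

definition max_reg :: "prog \<Rightarrow> nat" where
  "max_reg p = Max (insert 1 (fst ` ((\<lambda>(x, k). Inc x # k) -` conts p [])))"

lemma finite_heads: "finite (heads p)"
  unfolding heads_def
  by (intro finite_UnI finite_imageI finite_vimageI finite.insertI finite_conts) (auto simp: inj_def)

lemma Run_in_heads: "Run k \<in> heads p \<longleftrightarrow> k = [] \<or> k \<in> conts p []"
  by (auto simp: heads_def)

lemma Scan_in_heads: "Scan x k \<in> heads p \<longleftrightarrow> Zero x # k \<in> conts p []"
  by (force simp: heads_def)

lemma finite_inc_regs: "finite (insert 1 (fst ` ((\<lambda>(x, k). Inc x # k) -` conts p [])))"
  by (intro finite_imageI finite_vimageI finite.insertI finite_conts) (auto simp: inj_def)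

lemma max_reg_ge: "Inc x # k \<in> conts p [] \<Longrightarrow> x \<le> max_reg p"
  unfolding max_reg_def
  by (rule Max_ge[OF finite_inc_regs], rule insertI2, rule image_eqI[of _ _ "(x, k)"]) simp_all

lemma max_reg_pos: "1 \<le> max_reg p"
  unfolding max_reg_def
  by (rule Max_ge[OF finite_inc_regs]) simp

lemma heads_pstep:
  assumes "Run k \<in> heads p" "pstep (k, \<sigma>) (k', \<sigma>')"
  shows "Run k' \<in> heads p"
proof -
  have "k \<noteq> []" using assms(2) by (auto elim: pstep.cases)
  then show ?thesis using conts_closed[OF assms(2)] assms(1) by (auto simp: Run_in_heads)
qed

lemma heads_closed:
  assumes "delta s c s' c' d" "s \<in> heads p"
  shows "s' \<in> heads p"
proof -
  \<comment> \<open>Closure concerns the control alone, so any store that enables the step serves: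
    all ones for \<open>Dec\<close>, all zeros for the other steps.\<close>
  let ?one = "\<lambda>_. 1 :: nat" and ?zero = "\<lambda>_. 0 :: nat"
  show ?thesis
    using assms(1)
  proof cases
    case (skip k)
    then show ?thesis using heads_pstep[OF _ pstep.intros(1)[of k ?zero]] assms(2) by simp
  next
    case (inc x k)
    then show ?thesis using heads_pstep[OF _ pstep.intros(2)[of x k ?zero]] assms(2) by simp
  next
    case (dec x k)
    then show ?thesis using heads_pstep[OF _ pstep.intros(3)[of ?one x k]] assms(2) by simp
  next
    case (zero x k)
    then show ?thesis using assms(2) by (simp add: Run_in_heads Scan_in_heads)
  next
    case (scanned x k)
    then have "Run (Zero x # k) \<in> heads p" using assms(2) by (simp add: Run_in_heads Scan_in_heads)
    then show ?thesis using heads_pstep[OF _ pstep.intros(4)[of ?zero x k]] scanned by simp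
  next
    case (seq q r k)
    then show ?thesis using heads_pstep[OF _ pstep.intros(5)[of q r k ?zero]] assms(2) by simp
  next
    case (exit q k)
    then show ?thesis using heads_pstep[OF _ pstep.intros(6)[of q k ?zero]] assms(2) by simp
  next
    case (iter q k)
    then show ?thesis using heads_pstep[OF _ pstep.intros(7)[of q k ?zero]] assms(2) by simp
  qed (use assms(2) in simp_all)
qed

lemma delta_symbol_bound:
  assumes "delta s c s' c' d" "s \<in> heads p" "c < max_reg p + 4"
  shows "c' < max_reg p + 4"
  using assms by cases (auto simp: Run_in_heads dest: max_reg_ge)

section \<open>The chain of cells\<close>

text \<open>Two neighbours exchange only boundedly many signals, whatever the program is. The head is
  therefore handed over in unary: as many pulses as its number says, then an end signal. Every
  state of a cell that carries the head has an idle loop, so that only a halted chain is dead.\<close>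

datatype cell = Halt | Rcv nat nat | Act nat nat | Snd bool nat nat

instance cell :: countable
  by countable_datatype

text \<open>Port 0 is the local step. Types 1 and 2 send a pulse and an end signal to the right,
  types 3 and 4 to the left. Ports 2 and 4 receive a pulse and an end signal from either side, so a
  receiver does not need to know where the head comes from.\<close>

definition chain_itys :: "nat list list" where
  "chain_itys = [[0], [1, 2], [3, 4], [2, 5], [4, 6]]"

text \<open>The first number is that of a head: counted so far in \<open>Rcv\<close>, complete in
  \<open>Act\<close>, still to be sent in \<open>Snd\<close>, whose flag is \<open>True\<close> for
  the right. The second is the symbol of the cell. \<open>Rcv\<close> and \<open>Halt\<close> have
  no transition at port 0, so that nothing moves once the head has halted.\<close>

inductive trans :: "cell \<Rightarrow> nat \<Rightarrow> cell \<Rightarrow> bool" where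
  act_loop: "trans (Act n c) 0 (Act n c)"
| snd_loop: "trans (Snd d n c) 0 (Snd d n c)"
| halt: "trans (Act (to_nat (Run [])) c) 0 Halt"
| stay: "delta s c s' c' None \<Longrightarrow> trans (Act (to_nat s) c) 0 (Act (to_nat s') c')"
| move: "delta s c s' c' (Some d) \<Longrightarrow> trans (Act (to_nat s) c) 0 (Snd d (to_nat s') c')"
| pulse_right: "trans (Snd True (Suc n) c) 1 (Snd True n c)"
| end_right: "trans (Snd True 0 c) 3 (Rcv 0 c)"
| pulse_left: "trans (Snd False (Suc n) c) 5 (Snd False n c)"
| end_left: "trans (Snd False 0 c) 6 (Rcv 0 c)"
| recv: "trans (Rcv n c) 2 (Rcv (Suc n) c)"
| begun: "trans (Rcv n c) 4 (Act n c)"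

text \<open>Polymorphic in the states, so that it applies to cells as well as to their numeric
  codes.\<close>

inductive cstep :: "nat \<Rightarrow> ('q \<Rightarrow> nat \<Rightarrow> 'q \<Rightarrow> bool) \<Rightarrow> (nat \<Rightarrow> 'q) \<Rightarrow> (nat \<Rightarrow> 'q) \<Rightarrow> bool"
  for N T where
  single: "i < N \<Longrightarrow> [a] \<in> set chain_itys \<Longrightarrow> T (x i) a y \<Longrightarrow> cstep N T x (x(i := y))"
| pair: "Suc i < N \<Longrightarrow> [a, b] \<in> set chain_itys \<Longrightarrow> T (x i) a y \<Longrightarrow> T (x (Suc i)) b z \<Longrightarrow>
    cstep N T x (x(i := y, Suc i := z))"

lemma cstep_pairI:
  assumes "Suc i < N" "[a, b] \<in> set chain_itys" "T q a y" "T r b z"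
  shows "cstep N T (x(i := q, Suc i := r)) (x(i := y, Suc i := z))"
proof -
  let ?x = "x(i := q, Suc i := r)"
  have "T (?x i) a y" "T (?x (Suc i)) b z" using assms by simp_all
  with assms(1,2) have "cstep N T ?x (?x(i := y, Suc i := z))" by (rule cstep.pair)
  moreover have "?x(i := y, Suc i := z) = x(i := y, Suc i := z)" by auto
  ultimately show ?thesis by metis
qed

section \<open>Soundness of the chain\<close>

definition idle :: "(nat \<Rightarrow> nat) \<Rightarrow> nat \<Rightarrow> cell" where
  "idle cs = (\<lambda>i. Rcv 0 (cs i))"

fun cells_of :: "tape_conf \<Rightarrow> nat \<Rightarrow> cell" where
  "cells_of (s, cs, p) = (idle cs)(p := Act (to_nat s) (cs p))"

lemma idle_apply [simp]: "idle cs i = Rcv 0 (cs i)"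
  by (simp add: idle_def)

lemma idle_upd [simp]: "(idle (cs(p := c)))(p := q) = (idle cs)(p := q)"
  by auto

text \<open>During a hand-over the tape head already stands on the target cell, and the pulses
  counted and those left add up to its number. A head that leaves the tape at an end finds no
  partner and idles in \<open>Snd\<close> forever; such a move has no counterpart in
  \<open>tstep\<close>, so the stuck cases promise nothing about \<open>P\<close>.\<close>

inductive net_inv :: "nat \<Rightarrow> tape_conf \<Rightarrow> (nat \<Rightarrow> cell) \<Rightarrow> bool" for N P where
  act: "(tstep N)\<^sup>*\<^sup>* P (s, cs, p) \<Longrightarrow> p < N \<Longrightarrow>
    net_inv N P ((idle cs)(p := Act (to_nat s) (cs p)))"
| right: "(tstep N)\<^sup>*\<^sup>* P (s, cs, Suc p) \<Longrightarrow> Suc p < N \<Longrightarrow> m + n = to_nat s \<Longrightarrow>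
    net_inv N P ((idle cs)(p := Snd True n (cs p), Suc p := Rcv m (cs (Suc p))))"
| left: "(tstep N)\<^sup>*\<^sup>* P (s, cs, p) \<Longrightarrow> Suc p < N \<Longrightarrow> m + n = to_nat s \<Longrightarrow>
    net_inv N P ((idle cs)(p := Rcv m (cs p), Suc p := Snd False n (cs (Suc p))))"
| stuck_right: "Suc p = N \<Longrightarrow> net_inv N P ((idle cs)(p := Snd True n (cs p)))"
| stuck_left: "0 < N \<Longrightarrow> net_inv N P ((idle cs)(0 := Snd False n (cs 0)))"
| halted: "(tstep N)\<^sup>*\<^sup>* P (Run [], cs, p) \<Longrightarrow> p < N \<Longrightarrow> net_inv N P ((idle cs)(p := Halt))"

inductive_simps trans_signal:
  "trans q 1 y" "trans q 2 y" "trans q 3 y" "trans q 4 y" "trans q 5 y" "trans q 6 y"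

lemma pair_cases:
  assumes "[a, b] \<in> set chain_itys" "trans q a y" "trans r b z"
  obtains (pulse_right) n c m c' where "q = Snd True (Suc n) c" "y = Snd True n c"
      "r = Rcv m c'" "z = Rcv (Suc m) c'"
    | (end_right) c m c' where "q = Snd True 0 c" "y = Rcv 0 c" "r = Rcv m c'" "z = Act m c'"
    | (pulse_left) n c m c' where "r = Snd False (Suc n) c" "z = Snd False n c"
      "q = Rcv m c'" "y = Rcv (Suc m) c'"
    | (end_left) c m c' where "r = Snd False 0 c" "z = Rcv 0 c" "q = Rcv m c'" "y = Act m c'"
proof -
  from assms(1) consider "a = 1 \<and> b = 2" | "a = 3 \<and> b = 4" | "a = 2 \<and> b = 5" | "a = 4 \<and> b = 6"
    unfolding chain_itys_def by auto
  then show thesis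
  proof cases
    case 1
    then show thesis using assms(2,3) pulse_right by (auto simp only: trans_signal)
  next
    case 2
    then show thesis using assms(2,3) end_right by (auto simp only: trans_signal)
  next
    case 3
    then show thesis using assms(2,3) pulse_left by (auto simp only: trans_signal)
  next
    case 4
    then show thesis using assms(2,3) end_left by (auto simp only: trans_signal)
  qed
qed

lemma single_cases:
  assumes "[a] \<in> set chain_itys" "trans q a y"
  obtains (loop) "y = q"
    | (halt) c where "q = Act (to_nat (Run [])) c" "y = Halt"
    | (stay) s c s' c' where "delta s c s' c' None" "q = Act (to_nat s) c" "y = Act (to_nat s') c'"
    | (move) s c s' c' d where "delta s c s' c' (Some d)" "q = Act (to_nat s) c" "y = Snd d (to_nat s') c'"
proof -
  have "a = 0" using assms(1) by (simp add: chain_itys_def)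
  with assms(2) have "trans q 0 y" by simp
  then show thesis
    by cases (use that in \<open>auto split: if_splits\<close>)
qed

lemma net_inv_single:
  assumes "net_inv N P x" "i < N" "[a] \<in> set chain_itys" "trans (x i) a y"
  shows "net_inv N P (x(i := y))"
  using assms(3,4)
proof (cases rule: single_cases)
  case loop
  then show ?thesis using assms(1) by simp
next
  case (halt c)
  from assms(1) show ?thesis
  proof cases
    case (act s cs p)
    then have "i = p" "s = Run []" using halt by (auto split: if_splits)
    then show ?thesis using act net_inv.halted[of N P cs p] halt by simp
  qed (use halt in \<open>auto split: if_splits\<close>)
next
  case (stay s c s' c')
  from assms(1) show ?thesis
  proof cases
    case (act r cs p)
    then have *: "i = p" "r = s" "c = cs p" using stay by (auto split: if_splits)
    then have "tstep N (r, cs, p) (s', cs(p := c'), p)" using stay(1) by (auto intro: tstep.stay)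
    then have "(tstep N)\<^sup>*\<^sup>* P (s', cs(p := c'), p)" using act(2) by simp
    then show ?thesis using net_inv.act[of N P s' "cs(p := c')" p] act * stay by simp
  qed (use stay in \<open>auto split: if_splits\<close>)
next
  case (move s c s' c' d)
  from assms(1) show ?thesis
  proof cases
    case (act r cs p)
    then have *: "i = p" "r = s" "c = cs p" using move by (auto split: if_splits)
    have x: "x(i := y) = (idle (cs(p := c')))(p := Snd d (to_nat s') ((cs(p := c')) p))"
      using * act move by simp
    show ?thesis
    proof (cases d)
      case True
      show ?thesis
      proof (cases "Suc p < N")
        case inside: True
        then have "tstep N (r, cs, p) (s', cs(p := c'), Suc p)"
          using move(1) * True by (auto intro: tstep.right)
        then have "(tstep N)\<^sup>*\<^sup>* P (s', cs(p := c'), Suc p)" using act(2) by simp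
        moreover have "x(i := y) = (idle (cs(p := c')))(p := Snd True (to_nat s') ((cs(p := c')) p),
            Suc p := Rcv 0 ((cs(p := c')) (Suc p)))"
          using x True by (auto simp: fun_eq_iff)
        ultimately show ?thesis
          using inside net_inv.right[of N P s' "cs(p := c')" p 0 "to_nat s'"] by simp
      next
        case False
        then have "Suc p = N" using act by simp
        then show ?thesis
          using net_inv.stuck_right[of p N P "cs(p := c')" "to_nat s'"] x True by simp
      qed
    next
      case False
      show ?thesis
      proof (cases p)
        case 0
        then show ?thesis
          using net_inv.stuck_left[of N P "cs(p := c')" "to_nat s'"] x False act by simp
      next
        case (Suc p')
        then have "tstep N (r, cs, p) (s', cs(p := c'), p')"
          using move(1) * False by (auto intro: tstep.left)
        then have "(tstep N)\<^sup>*\<^sup>* P (s', cs(p := c'), p')" using act(2) by simp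
        moreover have "x(i := y) = (idle (cs(p := c')))(p' := Rcv 0 ((cs(p := c')) p'),
            Suc p' := Snd False (to_nat s') ((cs(p := c')) (Suc p')))"
          using x False Suc by (auto simp: fun_eq_iff)
        ultimately show ?thesis
          using Suc act net_inv.left[of N P s' "cs(p := c')" p' 0 "to_nat s'"] by simp
      qed
    qed
  qed (use move in \<open>auto split: if_splits\<close>)
qed

lemma net_inv_pair:
  assumes "net_inv N P x" "Suc i < N" "[a, b] \<in> set chain_itys"
    "trans (x i) a y" "trans (x (Suc i)) b z"
  shows "net_inv N P (x(i := y, Suc i := z))"
  using assms(3,4,5)
proof (cases rule: pair_cases)
  case (pulse_right n c m c')
  from assms(1) show ?thesis
  proof cases
    case (right s cs p m' n')
    then have *: "i = p" using pulse_right by (auto split: if_splits)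
    then have "x(i := y, Suc i := z) =
        (idle cs)(p := Snd True n (cs p), Suc p := Rcv (Suc m') (cs (Suc p)))"
      "n' = Suc n"
      using right pulse_right by (auto simp: fun_eq_iff)
    then show ?thesis using net_inv.right[of N P s cs p "Suc m'" n] right by simp
  qed (use pulse_right assms(2) in \<open>auto split: if_splits\<close>)
next
  case (end_right c m c')
  from assms(1) show ?thesis
  proof cases
    case (right s cs p m' n')
    then have *: "i = p" using end_right by (auto split: if_splits)
    then have "x(i := y, Suc i := z) = (idle cs)(Suc p := Act (to_nat s) (cs (Suc p)))"
      using right end_right by (auto simp: fun_eq_iff)
    then show ?thesis using net_inv.act[of N P s cs "Suc p"] right by simp
  qed (use end_right assms(2) in \<open>auto split: if_splits\<close>)
next
  case (pulse_left n c m c')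
  from assms(1) show ?thesis
  proof cases
    case (left s cs p m' n')
    then have *: "i = p" using pulse_left by (auto split: if_splits)
    then have "x(i := y, Suc i := z) =
        (idle cs)(p := Rcv (Suc m') (cs p), Suc p := Snd False n (cs (Suc p)))"
      "n' = Suc n"
      using left pulse_left by (auto simp: fun_eq_iff)
    then show ?thesis using net_inv.left[of N P s cs p "Suc m'" n] left by simp
  qed (use pulse_left assms(2) in \<open>auto split: if_splits\<close>)
next
  case (end_left c m c')
  from assms(1) show ?thesis
  proof cases
    case (left s cs p m' n')
    then have *: "i = p" using end_left by (auto split: if_splits)
    then have "x(i := y, Suc i := z) = (idle cs)(p := Act (to_nat s) (cs p))"
      using left end_left by (auto simp: fun_eq_iff)
    then show ?thesis using net_inv.act[of N P s cs p] left by simp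
  qed (use end_left assms(2) in \<open>auto split: if_splits\<close>)
qed

lemma net_inv_steps:
  assumes "(cstep N trans)\<^sup>*\<^sup>* x y" "net_inv N P x"
  shows "net_inv N P y"
  using assms
  by (induction rule: rtranclp_induct) (auto elim!: cstep.cases intro: net_inv_single net_inv_pair)

lemma net_inv_Halt:
  assumes "net_inv N P x" "x i = Halt"
  shows "\<exists>cs p. (tstep N)\<^sup>*\<^sup>* P (Run [], cs, p)"
  using assms by cases (auto split: if_splits)

text \<open>The cell that carries the head, in state \<open>Act\<close> or \<open>Snd\<close>, has
  its idle loop.\<close>

lemma net_inv_live:
  assumes "net_inv N P x" "\<And>i. i < N \<Longrightarrow> x i \<noteq> Halt"
  shows "\<exists>i<N. trans (x i) 0 (x i)"
  using assms(1)
proof cases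
  case (act s cs p)
  then show ?thesis by (intro exI[of _ p]) (auto intro: trans.intros)
next
  case (right s cs p m n)
  then show ?thesis by (intro exI[of _ p]) (auto intro: trans.intros)
next
  case (left s cs p m n)
  then show ?thesis by (intro exI[of _ "Suc p"]) (auto intro: trans.intros)
next
  case (stuck_right p cs n)
  then show ?thesis by (intro exI[of _ p]) (auto intro: trans.intros)
next
  case (stuck_left cs n)
  then show ?thesis by (intro exI[of _ 0]) (auto intro: trans.intros)
next
  case (halted cs p)
  then show ?thesis using assms(2)[of p] by simp
qed

text \<open>Only \<open>Rcv\<close> and \<open>Halt\<close> occur: neither has a local step, and
  each pair interaction requires a partner in state \<open>Snd\<close>.\<close>

lemma halted_dead: "\<not> cstep N trans ((idle cs)(p := Halt)) y"
proof
  assume "cstep N trans ((idle cs)(p := Halt)) y"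
  then show False
  proof cases
    case (single i a y)
    from single(3,4) show False
      by (auto elim!: trans.cases simp: chain_itys_def split: if_splits)
  next
    case (pair i a b y z)
    from pair(3-5) show False
      by (cases rule: pair_cases) (auto split: if_splits)
  qed
qed

section \<open>Restriction to finitely many cell states\<close>

definition small_cells :: "nat \<Rightarrow> nat \<Rightarrow> cell set" where
  "small_cells K C = insert Halt (\<Union>n<K. \<Union>c<C. {Rcv n c, Act n c, Snd True n c, Snd False n c})"

lemma finite_small_cells: "finite (small_cells K C)"
  by (simp add: small_cells_def)

lemma in_small_cells [simp]:
  "Halt \<in> small_cells K C"
  "Rcv n c \<in> small_cells K C \<longleftrightarrow> n < K \<and> c < C"
  "Act n c \<in> small_cells K C \<longleftrightarrow> n < K \<and> c < C"
  "Snd d n c \<in> small_cells K C \<longleftrightarrow> n < K \<and> c < C"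
  by (cases d; auto simp: small_cells_def)+

text \<open>The behavior must be finite. Soundness is argued with the larger relation
  \<open>trans\<close>, whereas the simulation below has to stay within the bounds \<open>K\<close>
  on head numbers and \<open>C\<close> on symbols.\<close>

definition small_trans :: "nat \<Rightarrow> nat \<Rightarrow> cell \<Rightarrow> nat \<Rightarrow> cell \<Rightarrow> bool" where
  "small_trans K C q a r \<longleftrightarrow> trans q a r \<and> q \<in> small_cells K C \<and> r \<in> small_cells K C"

text \<open>Each pulse shifts one unit from \<open>n\<close> to \<open>m\<close>, so the induction
  starts from an arbitrary number \<open>m\<close> of pulses already counted.\<close>

lemma hand_over_right:
  assumes "Suc p < N" "m + n < K" "c < C" "c' < C"
  shows "(cstep N (small_trans K C))\<^sup>*\<^sup>* (x(p := Snd True n c, Suc p := Rcv m c'))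
    (x(p := Rcv 0 c, Suc p := Act (m + n) c'))"
  using assms
proof (induction n arbitrary: m)
  case 0
  let ?x = "x(p := Snd True 0 c, Suc p := Rcv m c')"
  have "small_trans K C (Snd True 0 c) 3 (Rcv 0 c)" "small_trans K C (Rcv m c') 4 (Act m c')"
    using 0 by (auto simp: small_trans_def intro: trans.intros)
  then have "cstep N (small_trans K C) ?x (x(p := Rcv 0 c, Suc p := Act (m + 0) c'))"
    using 0 by (intro cstep_pairI[where T = "small_trans K C" and a = 3 and b = 4]) (simp_all add: chain_itys_def)
  then show ?case by (rule r_into_rtranclp[of "cstep N (small_trans K C)"])
next
  case (Suc n)
  let ?x = "x(p := Snd True (Suc n) c, Suc p := Rcv m c')"
  have "small_trans K C (Snd True (Suc n) c) 1 (Snd True n c)" "small_trans K C (Rcv m c') 2 (Rcv (Suc m) c')"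
    using Suc.prems by (auto simp: small_trans_def intro: trans.intros trans.intros[unfolded One_nat_def])
  then have "cstep N (small_trans K C) ?x (x(p := Snd True n c, Suc p := Rcv (Suc m) c'))"
    using Suc.prems by (intro cstep_pairI[where T = "small_trans K C" and a = 1 and b = 2]) (simp_all add: chain_itys_def)
  moreover have "(cstep N (small_trans K C))\<^sup>*\<^sup>* (x(p := Snd True n c, Suc p := Rcv (Suc m) c'))
      (x(p := Rcv 0 c, Suc p := Act (m + Suc n) c'))"
    using Suc.IH[of "Suc m"] Suc.prems unfolding add_Suc_shift by blast
  ultimately show ?case by (rule converse_rtranclp_into_rtranclp[of "cstep N (small_trans K C)"])
qed

lemma hand_over_left:
  assumes "Suc p < N" "m + n < K" "c < C" "c' < C"
  shows "(cstep N (small_trans K C))\<^sup>*\<^sup>* (x(p := Rcv m c', Suc p := Snd False n c))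
    (x(p := Act (m + n) c', Suc p := Rcv 0 c))"
  using assms
proof (induction n arbitrary: m)
  case 0
  let ?x = "x(p := Rcv m c', Suc p := Snd False 0 c)"
  have "small_trans K C (Snd False 0 c) 6 (Rcv 0 c)" "small_trans K C (Rcv m c') 4 (Act m c')"
    using 0 by (auto simp: small_trans_def intro: trans.intros)
  then have "cstep N (small_trans K C) ?x (x(p := Act (m + 0) c', Suc p := Rcv 0 c))"
    using 0 by (intro cstep_pairI[where T = "small_trans K C" and a = 4 and b = 6]) (simp_all add: chain_itys_def)
  then show ?case by (rule r_into_rtranclp[of "cstep N (small_trans K C)"])
next
  case (Suc n)
  let ?x = "x(p := Rcv m c', Suc p := Snd False (Suc n) c)"
  have "small_trans K C (Snd False (Suc n) c) 5 (Snd False n c)" "small_trans K C (Rcv m c') 2 (Rcv (Suc m) c')"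
    using Suc.prems by (auto simp: small_trans_def intro: trans.intros trans.intros[unfolded One_nat_def])
  then have "cstep N (small_trans K C) ?x (x(p := Rcv (Suc m) c', Suc p := Snd False n c))"
    using Suc.prems by (intro cstep_pairI[where T = "small_trans K C" and a = 2 and b = 5]) (simp_all add: chain_itys_def)
  moreover have "(cstep N (small_trans K C))\<^sup>*\<^sup>* (x(p := Rcv (Suc m) c', Suc p := Snd False n c))
      (x(p := Act (m + Suc n) c', Suc p := Rcv 0 c))"
    using Suc.IH[of "Suc m"] Suc.prems unfolding add_Suc_shift by blast
  ultimately show ?case by (rule converse_rtranclp_into_rtranclp[of "cstep N (small_trans K C)"])
qed

lemma small_tick:
  assumes "p < N" "trans (x p) 0 y" "x p \<in> small_cells K C" "y \<in> small_cells K C"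
  shows "cstep N (small_trans K C) x (x(p := y))"
  using assms by (intro cstep.single[where T = "small_trans K C" and a = 0]) (auto simp: small_trans_def chain_itys_def)

lemma cells_simulate_tstep:
  assumes "tstep N (s, cs, p) (s', cs', p')" "p < N"
    and "to_nat s < K" "to_nat s' < K" "\<And>i. cs i < C" "\<And>i. cs' i < C"
  shows "(cstep N (small_trans K C))\<^sup>*\<^sup>* (cells_of (s, cs, p)) (cells_of (s', cs', p'))"
  using assms(1)
proof cases
  case (stay c)
  have "c < C" using assms(6)[of p] stay by simp
  then have "cstep N (small_trans K C) (cells_of (s, cs, p))
      ((cells_of (s, cs, p))(p := Act (to_nat s') c))"
    using assms trans.stay[OF stay(3)] by (intro small_tick) auto
  then show ?thesis using stay by simp
next
  case (right c)
  have "c < C" using assms(6)[of p] right by simp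
  then have "cstep N (small_trans K C) (cells_of (s, cs, p))
      ((cells_of (s, cs, p))(p := Snd True (to_nat s') c))"
    using assms trans.move[OF right(3)] by (intro small_tick) auto
  moreover have "(cells_of (s, cs, p))(p := Snd True (to_nat s') c) =
      (idle cs)(p := Snd True (to_nat s') c, Suc p := Rcv 0 (cs (Suc p)))" by auto
  moreover have "(cstep N (small_trans K C))\<^sup>*\<^sup>*
      ((idle cs)(p := Snd True (to_nat s') c, Suc p := Rcv 0 (cs (Suc p))))
      ((idle cs)(p := Rcv 0 c, Suc p := Act (0 + to_nat s') (cs (Suc p))))"
    using assms right \<open>c < C\<close> by (intro hand_over_right) auto
  moreover have "(idle cs)(p := Rcv 0 c, Suc p := Act (0 + to_nat s') (cs (Suc p))) =
      cells_of (s', cs', p')" using right by auto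
  ultimately show ?thesis
    using converse_rtranclp_into_rtranclp[of "cstep N (small_trans K C)" "cells_of (s, cs, p)"]
    by (simp only:)
next
  case (left c)
  have "c < C" using assms(6)[of p] left by simp
  then have "cstep N (small_trans K C) (cells_of (s, cs, p))
      ((cells_of (s, cs, p))(p := Snd False (to_nat s') c))"
    using assms trans.move[OF left(3)[folded left(1)]] left by (intro small_tick) auto
  moreover have "(cells_of (s, cs, p))(p := Snd False (to_nat s') c) =
      (idle cs)(p' := Rcv 0 (cs p'), Suc p' := Snd False (to_nat s') c)" using left by auto
  moreover have "(cstep N (small_trans K C))\<^sup>*\<^sup>*
      ((idle cs)(p' := Rcv 0 (cs p'), Suc p' := Snd False (to_nat s') c))
      ((idle cs)(p' := Act (0 + to_nat s') (cs p'), Suc p' := Rcv 0 c))"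
    using assms left \<open>c < C\<close> by (intro hand_over_left) auto
  moreover have "(idle cs)(p' := Act (0 + to_nat s') (cs p'), Suc p' := Rcv 0 c) =
      cells_of (s', cs', p')" using left by auto
  ultimately show ?thesis
    using converse_rtranclp_into_rtranclp[of "cstep N (small_trans K C)" "cells_of (s, cs, p)"]
    by (simp only:)
qed

definition head_bound :: "prog \<Rightarrow> nat" where
  "head_bound p = Suc (Max (to_nat ` heads p))"

lemma head_bound: "s \<in> heads p \<Longrightarrow> to_nat s < head_bound p"
  by (simp add: head_bound_def less_Suc_eq_le finite_heads)

lemma cells_simulate_tsteps:
  assumes "(tstep N)\<^sup>*\<^sup>* (s0, cs0, i0) (s, cs, i)" "i0 < N" "s0 \<in> heads p" "\<And>i. cs0 i < max_reg p + 4"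
  shows "(cstep N (small_trans (head_bound p) (max_reg p + 4)))\<^sup>*\<^sup>*
      (cells_of (s0, cs0, i0)) (cells_of (s, cs, i)) \<and>
    i < N \<and> s \<in> heads p \<and> (\<forall>i. cs i < max_reg p + 4)"
  using assms(1)
proof (induction "(s, cs, i)" arbitrary: s cs i rule: rtranclp_induct)
  case base
  then show ?case using assms by auto
next
  case (step y)
  obtain s1 cs1 i1 where y: "y = (s1, cs1, i1)" by (cases y)
  note IH = step.hyps(3)[OF y]
  note st = step.hyps(2)[unfolded y]
  from st have "s \<in> heads p \<and> i < N \<and> (\<forall>i. cs i < max_reg p + 4)"
  proof cases
    case (stay c)
    then show ?thesis using IH heads_closed[OF stay(3)] delta_symbol_bound[OF stay(3)] by auto
  next
    case (right c)
    then show ?thesis using IH heads_closed[OF right(3)] delta_symbol_bound[OF right(3)] by auto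
  next
    case (left c)
    then show ?thesis using IH heads_closed[OF left(3)] delta_symbol_bound[OF left(3)] by auto
  qed
  moreover from this have "(cstep N (small_trans (head_bound p) (max_reg p + 4)))\<^sup>*\<^sup>*
      (cells_of (s1, cs1, i1)) (cells_of (s, cs, i))"
    using IH by (intro cells_simulate_tstep[OF st]) (auto intro: head_bound)
  ultimately show ?case using IH by auto
qed

text \<open>Symbols 1 and 2 are the end markers, 3 and 4 are units of the registers 0 and 1, and the
  \<open>n\<close> zeros are the free cells.\<close>

definition input_word :: "nat \<Rightarrow> nat \<Rightarrow> nat \<Rightarrow> nat list" where
  "input_word a b n = 1 # replicate a 3 @ replicate b 4 @ replicate n 0 @ [2]"

lemma input_word_pos: "0 < length (input_word a b n)"
  by (simp add: input_word_def)

text \<open>The default 0 beyond the word keeps all positions within the alphabet, because the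
  symbol bounds range over every position.\<close>

definition word_tape :: "nat list \<Rightarrow> nat \<Rightarrow> nat" where
  "word_tape w i = (if i < length w then w ! i else 0)"

lemma units_word_tape: "units (length w) (word_tape w) c = length (filter (\<lambda>y. y = c) w)"
  by (auto simp: units_def word_tape_def length_filter_conv_card intro!: arg_cong[where f = card])

lemma tape_store_input: "tape_store (length (input_word a b n)) (word_tape (input_word a b n)) = input a b"
  unfolding tape_store_def units_word_tape
  by (auto simp: input_word_def input_def fun_eq_iff filter_replicate)

lemma units_input_free: "units (length (input_word a b n)) (word_tape (input_word a b n)) 0 = n"
  unfolding units_word_tape by (simp add: input_word_def filter_replicate)

lemma tape_ok_input: "tape_ok (length (input_word a b n)) (word_tape (input_word a b n))"
  by (auto simp: tape_ok_def word_tape_def input_word_def nth_Cons nth_append split: nat.splits)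

lemma word_tape_bound: "word_tape (input_word a b n) i < max_reg p + 4"
proof (cases "i < length (input_word a b n)")
  case True
  then have "word_tape (input_word a b n) i \<in> set (input_word a b n)"
    by (simp add: word_tape_def)
  then show ?thesis using max_reg_pos[of p] by (auto simp: input_word_def)
qed (use max_reg_pos[of p] in \<open>auto simp: word_tape_def\<close>)

definition start_cells :: "prog \<Rightarrow> nat list \<Rightarrow> nat \<Rightarrow> cell" where
  "start_cells p w = cells_of (Run [p], word_tape w, 0)"

definition prog_trans :: "prog \<Rightarrow> cell \<Rightarrow> nat \<Rightarrow> cell \<Rightarrow> bool" where
  "prog_trans p = small_trans (head_bound p) (max_reg p + 4)"

definition prog_cells :: "prog \<Rightarrow> cell set" where
  "prog_cells p = small_cells (head_bound p) (max_reg p + 4)"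

lemma start_in_heads: "Run [p] \<in> heads p"
  by (simp add: Run_in_heads conts_start)

lemma start_cells_small: "start_cells p (input_word a b n) i \<in> prog_cells p"
  using word_tape_bound[of a b n _ p] head_bound[OF start_in_heads[of p]]
  by (auto simp: start_cells_def prog_cells_def head_bound_def)

lemma cstep_mono: "cstep N T x y \<Longrightarrow> (\<And>q a r. T q a r \<Longrightarrow> T' q a r) \<Longrightarrow> cstep N T' x y"
  by (erule cstep.cases) (auto intro: cstep.intros)

lemma chain_halts:
  assumes "sem p (input a b) \<tau>"
  shows "\<exists>n x i. (cstep (length (input_word a b n)) (prog_trans p))\<^sup>*\<^sup>* (start_cells p (input_word a b n)) x \<and>
    i < length (input_word a b n) \<and> x i = Halt \<and> (\<forall>y. \<not> cstep (length (input_word a b n)) (prog_trans p) x y)"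
proof -
  from assms have "pstep\<^sup>*\<^sup>* ([p], input a b) ([], \<tau>)" by (simp add: psteps_iff_sem)
  \<comment> \<open>The length of a complete run also serves as the number of free cells.\<close>
  then obtain n where n: "(pstep ^^ n) ([p], input a b) ([], \<tau>)" by (meson rtranclp_imp_relpowp)
  let ?w = "input_word a b n"
  let ?N = "length ?w"
  obtain cs i where "(tstep ?N)\<^sup>*\<^sup>* (Run [p], word_tape ?w, 0) (Run [], cs, i)" "i < ?N"
    using tape_complete[of n "[p]" ?N "word_tape ?w" \<tau> 0] n tape_ok_input[of a b n]
    input_word_pos[of a b n]
    by (auto simp: tape_store_input units_input_free)
  then have *: "(cstep ?N (prog_trans p))\<^sup>*\<^sup>* (start_cells p ?w) (cells_of (Run [], cs, i)) \<and>
      (\<forall>i. cs i < max_reg p + 4)" "i < ?N"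
    using cells_simulate_tsteps[of ?N "Run [p]" "word_tape ?w" 0 "Run []" cs i p] start_in_heads
      word_tape_bound input_word_pos unfolding start_cells_def prog_trans_def by auto
  have "cstep ?N (prog_trans p) (cells_of (Run [], cs, i)) ((cells_of (Run [], cs, i))(i := Halt))"
    unfolding prog_trans_def using * trans.halt head_bound[of "Run []" p]
    by (intro small_tick) (auto simp: Run_in_heads)
  moreover have "(cells_of (Run [], cs, i))(i := Halt) = (idle cs)(i := Halt)" by simp
  ultimately have "(cstep ?N (prog_trans p))\<^sup>*\<^sup>* (start_cells p ?w) ((idle cs)(i := Halt))"
    using *(1) by (metis rtranclp.rtrancl_into_rtrancl)
  moreover have "\<not> cstep ?N (prog_trans p) ((idle cs)(i := Halt)) y" for y
    using halted_dead[of ?N cs i y] cstep_mono[of ?N "prog_trans p" "(idle cs)(i := Halt)" y trans]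
    by (auto simp: prog_trans_def small_trans_def)
  ultimately show ?thesis using *(2) by (metis fun_upd_same)
qed

lemma chain_runs_forever:
  assumes "\<And>\<tau>. \<not> sem p (input a b) \<tau>"
    and "(cstep (length (input_word a b n)) (prog_trans p))\<^sup>*\<^sup>* (start_cells p (input_word a b n)) x"
  shows "\<And>i. x i \<noteq> Halt" and "\<exists>y. cstep (length (input_word a b n)) (prog_trans p) x y"
proof -
  let ?w = "input_word a b n"
  let ?N = "length ?w"
  let ?P = "(Run [p], word_tape ?w, 0)"
  have "(cstep ?N trans)\<^sup>*\<^sup>* (start_cells p ?w) x"
    using assms(2) by (rule rtranclp_mono[THEN predicate2D, rotated])
      (auto simp: prog_trans_def small_trans_def intro: cstep_mono)
  moreover have "net_inv ?N ?P (start_cells p ?w)"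
    unfolding start_cells_def cells_of.simps by (rule net_inv.act) (auto simp: input_word_def)
  ultimately have inv: "net_inv ?N ?P x" by (rule net_inv_steps)
  show no_halt: "x i \<noteq> Halt" for i
  proof
    assume "x i = Halt"
    then obtain cs j where "(tstep ?N)\<^sup>*\<^sup>* ?P (Run [], cs, j)" using net_inv_Halt[OF inv] by blast
    from tape_sound[OF tape_ok_input input_word_pos this] assms(1) show False
      by (auto simp: tape_store_input psteps_iff_sem)
  qed
  \<comment> \<open>Liveness is known for \<open>trans\<close> only; the idle loop belongs to the
    restricted relation because reachable states stay small.\<close>
  have "x i \<in> prog_cells p" for i
    using assms(2)
  proof (induction arbitrary: i rule: rtranclp_induct)
    case base
    show ?case by (rule start_cells_small)
  next
    case (step y z)
    from step.hyps(2) show ?case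
      by cases (use step.IH in \<open>auto simp: prog_trans_def small_trans_def prog_cells_def\<close>)
  qed
  moreover obtain i where "i < ?N" "trans (x i) 0 (x i)" using net_inv_live[OF inv] no_halt by blast
  ultimately have "cstep ?N (prog_trans p) x (x(i := x i))"
    unfolding prog_trans_def by (intro small_tick) (auto simp: prog_cells_def)
  then show "\<exists>y. cstep ?N (prog_trans p) x y" by blast
qed

section \<open>From chains of cells to the net\<close>

text \<open>The shape generated by the rules for \<open>L\<close>: each cell has the unary type 0,
  and neighbours are linked by all four binary types 1 to 4.\<close>

definition chain_arch :: "nat list \<Rightarrow> arch" where
  "chain_arch us = (set us, \<lambda>k. if k = 0 then {[u] | u. u \<in> set us}
     else if k < 5 then {[us ! i, us ! Suc i] | i. Suc i < length us} else {})"

definition marking_of :: "nat list \<Rightarrow> (nat \<Rightarrow> nat) \<Rightarrow> marking" where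
  "marking_of us q = {(q i, us ! i) | i. i < length us}"

definition beh_trans :: "behavior \<Rightarrow> nat \<Rightarrow> nat \<Rightarrow> nat \<Rightarrow> bool" where
  "beh_trans beta q a r \<longleftrightarrow> (q, a, r) \<in> set (snd beta)"

lemma marking_of_mem:
  "distinct us \<Longrightarrow> i < length us \<Longrightarrow> (r, us ! i) \<in> marking_of us q \<longleftrightarrow> r = q i"
  by (auto simp: marking_of_def nth_eq_iff_index_eq)

lemma marking_of_upd:
  assumes "distinct us" "i < length us"
  shows "(marking_of us q - {(q i, us ! i)}) \<union> {(y, us ! i)} = marking_of us (q(i := y))"
  using assms by (fastforce simp: marking_of_def nth_eq_iff_index_eq split: if_splits)

lemma marking_of_upd2:
  assumes "distinct us" "i < length us" "j < length us" "i \<noteq> j"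
  shows "(marking_of us q - {(q i, us ! i), (q j, us ! j)}) \<union> {(y, us ! i), (z, us ! j)} =
    marking_of us (q(i := y, j := z))"
proof -
  have "(marking_of us q - {(q i, us ! i), (q j, us ! j)}) \<union> {(y, us ! i), (z, us ! j)} =
      ((marking_of us q - {(q i, us ! i)}) \<union> {(y, us ! i)} - {((q(i := y)) j, us ! j)}) \<union> {(z, us ! j)}"
    using assms by (auto simp: nth_eq_iff_index_eq)
  then show ?thesis by (simp only: marking_of_upd[OF assms(1)] assms(2,3))
qed

lemma chain_ity_cases:
  "k < length chain_itys \<longleftrightarrow> k = 0 \<or> k = 1 \<or> k = 2 \<or> k = 3 \<or> k = 4"
  by (auto simp: chain_itys_def)

lemma chain_itys_nth:
  "chain_itys ! 0 = [0]" "chain_itys ! 1 = [1, 2]" "chain_itys ! 2 = [3, 4]"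
  "chain_itys ! 3 = [2, 5]" "chain_itys ! 4 = [4, 6]"
  by (simp_all add: chain_itys_def eval_nat_numeral)

text \<open>As the indices are distinct, the marking holds exactly one place per position; hence the
  pre-set of a transition determines the states of the one or two cells that move.\<close>

lemma cstep_if_fire_step:
  assumes us: "distinct us" and fire: "fire_step chain_itys (chain_arch us) beta (marking_of us q) m"
  shows "\<exists>q'. cstep (length us) (beh_trans beta) q q' \<and> m = marking_of us q'"
proof -
  obtain k vs ts where t: "(k, vs, ts) \<in> net_trans chain_itys (chain_arch us) beta"
    "pre_set (k, vs, ts) \<subseteq> marking_of us q"
    and m: "m = (marking_of us q - pre_set (k, vs, ts)) \<union> post_set (k, vs, ts)"
    using fire unfolding fire_step_def by (metis prod_cases3)
  have k: "k < length chain_itys" and vs: "vs \<in> snd (chain_arch us) k"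
    and len: "length vs = length (chain_itys ! k)" "length ts = length vs"
    and ts: "\<forall>i<length ts. ts ! i \<in> set (snd beta) \<and> fst (snd (ts ! i)) = chain_itys ! k ! i"
    using t(1) by (auto simp: net_trans_def)
  show ?thesis
  proof (cases "k = 0")
    case True
    then obtain i where i: "i < length us" "vs = [us ! i]"
      using vs by (auto simp: chain_arch_def in_set_conv_nth)
    then obtain q1 a q2 where ts1: "ts = [(q1, a, q2)]"
      using len by (cases ts) auto
    have a: "[a] \<in> set chain_itys" "(q1, a, q2) \<in> set (snd beta)"
      using ts True ts1 by (auto simp: chain_itys_def)
    have "q1 = q i" using t(2) us i by (auto simp: pre_set_def ts1 marking_of_mem)
    then have "cstep (length us) (beh_trans beta) q (q(i := q2))"
      using a i by (intro cstep.single[where T = "beh_trans beta" and a = a]) (simp_all add: beh_trans_def)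
    moreover have "m = marking_of us (q(i := q2))"
      using m marking_of_upd[OF us i(1), of q q2] \<open>q1 = q i\<close>
      by (simp add: pre_set_def post_set_def ts1 i(2) insert_Collect)
    ultimately show ?thesis by blast
  next
    case False
    then have "k < 5" and len2: "length (chain_itys ! k) = 2"
      using k by (auto simp: chain_ity_cases chain_itys_nth chain_itys_nth[unfolded One_nat_def])
    then obtain i where i: "Suc i < length us" "vs = [us ! i, us ! Suc i]"
      using vs False by (auto simp: chain_arch_def)
    then have "length ts = Suc (Suc 0)" using len by simp
    then obtain q1 a q2 r1 b r2 where ts2: "ts = [(q1, a, q2), (r1, b, r2)]"
      by (auto simp: length_Suc_conv)
    have "chain_itys ! k = [a, b]"
      using ts len2 ts2 by (intro nth_equalityI) (auto simp: less_Suc_eq numeral_2_eq_2)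
    then have ab: "[a, b] \<in> set chain_itys" using k by (metis nth_mem)
    have tr: "(q1, a, q2) \<in> set (snd beta)" "(r1, b, r2) \<in> set (snd beta)"
      using ts ts2 by force+
    have "{(q1, us ! i), (r1, us ! Suc i)} \<subseteq> marking_of us q"
    proof -
      have "pre_set (k, vs, ts) = {(q1, us ! i), (r1, us ! Suc i)}"
        by (auto simp: pre_set_def ts2 i(2) less_Suc_eq intro: exI[of _ 0] exI[of _ "Suc 0"])
      then show ?thesis using t(2) by simp
    qed
    then have eq: "q1 = q i" "r1 = q (Suc i)" using us i(1) by (auto simp: marking_of_mem)
    have "cstep (length us) (beh_trans beta) q (q(i := q2, Suc i := r2))"
      using i ab tr eq
      by (intro cstep.pair[where T = "beh_trans beta" and a = a and b = b]) (simp_all add: beh_trans_def)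
    moreover have "m = marking_of us (q(i := q2, Suc i := r2))"
    proof -
      have "pre_set (k, vs, ts) = {(q i, us ! i), (q (Suc i), us ! Suc i)}"
        "post_set (k, vs, ts) = {(q2, us ! i), (r2, us ! Suc i)}"
        by (auto simp: pre_set_def post_set_def ts2 i(2) eq less_Suc_eq intro: exI[of _ 0] exI[of _ "Suc 0"])
      then show ?thesis using m marking_of_upd2[OF us, of i "Suc i" q q2 r2] i(1) by simp
    qed
    ultimately show ?thesis by blast
  qed
qed

lemma fire_step_if_cstep:
  assumes us: "distinct us" and step: "cstep (length us) (beh_trans beta) q q'"
  shows "fire_step chain_itys (chain_arch us) beta (marking_of us q) (marking_of us q')"
  using step
proof cases
  case (single i a y)
  have "a = 0" using single(3) by (simp add: chain_itys_def)
  let ?t = "(0, [us ! i], [(q i, a, y)]) :: nat \<times> nat list \<times> (nat \<times> nat \<times> nat) list"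
  have "?t \<in> net_trans chain_itys (chain_arch us) beta"
    using single \<open>a = 0\<close> by (simp add: net_trans_def chain_arch_def beh_trans_def chain_itys_def)
  moreover have "pre_set ?t = {(q i, us ! i)}" "post_set ?t = {(y, us ! i)}"
    by (simp_all add: pre_set_def post_set_def)
  moreover have "(q i, us ! i) \<in> marking_of us q" using us single(2) by (simp add: marking_of_mem)
  ultimately show ?thesis unfolding fire_step_def
    using marking_of_upd[OF us single(2), of q y] single(1) by (intro bexI[of _ ?t]) simp_all
next
  case (pair i a b y z)
  obtain k where k: "k < length chain_itys" "chain_itys ! k = [a, b]"
    using pair(3) by (auto simp: in_set_conv_nth)
  then have k': "0 < k" "k < 5" by (auto simp: chain_ity_cases chain_itys_nth)
  let ?t = "(k, [us ! i, us ! Suc i], [(q i, a, y), (q (Suc i), b, z)])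
    :: nat \<times> nat list \<times> (nat \<times> nat \<times> nat) list"
  have "?t \<in> net_trans chain_itys (chain_arch us) beta"
    using pair us k k'
    by (auto simp: net_trans_def chain_arch_def beh_trans_def nth_eq_iff_index_eq less_Suc_eq)
  moreover have "pre_set ?t = {(q i, us ! i), (q (Suc i), us ! Suc i)}"
    "post_set ?t = {(y, us ! i), (z, us ! Suc i)}"
    by (auto simp: pre_set_def post_set_def less_Suc_eq intro: exI[of _ 0] exI[of _ "Suc 0"])
  moreover have "(q i, us ! i) \<in> marking_of us q" "(q (Suc i), us ! Suc i) \<in> marking_of us q"
    using us pair(2) by (simp_all add: marking_of_mem)
  ultimately show ?thesis unfolding fire_step_def
    using marking_of_upd2[OF us, of i "Suc i" q y z] pair(1,2) by (intro bexI[of _ ?t]) simp_all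
qed

lemma dead_iff: "dead itys A beta m \<longleftrightarrow> (\<nexists>m'. fire_step itys A beta m m')"
  by (auto simp: dead_def fire_step_def)

text \<open>\<open>Halt\<close> gets the number 0 for every program, so the target state of the
  reachability problem is a constant.\<close>

definition code :: "cell \<Rightarrow> nat" where
  "code q = (if q = Halt then 0 else Suc (to_nat q))"

lemma code_inj [simp]: "code q = code r \<longleftrightarrow> q = r"
  by (auto simp: code_def)

lemma code_eq_0 [simp]: "code q = 0 \<longleftrightarrow> q = Halt"
  by (auto simp: code_def)

lemma finite_prog_trans: "finite {(code q, a, code r) | q a r. prog_trans p q a r}"
proof (rule finite_subset)
  show "{(code q, a, code r) | q a r. prog_trans p q a r} \<subseteq>
      code ` prog_cells p \<times> {..6} \<times> code ` prog_cells p"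
    by (auto simp: prog_trans_def small_trans_def prog_cells_def elim!: trans.cases)
qed (simp add: prog_cells_def finite_small_cells)

text \<open>Any enumerations will do: the code of the behavior is never computed, it is merely fed
  to the program as a number.\<close>

definition prog_beh :: "prog \<Rightarrow> behavior" where
  "prog_beh p = (SOME qs. set qs = code ` prog_cells p,
     SOME ts. set ts = {(code q, a, code r) | q a r. prog_trans p q a r})"

lemma states_prog_beh: "set (fst (prog_beh p)) = code ` prog_cells p"
proof -
  have "\<exists>qs. set qs = code ` prog_cells p"
    by (rule finite_list) (simp add: prog_cells_def finite_small_cells)
  then show ?thesis unfolding prog_beh_def fst_conv by (rule someI_ex)
qed

lemma trans_prog_beh: "set (snd (prog_beh p)) = {(code q, a, code r) | q a r. prog_trans p q a r}"
  unfolding prog_beh_def snd_conv by (rule someI_ex[OF finite_list[OF finite_prog_trans]])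

lemma beh_ok_prog_beh: "beh_ok {..6} (prog_beh p)"
  unfolding beh_ok_def states_prog_beh trans_prog_beh
  by (auto simp: prog_trans_def small_trans_def prog_cells_def elim!: trans.cases)

lemma beh_trans_prog: "beh_trans (prog_beh p) q a r \<longleftrightarrow>
    (\<exists>q' r'. q = code q' \<and> r = code r' \<and> prog_trans p q' a r')"
  by (auto simp: beh_trans_def trans_prog_beh)

text \<open>Every transition of the behavior joins codes, and \<open>code\<close> is injective, so
  steps transfer in both directions.\<close>

lemma cstep_code_iff:
  "cstep N (beh_trans (prog_beh p)) (code \<circ> x) y \<longleftrightarrow>
    (\<exists>x'. cstep N (prog_trans p) x x' \<and> y = code \<circ> x')"
proof
  assume "cstep N (beh_trans (prog_beh p)) (code \<circ> x) y"
  then show "\<exists>x'. cstep N (prog_trans p) x x' \<and> y = code \<circ> x'"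
  proof cases
    case (single i a q)
    then obtain r where r: "q = code r" "prog_trans p (x i) a r" by (auto simp: beh_trans_prog)
    have "cstep N (prog_trans p) x (x(i := r))"
      using single(2,3) r(2) by (rule cstep.single)
    moreover have "y = code \<circ> (x(i := r))" using single(1) r(1) by (auto simp: fun_eq_iff)
    ultimately show ?thesis by blast
  next
    case (pair i a b q q')
    then obtain r r' where r: "q = code r" "prog_trans p (x i) a r" "q' = code r'"
      "prog_trans p (x (Suc i)) b r'" by (auto simp: beh_trans_prog)
    have "cstep N (prog_trans p) x (x(i := r, Suc i := r'))"
      using pair(2,3) r(2,4) by (rule cstep.pair)
    moreover have "y = code \<circ> (x(i := r, Suc i := r'))" using pair(1) r(1,3) by (auto simp: fun_eq_iff)
    ultimately show ?thesis by blast
  qed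
next
  assume "\<exists>x'. cstep N (prog_trans p) x x' \<and> y = code \<circ> x'"
  then obtain x' where x': "cstep N (prog_trans p) x x'" "y = code \<circ> x'" by blast
  from x'(1) show "cstep N (beh_trans (prog_beh p)) (code \<circ> x) y"
  proof cases
    case (single i a q)
    have "y = (code \<circ> x)(i := code q)" using x'(2) single(1) by (auto simp: fun_eq_iff)
    moreover have "beh_trans (prog_beh p) ((code \<circ> x) i) a (code q)"
      using single(4) by (auto simp: beh_trans_prog)
    ultimately show ?thesis using cstep.single[where T = "beh_trans (prog_beh p)"] single(2,3) by simp
  next
    case (pair i a b q q')
    have "y = (code \<circ> x)(i := code q, Suc i := code q')" using x'(2) pair(1) by (auto simp: fun_eq_iff)
    moreover have "beh_trans (prog_beh p) ((code \<circ> x) i) a (code q)"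
      "beh_trans (prog_beh p) ((code \<circ> x) (Suc i)) b (code q')"
      using pair(4,5) by (auto simp: beh_trans_prog)
    ultimately show ?thesis using cstep.pair[where T = "beh_trans (prog_beh p)"] pair(2,3) by simp
  qed
qed

lemma reachable_iff:
  assumes us: "distinct us"
  shows "reachable chain_itys (chain_arch us) (prog_beh p) (marking_of us (code \<circ> x)) m \<longleftrightarrow>
    (\<exists>x'. (cstep (length us) (prog_trans p))\<^sup>*\<^sup>* x x' \<and> m = marking_of us (code \<circ> x'))"
proof
  let ?m = "marking_of us (code \<circ> x)"
  assume "reachable chain_itys (chain_arch us) (prog_beh p) ?m m"
  then have "(fire_step chain_itys (chain_arch us) (prog_beh p))\<^sup>*\<^sup>* ?m m" by (simp add: reachable_def)
  then show "\<exists>x'. (cstep (length us) (prog_trans p))\<^sup>*\<^sup>* x x' \<and> m = marking_of us (code \<circ> x')"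
  proof (induction rule: rtranclp_induct)
    case base
    then show ?case by blast
  next
    case (step m1 m2)
    then obtain x1 where x1: "(cstep (length us) (prog_trans p))\<^sup>*\<^sup>* x x1" "m1 = marking_of us (code \<circ> x1)"
      by blast
    with cstep_if_fire_step[OF us] step.hyps(2) obtain y where
      "cstep (length us) (beh_trans (prog_beh p)) (code \<circ> x1) y" "m2 = marking_of us y" by blast
    then obtain x2 where "cstep (length us) (prog_trans p) x1 x2" "m2 = marking_of us (code \<circ> x2)"
      by (auto simp: cstep_code_iff)
    with x1(1) show ?case
      using rtranclp.rtrancl_into_rtrancl[of "cstep (length us) (prog_trans p)" x x1 x2] by blast
  qed
next
  let ?m = "marking_of us (code \<circ> x)"
  assume "\<exists>x'. (cstep (length us) (prog_trans p))\<^sup>*\<^sup>* x x' \<and> m = marking_of us (code \<circ> x')"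
  then obtain x' where x': "(cstep (length us) (prog_trans p))\<^sup>*\<^sup>* x x'" "m = marking_of us (code \<circ> x')"
    by blast
  let ?fire = "fire_step chain_itys (chain_arch us) (prog_beh p)"
  from x'(1) have "?fire\<^sup>*\<^sup>* ?m (marking_of us (code \<circ> x'))"
  proof (induction rule: rtranclp_induct)
    case (step x1 x2)
    from step.hyps(2) have "cstep (length us) (beh_trans (prog_beh p)) (code \<circ> x1) (code \<circ> x2)"
      using cstep_code_iff by blast
    from fire_step_if_cstep[OF us this] step.IH show ?case
      using rtranclp.rtrancl_into_rtrancl[of ?fire] by blast
  qed simp
  with x'(2) show "reachable chain_itys (chain_arch us) (prog_beh p) ?m m" by (simp add: reachable_def)
qed

lemma dead_chain_iff:
  assumes "distinct us"
  shows "dead chain_itys (chain_arch us) (prog_beh p) (marking_of us (code \<circ> x)) \<longleftrightarrow>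
    (\<nexists>y. cstep (length us) (prog_trans p) x y)"
  unfolding dead_iff
  using cstep_if_fire_step[OF assms, of "prog_beh p" "code \<circ> x"]
    fire_step_if_cstep[OF assms, of "prog_beh p" "code \<circ> x"] cstep_code_iff[of "length us" p x]
  by metis

lemma precise_chain:
  assumes "distinct us" "\<And>i. x i \<in> prog_cells p"
  shows "precise (chain_arch us) (prog_beh p) (marking_of us (code \<circ> x))"
proof -
  have "\<exists>!q. (q, u) \<in> marking_of us (code \<circ> x)" if "u \<in> set us" for u
    using that assms(1) by (auto simp: in_set_conv_nth marking_of_mem)
  moreover have "marking_of us (code \<circ> x) \<subseteq> code ` prog_cells p \<times> set us"
    using assms(2) by (auto simp: marking_of_def)
  ultimately show ?thesis by (simp add: precise_def states_prog_beh chain_arch_def)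
qed

section \<open>Chains as models of the sentences\<close>

declare split_paired_Ex [simp del] split_paired_All [simp del]

inductive_cases sat_EmpE: "sat itys D Q s Emp A m"
inductive_cases sat_CAtomE: "sat itys D Q s (CAtom x) A m"
inductive_cases sat_CStAtomE: "sat itys D Q s (CStAtom x q) A m"
inductive_cases sat_IAtomE: "sat itys D Q s (IAtom k xs) A m"

lemma sat_Emp_iff: "sat itys D Q s Emp A m \<longleftrightarrow> A = arch_empty \<and> m = {}"
  by (blast elim: sat_EmpE intro: sat.intros)

lemma sat_CAtom_iff: "sat itys D Q s (CAtom x) A m \<longleftrightarrow>
    (\<exists>q\<in>Q. A = ({s x}, \<lambda>k. {}) \<and> m = {(q, s x)})"
  by (blast elim: sat_CAtomE intro: sat.intros)

lemma sat_CStAtom_iff: "sat itys D Q s (CStAtom x q) A m \<longleftrightarrow>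
    q \<in> Q \<and> A = ({s x}, \<lambda>k. {}) \<and> m = {(q, s x)}"
  by (blast elim: sat_CStAtomE intro: sat.intros)

lemma sat_IAtom_iff: "sat itys D Q s (IAtom k xs) A m \<longleftrightarrow>
    k < length itys \<and> length xs = length (itys ! k) \<and>
    A = ({}, \<lambda>j. if j = k then {map s xs} else {}) \<and> m = {}"
  by (blast elim: sat_IAtomE intro: sat.intros)

inductive_simps sat_PAtom_iff: "sat itys D Q s (PAtom a xs) A m"
inductive_simps sat_Ex_iff: "sat itys D Q s (Ex x f) A m"
inductive_cases sat_StarE: "sat itys D Q s (Star f g) A m"

lemma sat_Star_iff: "sat itys D Q s (Star f g) A m \<longleftrightarrow>
    (\<exists>A1 m1 A2 m2. sat itys D Q s f A1 m1 \<and> sat itys D Q s g A2 m2 \<and> arch_disj A1 A2 \<and>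
      A = arch_union A1 A2 \<and> m = m1 \<union> m2)"
  by (rule iffI, erule sat_StarE, blast, blast intro: sat_star)

lemma sat_finite: "sat itys D Q s f A m \<Longrightarrow> finite (fst A)"
  by (induction rule: sat.induct) (auto simp: arch_empty_def arch_union_def)

abbreviation csat :: "sid \<Rightarrow> nat set \<Rightarrow> store \<Rightarrow> form \<Rightarrow> arch \<Rightarrow> marking \<Rightarrow> bool" where
  "csat \<equiv> sat chain_itys"

definition unary :: "nat \<Rightarrow> form" where
  "unary x = stars (map (\<lambda>k. IAtom k [x]) (itypes_of_arity chain_itys 1))"

definition binary :: "nat \<Rightarrow> nat \<Rightarrow> form" where
  "binary x z = stars (map (\<lambda>k. IAtom k [x, z]) (itypes_of_arity chain_itys 2))"

definition unary_arch :: "nat \<Rightarrow> arch" where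
  "unary_arch u = ({}, \<lambda>k. if k = 0 then {[u]} else {})"

definition binary_arch :: "nat \<Rightarrow> nat \<Rightarrow> arch" where
  "binary_arch u v = ({}, \<lambda>k. if 0 < k \<and> k < 5 then {[u, v]} else {})"

text \<open>The contribution of one predicate atom: a cell with its links, where the right end
  \<open>v\<close> is a component of the rest of the chain only.\<close>

definition link_arch :: "nat \<Rightarrow> nat \<Rightarrow> arch" where
  "link_arch u v = ({u}, \<lambda>k. if k = 0 then {[u]} else if k < 5 then {[u, v]} else {})"

lemma itypes_chain: "itypes_of_arity chain_itys 1 = [0]" "itypes_of_arity chain_itys 2 = [1, 2, 3, 4]"
  by (simp_all add: itypes_of_arity_def chain_itys_def upt_rec)

lemma unary_eq: "unary x = Star (IAtom 0 [x]) Emp"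
  unfolding unary_def itypes_chain by simp

lemma binary_eq: "binary x z = Star (IAtom 1 [x, z]) (Star (IAtom 2 [x, z])
    (Star (IAtom 3 [x, z]) (Star (IAtom 4 [x, z]) Emp)))"
  unfolding binary_def itypes_chain by simp

lemma sat_inter_Star_iff:
  assumes "k < length itys" "length xs = length (itys ! k)"
  shows "sat itys D Q s (Star (IAtom k xs) g) A m \<longleftrightarrow>
    (\<exists>B. sat itys D Q s g B m \<and> map s xs \<notin> snd B k \<and>
      A = (fst B, (snd B)(k := insert (map s xs) (snd B k))))"
proof -
  have "arch_disj ({}, \<lambda>j. if j = k then {map s xs} else {}) B \<longleftrightarrow> map s xs \<notin> snd B k" for B
    by (auto simp: arch_disj_def)
  moreover have "arch_union ({}, \<lambda>j. if j = k then {map s xs} else {}) B =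
      (fst B, (snd B)(k := insert (map s xs) (snd B k)))" for B
    by (auto simp: arch_union_def fun_eq_iff)
  ultimately show ?thesis using assms by (auto simp: sat_Star_iff sat_IAtom_iff)
qed

lemma sat_unary_iff: "csat D Q s (unary x) A m \<longleftrightarrow> A = unary_arch (s x) \<and> m = {}"
proof -
  have "({}, (\<lambda>k. {})(0 := {[s x]})) = unary_arch (s x)"
    by (auto simp: unary_arch_def fun_eq_iff)
  then show ?thesis
    by (simp add: unary_eq sat_inter_Star_iff sat_Emp_iff chain_ity_cases chain_itys_nth arch_empty_def)
      auto
qed

lemma sat_binary_iff: "csat D Q s (binary x z) A m \<longleftrightarrow> A = binary_arch (s x) (s z) \<and> m = {}"
proof -
  let ?l = "[s x, s z]"
  have "({}, (\<lambda>k. {})(4 := {?l}, 3 := {?l}, 2 := {?l}, Suc 0 := {?l})) = binary_arch (s x) (s z)"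
    by (auto simp: binary_arch_def fun_eq_iff)
  then show ?thesis
    by (simp add: binary_eq sat_inter_Star_iff sat_Emp_iff chain_ity_cases chain_itys_nth
        chain_itys_nth[unfolded One_nat_def] arch_empty_def) auto
qed

definition link_form :: "nat \<Rightarrow> form" where
  "link_form q = Star (CStAtom 0 q) (Star (unary 0) (binary 0 1))"

lemma sat_link_form_iff:
  "csat D Q s (link_form q) A m \<longleftrightarrow> q \<in> Q \<and> A = link_arch (s 0) (s 1) \<and> m = {(q, s 0)}"
proof -
  have "arch_union ({u}, \<lambda>k. {}) (arch_union (unary_arch u) (binary_arch u v)) = link_arch u v" for u v
    by (auto simp: arch_union_def unary_arch_def binary_arch_def link_arch_def fun_eq_iff)
  moreover have "arch_disj (unary_arch u) (binary_arch u v)"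
    "arch_disj ({u}, \<lambda>k. {}) (arch_union (unary_arch u) (binary_arch u v))" for u v
    by (auto simp: arch_disj_def arch_union_def unary_arch_def binary_arch_def)
  ultimately show ?thesis
    by (auto simp: link_form_def sat_Star_iff sat_CStAtom_iff sat_unary_iff sat_binary_iff)
qed

lemma sat_end_iff:
  "csat D Q s (Star (CStAtom x q) (unary x)) A m \<longleftrightarrow> q \<in> Q \<and> A = chain_arch [s x] \<and> m = {(q, s x)}"
proof -
  have "arch_union ({u}, \<lambda>k. {}) (unary_arch u) = chain_arch [u]" "arch_disj ({u}, \<lambda>k. {}) (unary_arch u)" for u
    by (auto simp: arch_union_def unary_arch_def chain_arch_def arch_disj_def fun_eq_iff)
  then show ?thesis by (auto simp: sat_Star_iff sat_CStAtom_iff sat_unary_iff)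
qed

lemma chain_arch_Cons:
  assumes "us \<noteq> []"
  shows "arch_union (link_arch u (hd us)) (chain_arch us) = chain_arch (u # us)"
proof -
  have "{[(u # us) ! i, (u # us) ! Suc i] | i. Suc i < length (u # us)} =
      insert [u, hd us] {[us ! i, us ! Suc i] | i. Suc i < length us}"
  proof (intro set_eqI iffI)
    fix l assume "l \<in> {[(u # us) ! i, (u # us) ! Suc i] | i. Suc i < length (u # us)}"
    then obtain i where "l = [(u # us) ! i, (u # us) ! Suc i]" "Suc i < length (u # us)" by blast
    then show "l \<in> insert [u, hd us] {[us ! i, us ! Suc i] | i. Suc i < length us}"
      using assms by (cases i) (auto simp: hd_conv_nth)
  next
    fix l assume "l \<in> insert [u, hd us] {[us ! i, us ! Suc i] | i. Suc i < length us}"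
    then consider "l = [u, hd us]" | i where "l = [us ! i, us ! Suc i]" "Suc i < length us" by blast
    then show "l \<in> {[(u # us) ! i, (u # us) ! Suc i] | i. Suc i < length (u # us)}"
    proof cases
      case 1
      then show ?thesis using assms by (intro CollectI exI[of _ 0]) (auto simp: hd_conv_nth)
    next
      case 2
      then show ?thesis by (intro CollectI exI[of _ "Suc i"]) auto
    qed
  qed
  then show ?thesis
    by (auto simp: arch_union_def link_arch_def chain_arch_def fun_eq_iff)
qed

text \<open>All tuples of the link start with \<open>u\<close>, so separation amounts to the absence
  of \<open>u\<close> among the indices. This is how the separating conjunction forces the cells to
  be distinct.\<close>

lemma chain_arch_disj:
  "arch_disj (link_arch u v) (chain_arch us) \<longleftrightarrow> u \<notin> set us"
proof
  assume "u \<notin> set us"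
  moreover have "us ! i \<in> set us" if "Suc i < length us" for i using that by simp
  ultimately show "arch_disj (link_arch u v) (chain_arch us)"
    by (auto simp: arch_disj_def link_arch_def chain_arch_def)
qed (auto simp: arch_disj_def link_arch_def chain_arch_def)

lemma marking_of_zip:
  "length us = n \<Longrightarrow> marking_of us q = set (zip (map q [0..<n]) us)"
  unfolding marking_of_def set_zip by (intro Collect_cong ex_cong1) auto

text \<open>The leftmost index \<open>u\<close> is exposed because the links of a cell put in front
  refer to it.\<close>

definition chained :: "nat \<Rightarrow> nat list \<Rightarrow> arch \<Rightarrow> marking \<Rightarrow> bool" where
  "chained u qs A m \<longleftrightarrow> (\<exists>us. us \<noteq> [] \<and> hd us = u \<and> distinct us \<and> length us = length qs \<and>
     A = chain_arch us \<and> m = set (zip qs us))"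

lemma chained_single: "chained u [q] A m \<longleftrightarrow> A = chain_arch [u] \<and> m = {(q, u)}"
  by (auto simp: chained_def length_Suc_conv intro!: exI[of _ "[u]"])

lemma chained_Cons:
  assumes "qs \<noteq> []"
  shows "chained u (q # qs) A m \<longleftrightarrow> (\<exists>v A2 m2. chained v qs A2 m2 \<and> arch_disj (link_arch u v) A2 \<and>
    A = arch_union (link_arch u v) A2 \<and> m = {(q, u)} \<union> m2)"
proof
  assume "chained u (q # qs) A m"
  then obtain us where us: "hd us = u" "distinct us" "length us = Suc (length qs)" "us \<noteq> []"
    "A = chain_arch us" "m = set (zip (q # qs) us)" by (auto simp: chained_def)
  then obtain vs where vs: "us = u # vs" by (cases us) auto
  then have "vs \<noteq> []" using us assms by auto
  then have "chained (hd vs) qs (chain_arch vs) (set (zip qs vs))"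
    "arch_disj (link_arch u (hd vs)) (chain_arch vs)"
    "A = arch_union (link_arch u (hd vs)) (chain_arch vs)" "m = {(q, u)} \<union> set (zip qs vs)"
    using us vs by (auto simp: chained_def chain_arch_Cons chain_arch_disj)
  then show "\<exists>v A2 m2. chained v qs A2 m2 \<and> arch_disj (link_arch u v) A2 \<and>
    A = arch_union (link_arch u v) A2 \<and> m = {(q, u)} \<union> m2" by blast
next
  assume "\<exists>v A2 m2. chained v qs A2 m2 \<and> arch_disj (link_arch u v) A2 \<and>
    A = arch_union (link_arch u v) A2 \<and> m = {(q, u)} \<union> m2"
  then obtain us where us: "us \<noteq> []" "distinct us" "length us = length qs"
    "arch_disj (link_arch u (hd us)) (chain_arch us)"
    "A = arch_union (link_arch u (hd us)) (chain_arch us)" "m = {(q, u)} \<union> set (zip qs us)"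
    by (auto simp: chained_def)
  then show "chained u (q # qs) A m"
    unfolding chained_def by (intro exI[of _ "u # us"]) (auto simp: chain_arch_Cons chain_arch_disj)
qed

section \<open>The SID and the sentences of a program\<close>

abbreviation cell_code :: "nat \<Rightarrow> nat" where
  "cell_code c \<equiv> code (Rcv 0 c)"

definition head_code :: "prog \<Rightarrow> nat" where
  "head_code p = code (Act (to_nat (Run [p])) 1)"

text \<open>Predicate \<open>0\<close> generates the unused right part of a chain; the predicates \<open>1\<close> to \<open>4\<close> stand for
  a single cell (the start cell, a unit of register 0, a unit of register 1, a free cell) together
  with its links to the right neighbour.\<close>

definition prog_sid :: "prog \<Rightarrow> sid" where
  "prog_sid p =
    [(0, [0], Star (CStAtom 0 (cell_code 2)) (unary 0)),
     (0, [0], Ex 1 (Star (PAtom 4 [0, 1]) (PAtom 0 [1]))),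
     (1, [0, 1], link_form (head_code p)),
     (2, [0, 1], link_form (cell_code 3)),
     (3, [0, 1], link_form (cell_code 4)),
     (4, [0, 1], link_form (cell_code 0))]"

text \<open>The variables count down along the chain to 0. This makes the sentence, and later its
  code, primitive recursive in the number of cells.\<close>

primrec second_form :: "nat \<Rightarrow> form" where
  "second_form 0 = PAtom 0 [0]"
| "second_form (Suc j) = Ex j (Star (PAtom 3 [Suc j, j]) (second_form j))"

primrec first_form :: "nat \<Rightarrow> nat \<Rightarrow> form" where
  "first_form b 0 = second_form b"
| "first_form b (Suc i) = Ex (b + i) (Star (PAtom 2 [Suc (b + i), b + i]) (first_form b i))"

definition input_form :: "nat \<Rightarrow> nat \<Rightarrow> form" where
  "input_form a b = Ex (Suc (b + a)) (Ex (b + a) (Star (PAtom 1 [Suc (b + a), b + a]) (first_form b a)))"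

lemma fv_unary [simp]: "fv (unary x) = {x}" "preds (unary x) = {}"
  "wf_form chain_itys Q (unary x)"
  by (simp_all add: unary_eq chain_itys_def)

lemma fv_binary [simp]: "fv (binary x z) = {x, z}" "preds (binary x z) = {}"
  "wf_form chain_itys Q (binary x z)"
  by (auto simp: binary_eq chain_itys_def)

lemma states_used:
  "cell_code 0 \<in> set (fst (prog_beh p))" "cell_code 2 \<in> set (fst (prog_beh p))"
  "cell_code 3 \<in> set (fst (prog_beh p))" "cell_code 4 \<in> set (fst (prog_beh p))"
  "head_code p \<in> set (fst (prog_beh p))" "0 \<in> set (fst (prog_beh p))"
proof -
  have "0 = code Halt" by simp
  then show "0 \<in> set (fst (prog_beh p))"
    unfolding states_prog_beh prog_cells_def by (rule image_eqI) simp
qed (use max_reg_pos[of p] head_bound[OF start_in_heads[of p]] in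
  \<open>auto simp: states_prog_beh prog_cells_def head_code_def head_bound_def\<close>)

lemma sid_ok_prog_sid: "sid_ok chain_itys (set (fst (prog_beh p))) (prog_sid p)"
  using states_used[of p] by (auto simp: sid_ok_def prog_sid_def link_form_def)

lemma sid_preds_prog_sid: "sid_preds (prog_sid p) = {0, 1, 2, 3, 4}"
  by (auto simp: sid_preds_def prog_sid_def link_form_def)

lemma fv_second_form: "fv (second_form b) = {b}"
  by (induction b) auto

lemma fv_first_form: "fv (first_form b a) = {b + a}"
  by (induction a) (auto simp: fv_second_form)

lemma fv_input_form: "fv (input_form a b) = {}"
  by (auto simp: input_form_def fv_first_form)

lemma wf_second_form: "wf_form itys Q (second_form b)"
  by (induction b) auto

lemma wf_first_form: "wf_form itys Q (first_form b a)"
  by (induction a) (auto simp: wf_second_form)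

lemma wf_input_form: "wf_form itys Q (input_form a b)"
  by (auto simp: input_form_def wf_first_form)

text \<open>Puts one cell in front of a chain; \<open>w n\<close> is the word of states of the
  remaining chain with \<open>n\<close> free cells.\<close>

lemma sat_link_Ex:
  assumes link: "\<And>s A m. csat D Q s f A m \<longleftrightarrow> A = link_arch (s x) (s z) \<and> m = {(q, s x)}"
    and rest: "\<And>s A m. csat D Q s g A m \<longleftrightarrow> (\<exists>n. chained (s z) (w n) A m)"
    and w: "\<And>n. w n \<noteq> []" and "x \<noteq> z"
  shows "csat D Q s (Ex z (Star f g)) A m \<longleftrightarrow> (\<exists>n. chained (s x) (q # w n) A m)"
  unfolding sat_Ex_iff sat_Star_iff link rest chained_Cons[OF w]
  using \<open>x \<noteq> z\<close> by simp blast

text \<open>Linearity is an entailment over the SID extended by the rules for \<open>L\<close>, hence the models have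
  to be determined for such extensions, too.\<close>

locale extended_sid =
  fixes p :: prog and D :: sid
  assumes rules: "\<And>a r. a < 5 \<Longrightarrow> (a, r) \<in> set D \<longleftrightarrow> (a, r) \<in> set (prog_sid p)"
begin

abbreviation "states \<equiv> set (fst (prog_beh p))"

lemma sat_link:
  "csat D states s (PAtom 1 [x, z]) A m \<longleftrightarrow> A = link_arch (s x) (s z) \<and> m = {(head_code p, s x)}"
  "csat D states s (PAtom 2 [x, z]) A m \<longleftrightarrow> A = link_arch (s x) (s z) \<and> m = {(cell_code 3, s x)}"
  "csat D states s (PAtom 3 [x, z]) A m \<longleftrightarrow> A = link_arch (s x) (s z) \<and> m = {(cell_code 4, s x)}"
  "csat D states s (PAtom 4 [x, z]) A m \<longleftrightarrow> A = link_arch (s x) (s z) \<and> m = {(cell_code 0, s x)}"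
proof -
  have *: "csat D states s (PAtom a [x, z]) A m \<longleftrightarrow> A = link_arch (s x) (s z) \<and> m = {(q, s x)}"
    if "a < 5" "q \<in> states" "\<And>ps b. (a, ps, b) \<in> set (prog_sid p) \<longleftrightarrow> ps = [0, 1] \<and> b = link_form q" for a q
  proof -
    have "csat D states s (PAtom a [x, z]) A m \<longleftrightarrow>
      (\<exists>s'. s' 0 = s x \<and> s' 1 = s z \<and> csat D states s' (link_form q) A m)"
      using that(1,3) by (auto simp: sat_PAtom_iff rules All_less_Suc2)
    also have "\<dots> \<longleftrightarrow> A = link_arch (s x) (s z) \<and> m = {(q, s x)}"
      using that(2) by (auto simp: sat_link_form_iff intro: exI[of _ "(\<lambda>_. s z)(0 := s x)"])
    finally show ?thesis .
  qed
  show "csat D states s (PAtom 1 [x, z]) A m \<longleftrightarrow> A = link_arch (s x) (s z) \<and> m = {(head_code p, s x)}"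
    by (rule *) (auto simp: states_used prog_sid_def)
  show "csat D states s (PAtom 2 [x, z]) A m \<longleftrightarrow> A = link_arch (s x) (s z) \<and> m = {(cell_code 3, s x)}"
    by (rule *) (auto simp: states_used prog_sid_def)
  show "csat D states s (PAtom 3 [x, z]) A m \<longleftrightarrow> A = link_arch (s x) (s z) \<and> m = {(cell_code 4, s x)}"
    by (rule *) (auto simp: states_used prog_sid_def)
  show "csat D states s (PAtom 4 [x, z]) A m \<longleftrightarrow> A = link_arch (s x) (s z) \<and> m = {(cell_code 0, s x)}"
    by (rule *) (auto simp: states_used prog_sid_def)
qed

text \<open>Truth depends on the store only through the value of the argument. Moving the recursive
  occurrence to a canonical store turns the rules into a recursion on the architecture.\<close>

lemma sat_rest_unfold: "csat D states s (PAtom 0 [x]) A m \<longleftrightarrow>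
    A = chain_arch [s x] \<and> m = {(cell_code 2, s x)} \<or>
    (\<exists>v A2 m2. csat D states ((\<lambda>_. 0)(1 := v)) (PAtom 0 [1]) A2 m2 \<and> arch_disj (link_arch (s x) v) A2 \<and>
      A = arch_union (link_arch (s x) v) A2 \<and> m = {(cell_code 0, s x)} \<union> m2)"
proof -
  have cong: "csat D states s1 (PAtom 0 [1]) B n \<longleftrightarrow> csat D states s2 (PAtom 0 [1]) B n"
    if "s1 1 = s2 1" for s1 s2 B n
    using that by (simp add: sat_PAtom_iff cong: conj_cong)
  have unfold: "csat D states s (PAtom 0 [x]) A m \<longleftrightarrow>
      (\<exists>s'. s' 0 = s x \<and> (csat D states s' (Star (CStAtom 0 (cell_code 2)) (unary 0)) A m \<or>
         csat D states s' (Ex 1 (Star (PAtom 4 [0, 1]) (PAtom 0 [1]))) A m))"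
    unfolding sat_PAtom_iff[of _ _ _ _ 0]
    by (simp add: rules prog_sid_def conj_disj_distribR conj_disj_distribL ex_disj_distrib)
  have last: "csat D states s' (Star (CStAtom 0 (cell_code 2)) (unary 0)) A m \<longleftrightarrow>
      A = chain_arch [s x] \<and> m = {(cell_code 2, s x)}" if "s' 0 = s x" for s'
    using that states_used(2)[of p] by (simp add: sat_end_iff)
  have inner: "csat D states s' (Ex 1 (Star (PAtom 4 [0, 1]) (PAtom 0 [1]))) A m \<longleftrightarrow>
    (\<exists>v A2 m2. csat D states ((\<lambda>_. 0)(1 := v)) (PAtom 0 [1]) A2 m2 \<and> arch_disj (link_arch (s x) v) A2 \<and>
      A = arch_union (link_arch (s x) v) A2 \<and> m = {(cell_code 0, s x)} \<union> m2)" if "s' 0 = s x" for s'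
  proof -
    have "csat D states (s'(1 := v)) (PAtom 0 [1]) = csat D states ((\<lambda>_. 0)(1 := v)) (PAtom 0 [1])" for v
      by (intro ext cong) simp
    then show ?thesis
      unfolding sat_Ex_iff sat_Star_iff[of _ _ _ _ "PAtom 4 [0, 1]"] sat_link using that by simp
  qed
  have "\<exists>s' :: store. s' 0 = s x" by (rule exI[of _ "\<lambda>_. s x"]) simp
  with unfold show ?thesis by (simp only: last inner cong: conj_cong) simp
qed

abbreviation rest_word :: "nat \<Rightarrow> nat list" where
  "rest_word n \<equiv> replicate n (cell_code 0) @ [cell_code 2]"

text \<open>Each unfolding splits off one component, so the first direction is by induction on the
  number of components, which is finite by \<open>sat_finite\<close>.\<close>

lemma sat_rest_iff:
  "csat D states s (PAtom 0 [x]) A m \<longleftrightarrow> (\<exists>n. chained (s x) (rest_word n) A m)"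
proof
  assume "csat D states s (PAtom 0 [x]) A m"
  then show "\<exists>n. chained (s x) (rest_word n) A m"
  proof (induction "card (fst A)" arbitrary: s x A m rule: less_induct)
    case less
    from less.prems sat_rest_unfold[of s x A m] consider
      "A = chain_arch [s x]" "m = {(cell_code 2, s x)}"
      | v A2 m2 where "csat D states ((\<lambda>_. 0)(1 := v)) (PAtom 0 [1]) A2 m2"
        "arch_disj (link_arch (s x) v) A2"
        "A = arch_union (link_arch (s x) v) A2" "m = {(cell_code 0, s x)} \<union> m2" by blast
    then show ?case
    proof cases
      case 1
      then show ?thesis by (intro exI[of _ 0]) (simp add: chained_single)
    next
      case 2
      have "fst A = insert (s x) (fst A2)" "s x \<notin> fst A2"
        using 2(2,3) by (auto simp: arch_union_def link_arch_def arch_disj_def)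
      then have "card (fst A2) < card (fst A)" using sat_finite[OF 2(1)] by simp
      from less.hyps[OF this 2(1)] obtain n where "chained v (rest_word n) A2 m2" by auto
      then have "chained (s x) (rest_word (Suc n)) A m"
        using 2 chained_Cons[of "rest_word n" "s x" "cell_code 0" A m] by auto
      then show ?thesis by blast
    qed
  qed
next
  assume "\<exists>n. chained (s x) (rest_word n) A m"
  then obtain n where "chained (s x) (rest_word n) A m" by blast
  then show "csat D states s (PAtom 0 [x]) A m"
  proof (induction n arbitrary: s x A m)
    case 0
    then show ?case by (subst sat_rest_unfold) (simp add: chained_single)
  next
    case (Suc n)
    then obtain v A2 m2 where "chained v (rest_word n) A2 m2" "arch_disj (link_arch (s x) v) A2"
      "A = arch_union (link_arch (s x) v) A2" "m = {(cell_code 0, s x)} \<union> m2"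
      using chained_Cons[of "rest_word n" "s x" "cell_code 0" A m] by auto
    moreover from this(1) have "csat D states ((\<lambda>_. 0)(1 := v)) (PAtom 0 [1]) A2 m2"
      by (intro Suc.IH) simp
    ultimately show ?case by (subst sat_rest_unfold) blast
  qed
qed

lemma sat_second_form_iff: "csat D states s (second_form b) A m \<longleftrightarrow>
    (\<exists>n. chained (s b) (replicate b (cell_code 4) @ rest_word n) A m)"
proof (induction b arbitrary: s A m)
  case 0
  show ?case by (simp add: sat_rest_iff)
next
  case (Suc b)
  show ?case
    using sat_link_Ex[OF sat_link(3) Suc.IH, where x = "Suc b"] by simp
qed

lemma sat_first_form_iff: "csat D states s (first_form b a) A m \<longleftrightarrow>
    (\<exists>n. chained (s (b + a)) (replicate a (cell_code 3) @ replicate b (cell_code 4) @ rest_word n) A m)"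
proof (induction a arbitrary: s A m)
  case 0
  show ?case by (simp add: sat_second_form_iff)
next
  case (Suc a)
  show ?case
    using sat_link_Ex[OF sat_link(2) Suc.IH, where x = "Suc (b + a)"] by simp
qed

definition start_word :: "nat \<Rightarrow> nat \<Rightarrow> nat \<Rightarrow> nat list" where
  "start_word a b n = head_code p # replicate a (cell_code 3) @ replicate b (cell_code 4) @ rest_word n"

lemma models_input_form_iff: "models chain_itys D states (input_form a b) A m \<longleftrightarrow>
    (\<exists>u n. chained u (start_word a b n) A m)"
proof -
  have "csat D states s (Ex (b + a) (Star (PAtom 1 [Suc (b + a), b + a]) (first_form b a))) A m \<longleftrightarrow>
      (\<exists>n. chained (s (Suc (b + a))) (start_word a b n) A m)" for s
    using sat_link_Ex[OF sat_link(1) sat_first_form_iff, where x = "Suc (b + a)"]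
    by (simp add: start_word_def)
  then have "models chain_itys D states (input_form a b) A m \<longleftrightarrow>
      (\<exists>s :: store. \<exists>v. \<exists>n. chained ((s(Suc (b + a) := v)) (Suc (b + a))) (start_word a b n) A m)"
    unfolding models_def input_form_def sat_Ex_iff[of _ _ _ _ "Suc (b + a)"] by blast
  then show ?thesis by simp
qed

lemma start_word_eq: "start_word a b n =
    map (\<lambda>i. code (start_cells p (input_word a b n) i)) [0..<length (input_word a b n)]"
proof (rule nth_equalityI)
  show len: "length (start_word a b n) =
      length (map (\<lambda>i. code (start_cells p (input_word a b n) i)) [0..<length (input_word a b n)])"
    by (simp add: start_word_def input_word_def)
  fix i assume "i < length (start_word a b n)"
  then have i: "i < length (input_word a b n)" using len by simp
  have tl: "start_word a b n = head_code p # map cell_code (tl (input_word a b n))"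
    by (simp add: start_word_def input_word_def)
  have "start_word a b n ! i = code (start_cells p (input_word a b n) i)"
  proof (cases i)
    case 0
    then show ?thesis
      by (simp add: tl start_cells_def head_code_def word_tape_def input_word_def)
  next
    case (Suc j)
    then show ?thesis
      using i by (simp add: tl start_cells_def word_tape_def nth_tl less_diff_conv)
  qed
  then show "start_word a b n ! i =
      map (\<lambda>i. code (start_cells p (input_word a b n) i)) [0..<length (input_word a b n)] ! i"
    using i by simp
qed

text \<open>The indices and the number of free cells are all that the sentence leaves open, so
  choosing a model means choosing the length of the tape.\<close>

lemma models_input_form_cells_iff: "models chain_itys D states (input_form a b) A m \<longleftrightarrow>
    (\<exists>us n. distinct us \<and> length us = length (input_word a b n) \<and> A = chain_arch us \<and>
      m = marking_of us (code \<circ> start_cells p (input_word a b n)))"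
proof -
  have "us \<noteq> []" if "length us = length (input_word a b n)" for us :: "nat list" and n
    using that by (auto simp: input_word_def)
  moreover have "set (zip (start_word a b n) us) = marking_of us (code \<circ> start_cells p (input_word a b n))"
    if "length us = length (input_word a b n)" for us n
    unfolding start_word_eq marking_of_zip[OF that] by (simp add: comp_def)
  moreover have "length (start_word a b n) = length (input_word a b n)" for n
    by (simp add: start_word_eq)
  ultimately show ?thesis unfolding models_input_form_iff chained_def by metis
qed

end

text \<open>The recursive rule for \<open>L\<close> takes off the leftmost cell and passes the right
  end on unchanged, as in the induction on \<open>us\<close>.\<close>

lemma sat_linear_chain:
  assumes rules: "set (lin_rules chain_itys L) \<subseteq> set D"
    and "us \<noteq> []" "distinct us" "length us = length qs" "set qs \<subseteq> Q"
    and "s x = hd us" "s y = last us"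
  shows "csat D Q s (PAtom L [x, y]) (chain_arch us) (set (zip qs us))"
  using assms(2-)
proof (induction us arbitrary: qs s x y)
  case Nil
  then show ?case by simp
next
  case (Cons u us)
  obtain q qs' where qs: "qs = q # qs'" using Cons.prems(3) by (cases qs) auto
  then have q: "q \<in> Q" "set qs' \<subseteq> Q" using Cons.prems(4) by auto
  show ?case
  proof (cases us)
    case Nil
    let ?b = "Star (CAtom 0) (unary 0)"
    have "(L, [0, 0], ?b) \<in> set D"
      using rules by (simp add: lin_rules_def unary_def)
    moreover have "csat D Q (\<lambda>_. u) ?b (chain_arch [u]) {(q, u)}"
    proof -
      have "arch_union ({u}, \<lambda>k. {}) (unary_arch u) = chain_arch [u]" "arch_disj ({u}, \<lambda>k. {}) (unary_arch u)"
        by (auto simp: arch_union_def unary_arch_def chain_arch_def arch_disj_def fun_eq_iff)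
      then show ?thesis using q(1) by (auto simp: sat_Star_iff sat_CAtom_iff sat_unary_iff)
    qed
    \<comment> \<open>The base rule has the parameter list \<open>[0, 0]\<close>, so both arguments
      must denote the only index of the chain.\<close>
    moreover have "\<forall>i<length [0 :: nat, 0]. (\<lambda>_. u) ([0 :: nat, 0] ! i) = s ([x, y] ! i)"
      using Cons.prems(5,6) Nil by (auto simp: less_Suc_eq)
    ultimately have "csat D Q s (PAtom L [x, y]) (chain_arch [u]) {(q, u)}"
      by (intro sat_pred[of L "[0, 0]" ?b]) auto
    then show ?thesis using Cons.prems(3) Nil qs by simp
  next
    case us: (Cons v vs)
    then have ne: "us \<noteq> []" by simp
    let ?b = "Ex 2 (Star (CAtom 0) (Star (unary 0) (Star (binary 0 2) (PAtom L [2, 1]))))"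
    let ?s = "(\<lambda>_ :: nat. 0 :: nat)(0 := u, 1 := last us)"
    let ?t = "?s(2 := hd us)"
    have t: "?t 0 = u" "?t 1 = last us" "?t 2 = hd us" by simp_all
    have "(L, [0, 1], ?b) \<in> set D"
      using rules by (simp add: lin_rules_def unary_def binary_def)
    moreover have "csat D Q ?s ?b (chain_arch (u # us)) (set (zip qs (u # us)))"
    proof -
      have "csat D Q ?t (PAtom L [2, 1]) (chain_arch us) (set (zip qs' us))"
        using Cons.prems(2,3) ne q(2) qs by (intro Cons.IH) auto
      moreover have "u \<notin> set us" using Cons.prems(2) by simp
      \<comment> \<open>The rule spreads what is here a single link over three conjuncts, the
        component, its unary and its binary interactions; each needs its own disjointness from the
        rest.\<close>
      then have disj: "arch_disj (link_arch u (hd us)) (chain_arch us)" by (simp add: chain_arch_disj)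
      then have "arch_disj (binary_arch u (hd us)) (chain_arch us)"
        "arch_disj (unary_arch u) (arch_union (binary_arch u (hd us)) (chain_arch us))"
        "arch_disj ({u}, \<lambda>k. {}) (arch_union (unary_arch u) (arch_union (binary_arch u (hd us)) (chain_arch us)))"
        by (auto simp: arch_disj_def link_arch_def binary_arch_def unary_arch_def arch_union_def split: if_splits)
      moreover have "csat D Q ?t (unary 0) (unary_arch u) {}" "csat D Q ?t (binary 0 2) (binary_arch u (hd us)) {}"
        "csat D Q ?t (CAtom 0) ({u}, \<lambda>k. {}) {(q, u)}"
        using q(1) by (simp_all add: sat_unary_iff sat_binary_iff sat_CAtom_iff)
      ultimately have "csat D Q ?t (Star (CAtom 0) (Star (unary 0) (Star (binary 0 2) (PAtom L [2, 1]))))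
          (arch_union ({u}, \<lambda>k. {}) (arch_union (unary_arch u) (arch_union (binary_arch u (hd us)) (chain_arch us))))
          ({(q, u)} \<union> ({} \<union> ({} \<union> set (zip qs' us))))"
        by (intro sat_star)
      moreover have "arch_union ({u}, \<lambda>k. {}) (arch_union (unary_arch u) (arch_union (binary_arch u (hd us)) (chain_arch us))) =
          chain_arch (u # us)"
        unfolding chain_arch_Cons[OF ne, symmetric]
        by (auto simp: link_arch_def binary_arch_def unary_arch_def arch_union_def fun_eq_iff)
      ultimately show ?thesis unfolding sat_Ex_iff by (intro exI[of _ "hd us"]) (simp add: qs)
    qed
    moreover have "\<forall>i<length [0 :: nat, 1]. ?s ([0, 1] ! i) = s ([x, y] ! i)"
      using Cons.prems(5,6) ne by (auto simp: less_Suc_eq)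
    ultimately show ?thesis by (intro sat_pred[of L "[0, 1]" ?b _ _ ?s]) simp_all
  qed
qed

interpretation prog_sid: extended_sid p "prog_sid p"
  by unfold_locales simp

lemma linear_input_form:
  "linear chain_itys (set (fst (prog_beh p))) (prog_sid p) (input_form a b)"
  unfolding linear_def entails_def
proof (intro allI impI)
  fix L A m
  let ?D = "prog_sid p @ lin_rules chain_itys L"
  let ?Q = "set (fst (prog_beh p))"
  assume "L \<notin> sid_preds (prog_sid p) \<and> L \<notin> preds (input_form a b)"
    and mod: "models chain_itys ?D ?Q (input_form a b) A m"
  then have L: "L \<noteq> 0" "L \<noteq> 1" "L \<noteq> 2" "L \<noteq> 3" "L \<noteq> 4" by (simp_all add: sid_preds_prog_sid)
  \<comment> \<open>A fresh \<open>L\<close> differs from the predicates 0 to 4, so its rules leave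
    theirs intact and the models are the same chains as before.\<close>
  interpret extended_sid p ?D
    by unfold_locales (use L in \<open>auto simp: lin_rules_def less_Suc_eq eval_nat_numeral\<close>)
  obtain us n where us: "distinct us" "length us = length (input_word a b n)" "A = chain_arch us"
    "m = marking_of us (code \<circ> start_cells p (input_word a b n))"
    using mod models_input_form_cells_iff by blast
  let ?qs = "map (code \<circ> start_cells p (input_word a b n)) [0..<length us]"
  have "us \<noteq> []" using us(2) by (auto simp: input_word_def)
  moreover have "set ?qs \<subseteq> ?Q" using start_cells_small by (auto simp: states_prog_beh)
  moreover have "m = set (zip ?qs us)" by (simp add: us(4) marking_of_zip)
  ultimately have "csat ?D ?Q ((\<lambda>_. 0)(0 := hd us, 1 := last us)) (PAtom L [0, 1]) A m"
    using sat_linear_chain[of L ?D us ?qs ?Q] us by simp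
  then have "csat ?D ?Q (\<lambda>_. 0) (Ex 0 (Ex 1 (PAtom L [0, 1]))) A m"
    unfolding sat_Ex_iff by blast
  then show "models chain_itys ?D ?Q (Ex 0 (Ex 1 (PAtom L [0, 1]))) A m"
    unfolding models_def by blast
qed

lemma lin_instance: "(prog_sid p, prog_beh p, input_form a b) \<in> lin_instances {..6} chain_itys"
  by (simp add: lin_instances_def sid_ok_prog_sid beh_ok_prog_beh fv_input_form wf_input_form
      linear_input_form)

lemma reach_instance: "((prog_sid p, prog_beh p, input_form a b), 0) \<in> reach_instances {..6} chain_itys"
  by (simp add: reach_instances_def lin_instance states_used)

section \<open>Deadlock and reachability express halting\<close>

lemma deadlock_and_reach_if_halts:
  assumes "sem p (input a b) \<tau>"
  shows "deadlock chain_itys (input_form a b) (prog_sid p) (prog_beh p)"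
    and "reach1 chain_itys (input_form a b) 0 (prog_sid p) (prog_beh p)"
proof -
  obtain n x i where x: "(cstep (length (input_word a b n)) (prog_trans p))\<^sup>*\<^sup>* (start_cells p (input_word a b n)) x"
    "i < length (input_word a b n)" "x i = Halt"
    "\<forall>y. \<not> cstep (length (input_word a b n)) (prog_trans p) x y"
    using chain_halts[OF assms] by blast
  define us where "us = [0..<length (input_word a b n)]"
  have us: "distinct us" "length us = length (input_word a b n)" by (simp_all add: us_def)
  let ?m = "marking_of us (code \<circ> start_cells p (input_word a b n))"
  let ?m' = "marking_of us (code \<circ> x)"
  have 1: "models chain_itys (prog_sid p) (set (fst (prog_beh p))) (input_form a b) (chain_arch us) ?m"
    using us prog_sid.models_input_form_cells_iff by blast
  have 2: "precise (chain_arch us) (prog_beh p) ?m"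
    using us(1) start_cells_small by (rule precise_chain)
  have 3: "reachable chain_itys (chain_arch us) (prog_beh p) ?m ?m'"
    unfolding reachable_iff[OF us(1)] us(2) using x(1) by blast
  have 4: "dead chain_itys (chain_arch us) (prog_beh p) ?m'"
    unfolding dead_chain_iff[OF us(1)] us(2) using x(4) by blast
  have 5: "(0, us ! i) \<in> ?m'" using us x(2,3) by (simp add: marking_of_mem)
  show "deadlock chain_itys (input_form a b) (prog_sid p) (prog_beh p)"
    unfolding deadlock_def using 1 2 3 4 by blast
  show "reach1 chain_itys (input_form a b) 0 (prog_sid p) (prog_beh p)"
    unfolding reach1_def using 1 2 3 5 by blast
qed

lemma halts_if_deadlock_or_reach:
  assumes "deadlock chain_itys (input_form a b) (prog_sid p) (prog_beh p) \<or>
    reach1 chain_itys (input_form a b) 0 (prog_sid p) (prog_beh p)"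
  shows "\<exists>\<tau>. sem p (input a b) \<tau>"
proof (rule ccontr)
  assume "\<nexists>\<tau>. sem p (input a b) \<tau>"
  then have never: "\<And>\<tau>. \<not> sem p (input a b) \<tau>" by blast
  from assms obtain A m m' where mod: "models chain_itys (prog_sid p) (set (fst (prog_beh p))) (input_form a b) A m"
    and reach: "reachable chain_itys A (prog_beh p) m m'"
    and goal: "dead chain_itys A (prog_beh p) m' \<or> (\<exists>u. (0, u) \<in> m')"
    unfolding deadlock_def reach1_def by blast
  obtain us n where us: "distinct us" "length us = length (input_word a b n)" "A = chain_arch us"
    "m = marking_of us (code \<circ> start_cells p (input_word a b n))"
    using mod prog_sid.models_input_form_cells_iff by blast
  obtain x where x: "(cstep (length (input_word a b n)) (prog_trans p))\<^sup>*\<^sup>* (start_cells p (input_word a b n)) x"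
    "m' = marking_of us (code \<circ> x)"
    using reach unfolding us(3,4) reachable_iff[OF us(1)] us(2) by blast
  from goal show False
  proof
    assume "dead chain_itys A (prog_beh p) m'"
    then show False
      unfolding us(3) x(2) dead_chain_iff[OF us(1)] us(2)
      using chain_runs_forever(2)[OF never x(1)] by blast
  next
    assume "\<exists>u. (0, u) \<in> m'"
    then obtain i where "code (x i) = 0" unfolding x(2) marking_of_def by auto
    then show False using chain_runs_forever(1)[OF never x(1)] by simp
  qed
qed

theorem deadlock_reach_iff_halts:
  "deadlock chain_itys (input_form a b) (prog_sid p) (prog_beh p) \<longleftrightarrow> (\<exists>\<tau>. sem p (input a b) \<tau>)"
  "reach1 chain_itys (input_form a b) 0 (prog_sid p) (prog_beh p) \<longleftrightarrow> (\<exists>\<tau>. sem p (input a b) \<tau>)"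
  using deadlock_and_reach_if_halts halts_if_deadlock_or_reach by blast+

section \<open>Computing the code of an instance\<close>

definition computable :: "nat \<Rightarrow> (nat list \<Rightarrow> nat) \<Rightarrow> bool" where
  "computable n F \<longleftrightarrow> (\<exists>f. \<forall>xs. length xs = n \<longrightarrow> recf_eval f xs (F xs))"

lemma computable_cong:
  "computable n F \<Longrightarrow> (\<And>xs. length xs = n \<Longrightarrow> F xs = G xs) \<Longrightarrow> computable n G"
  unfolding computable_def by metis

lemma computable_proj: "i < n \<Longrightarrow> computable n (\<lambda>xs. xs ! i)"
  unfolding computable_def by (blast intro: recf_eval.proj)

lemma computable_comp:
  assumes "computable m F" "length Gs = m" "\<forall>G \<in> set Gs. computable n G"
  shows "computable n (\<lambda>xs. F (map (\<lambda>G. G xs) Gs))"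
proof -
  obtain f where f: "\<And>ys. length ys = m \<Longrightarrow> recf_eval f ys (F ys)"
    using assms(1) by (auto simp: computable_def)
  obtain g where g: "\<And>G xs. G \<in> set Gs \<Longrightarrow> length xs = n \<Longrightarrow> recf_eval (g G) xs (G xs)"
    using assms(3) unfolding computable_def by metis
  have "recf_eval (RComp f (map g Gs)) xs (F (map (\<lambda>G. G xs) Gs))" if "length xs = n" for xs
    by (rule recf_eval.comp[where ys = "map (\<lambda>G. G xs) Gs"]) (use that f g assms(2) in auto)
  then show ?thesis by (auto simp: computable_def)
qed

lemma computable_comp1: "computable 1 (\<lambda>xs. F (xs ! 0)) \<Longrightarrow> computable n G \<Longrightarrow> computable n (\<lambda>xs. F (G xs))"
  using computable_comp[of 1 "\<lambda>xs. F (xs ! 0)" "[G]" n] by simp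

lemma computable_comp2:
  "computable 2 (\<lambda>xs. F (xs ! 0) (xs ! 1)) \<Longrightarrow> computable n G \<Longrightarrow> computable n H \<Longrightarrow>
    computable n (\<lambda>xs. F (G xs) (H xs))"
  using computable_comp[of 2 "\<lambda>xs. F (xs ! 0) (xs ! 1)" "[G, H]" n] by simp

lemma computable_Suc:
  assumes "computable n F"
  shows "computable n (\<lambda>xs. Suc (F xs))"
proof -
  have "recf_eval RSucc xs (Suc (xs ! 0))" if "length xs = 1" for xs
    using that recf_eval.succ[of "xs ! 0" "[]"] by (cases xs) auto
  then have "computable 1 (\<lambda>xs. Suc (xs ! 0))" by (auto simp: computable_def)
  then show ?thesis using assms by (rule computable_comp1)
qed

lemma computable_const: "computable n (\<lambda>_. c)"
proof (induction c)
  case 0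
  show ?case unfolding computable_def by (blast intro: recf_eval.zero)
qed (rule computable_Suc)

text \<open>The argument order of the step function, previous value before the counter, is that of
  \<open>RPrimRec\<close>.\<close>

lemma computable_prim:
  assumes "computable n F" "computable (Suc (Suc n)) G"
  shows "computable (Suc n) (\<lambda>xs. rec_nat (F (tl xs)) (\<lambda>k y. G (y # k # tl xs)) (xs ! 0))"
proof -
  obtain f g where f: "\<And>xs. length xs = n \<Longrightarrow> recf_eval f xs (F xs)"
    and g: "\<And>xs. length xs = Suc (Suc n) \<Longrightarrow> recf_eval g xs (G xs)"
    using assms by (auto simp: computable_def)
  have "recf_eval (RPrimRec f g) (k # xs) (rec_nat (F xs) (\<lambda>k y. G (y # k # xs)) k)"
    if "length xs = n" for k xs
  proof (induction k)
    case 0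
    show ?case using recf_eval.prim0[OF f[OF that]] by simp
  next
    case (Suc k)
    show ?case using recf_eval.primS[OF Suc] g that by simp
  qed
  then have "recf_eval (RPrimRec f g) xs (rec_nat (F (tl xs)) (\<lambda>k y. G (y # k # tl xs)) (xs ! 0))"
    if "length xs = Suc n" for xs
    using that by (cases xs) auto
  then show ?thesis by (auto simp: computable_def)
qed

lemma computable_add:
  assumes "computable n F" "computable n G"
  shows "computable n (\<lambda>xs. F xs + G xs)"
proof -
  have eq: "rec_nat a (\<lambda>k y. Suc y) m = m + a" for a m :: nat by (induction m) auto
  have "computable (Suc (Suc 0)) (\<lambda>xs. rec_nat (tl xs ! 0) (\<lambda>k y. Suc ((y # k # tl xs) ! 0)) (xs ! 0))"
    by (rule computable_prim[of _ "\<lambda>xs. xs ! 0" "\<lambda>xs. Suc (xs ! 0)"])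
      (intro computable_proj computable_Suc; simp)+
  then have "computable (Suc (Suc 0)) (\<lambda>xs. xs ! 0 + xs ! 1)"
    by (rule computable_cong) (simp add: eq nth_tl)
  then have "computable 2 (\<lambda>xs. xs ! 0 + xs ! 1)" by (simp only: numeral_2_eq_2)
  then show ?thesis using assms by (rule computable_comp2)
qed

lemma computable_triangle:
  assumes "computable n F"
  shows "computable n (\<lambda>xs. triangle (F xs))"
proof -
  have eq: "rec_nat 0 (\<lambda>k y. Suc (y + k)) m = triangle m" for m by (induction m) auto
  have "computable (Suc 0) (\<lambda>xs. rec_nat 0 (\<lambda>k y. (y # k # tl xs) ! 0 + Suc ((y # k # tl xs) ! 1)) (xs ! 0))"
    by (rule computable_prim[of _ "\<lambda>xs. 0" "\<lambda>xs. xs ! 0 + Suc (xs ! 1)"])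
      (intro computable_proj computable_Suc computable_add computable_const; simp)+
  then have "computable 1 (\<lambda>xs. triangle (xs ! 0))" by (simp add: eq)
  then show ?thesis using assms by (rule computable_comp1)
qed

lemma computable_Nil: "computable n (\<lambda>xs. list_encode [])"
  by (rule computable_const)

text \<open>\<open>list_encode\<close> iterates the Cantor pairing
  \<open>triangle (m + n) + m\<close>, so sums and triangular numbers suffice.\<close>

lemma computable_Cons:
  assumes "computable n F" "computable n (\<lambda>xs. list_encode (L xs))"
  shows "computable n (\<lambda>xs. list_encode (F xs # L xs))"
  unfolding list_encode.simps prod_encode_def split
  by (intro computable_Suc computable_add computable_triangle assms)

lemmas computable_intros = computable_Cons computable_Nil computable_Suc computable_add computable_const

text \<open>The effect on codes of putting a cell in front of a formula with code \<open>y\<close>;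
  6, 5 and 4 are the tags of \<open>Ex\<close>, \<open>Star\<close> and \<open>PAtom\<close>. This
  is the step function of the primitive recursions below.\<close>

definition enc_link :: "nat \<Rightarrow> nat \<Rightarrow> nat \<Rightarrow> nat" where
  "enc_link a j y = list_encode [6, j, list_encode [5, list_encode [4, a, list_encode [Suc j, j]], y]]"

lemma enc_link: "enc_form (Ex j (Star (PAtom a [Suc j, j]) f)) = enc_link a j (enc_form f)"
  by (simp add: enc_link_def)

lemma computable_enc_link:
  "computable n J \<Longrightarrow> computable n Y \<Longrightarrow> computable n (\<lambda>xs. enc_link a (J xs) (Y xs))"
  unfolding enc_link_def by (intro computable_intros)

lemma computable_enc_second:
  assumes "computable n B"
  shows "computable n (\<lambda>xs. enc_form (second_form (B xs)))"
proof -
  have eq: "rec_nat (enc_form (PAtom 0 [0])) (\<lambda>j y. enc_link 3 j y) b = enc_form (second_form b)" for b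
    by (induction b) (simp_all only: second_form.simps enc_link old.nat.simps)
  have "computable (Suc 0) (\<lambda>xs. rec_nat (enc_form (PAtom 0 [0]))
      (\<lambda>k y. enc_link 3 ((y # k # tl xs) ! 1) ((y # k # tl xs) ! 0)) (xs ! 0))"
    by (rule computable_prim[of _ "\<lambda>xs. enc_form (PAtom 0 [0])" "\<lambda>xs. enc_link 3 (xs ! 1) (xs ! 0)"])
      (intro computable_proj computable_enc_link computable_const; simp)+
  then have "computable 1 (\<lambda>xs. enc_form (second_form (xs ! 0)))"
    by (simp only: nth_Cons_0 nth_Cons_Suc One_nat_def eq)
  then show ?thesis using assms by (rule computable_comp1)
qed

lemma computable_enc_first:
  assumes "computable n A" "computable n B"
  shows "computable n (\<lambda>xs. enc_form (first_form (B xs) (A xs)))"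
proof -
  have eq: "rec_nat (enc_form (second_form b)) (\<lambda>j y. enc_link 2 (b + j) y) a = enc_form (first_form b a)" for a b
    by (induction a) (simp_all only: first_form.simps enc_link old.nat.simps)
  have "computable (Suc (Suc 0)) (\<lambda>xs. rec_nat (enc_form (second_form (tl xs ! 0)))
      (\<lambda>k y. enc_link 2 ((y # k # tl xs) ! 2 + (y # k # tl xs) ! 1) ((y # k # tl xs) ! 0)) (xs ! 0))"
    by (rule computable_prim[of _ "\<lambda>xs. enc_form (second_form (xs ! 0))"
          "\<lambda>xs. enc_link 2 (xs ! 2 + xs ! 1) (xs ! 0)"])
      (intro computable_proj computable_enc_link computable_add computable_enc_second; simp)+
  then have "computable (Suc (Suc 0)) (\<lambda>xs. enc_form (first_form (xs ! 1) (xs ! 0)))"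
    by (rule computable_cong) (simp add: eq nth_tl)
  then have "computable 2 (\<lambda>xs. enc_form (first_form (xs ! 1) (xs ! 0)))"
    by (simp only: numeral_2_eq_2)
  then show ?thesis using assms by (rule computable_comp2)
qed

lemma computable_enc_input:
  assumes "computable n A" "computable n B"
  shows "computable n (\<lambda>xs. enc_form (input_form (A xs) (B xs)))"
proof -
  have eq: "enc_form (input_form a b) =
      list_encode [6, Suc (b + a), enc_link 1 (b + a) (enc_form (first_form b a))]" for a b
    unfolding input_form_def enc_form.simps(7)[of "Suc (b + a)"] enc_link ..
  show ?thesis
    unfolding eq by (intro computable_intros computable_enc_link computable_enc_first assms)
qed

section \<open>The diagonal argument\<close>

text \<open>Shared by both problems. \<open>E\<close> builds the code of an instance from the codes
  \<open>a\<close> and \<open>b\<close> of its SID and behavior, adding the sentence for these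
  inputs; it is compared with \<open>enc\<close> only at the codes that belong to the program
  itself, so nothing ever has to be decoded.\<close>

lemma undecidable_if_expresses_halting:
  assumes "computable 2 (\<lambda>xs. E (xs ! 0) (xs ! 1))"
    and inst: "\<And>p a b. inst p a b \<in> X"
    and P: "\<And>p a b. P (inst p a b) \<longleftrightarrow> (\<exists>\<tau>. sem p (input a b) \<tau>)"
    and enc: "\<And>p. enc (inst p (enc_sid (prog_sid p)) (enc_beh (prog_beh p))) =
      E (enc_sid (prog_sid p)) (enc_beh (prog_beh p))"
  shows "\<not> decidable_on X P enc"
proof
  assume "decidable_on X P enc"
  then obtain f where f: "\<And>x. x \<in> X \<Longrightarrow> recf_eval f [enc x] (if P x then 1 else 0)"
    by (auto simp: decidable_on_def)
  obtain g where g: "\<And>xs. length xs = 2 \<Longrightarrow> recf_eval g xs (E (xs ! 0) (xs ! 1))"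
    using assms(1) by (auto simp: computable_def)
  \<comment> \<open>Determinism of \<open>g\<close> ensures that the composition passes no other
    argument than \<open>E a b\<close> to \<open>f\<close>.\<close>
  have h: "recf_eval (RComp f [g]) [a, b] 0 \<longleftrightarrow> recf_eval f [E a b] 0" for a b
  proof
    have gab: "recf_eval g [a, b] (E a b)" using g[of "[a, b]"] by simp
    show "recf_eval f [E a b] 0" if "recf_eval (RComp f [g]) [a, b] 0"
    proof -
      from that obtain ys where "length ys = 1" "recf_eval g [a, b] (ys ! 0)" "recf_eval f ys 0"
        by (rule eval_CompE) auto
      moreover from this(1,2) have "ys = [E a b]"
        using recf_eval_deterministic[OF gab] by (cases ys) auto
      ultimately show ?thesis by simp
    qed
    show "recf_eval (RComp f [g]) [a, b] 0" if "recf_eval f [E a b] 0"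
      using that gab by (intro recf_eval.comp[where ys = "[E a b]"]) auto
  qed
  obtain p where p: "\<And>a b. (\<exists>\<tau>. sem p (input a b) \<tau>) \<longleftrightarrow> recf_eval (RComp f [g]) [a, b] 0"
    using accepting_prog_ex by blast
  define x where "x = inst p (enc_sid (prog_sid p)) (enc_beh (prog_beh p))"
  have "P x \<longleftrightarrow> recf_eval f [enc x] 0"
    unfolding x_def P p h enc ..
  moreover have "recf_eval f [enc x] (if P x then 1 else 0)"
    using f inst x_def by blast
  ultimately show False
    using recf_eval_deterministic[of f "[enc x]" 0 1] by (auto split: if_splits)
qed

lemma undecidable_deadlock:
  "\<not> decidable_on (lin_instances {..6} chain_itys)
    (\<lambda>(D, beta, phi). deadlock chain_itys phi D beta) enc_dl"
proof (rule undecidable_if_expresses_halting)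
  show "computable 2 (\<lambda>xs. list_encode [xs ! 0, xs ! 1, enc_form (input_form (xs ! 0) (xs ! 1))])"
    by (intro computable_intros computable_enc_input computable_proj) simp_all
  show "(prog_sid p, prog_beh p, input_form a b) \<in> lin_instances {..6} chain_itys" for p a b
    by (rule lin_instance)
qed (simp_all add: deadlock_reach_iff_halts enc_dl_def)

lemma undecidable_reach:
  "\<not> decidable_on (reach_instances {..6} chain_itys)
    (\<lambda>((D, beta, phi), q1). reach1 chain_itys phi q1 D beta) enc_reach"
proof (rule undecidable_if_expresses_halting)
  show "computable 2 (\<lambda>xs. list_encode [xs ! 0, xs ! 1, enc_form (input_form (xs ! 0) (xs ! 1)), 0])"
    by (intro computable_intros computable_enc_input computable_proj) simp_all
  show "((prog_sid p, prog_beh p, input_form a b), 0) \<in> reach_instances {..6} chain_itys" for p a b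
    by (rule reach_instance)
qed (simp_all add: deadlock_reach_iff_halts enc_reach_def)

theorem mainTheorem3:
  shows "\<exists>ports itys. sig_ok ports itys \<and>
    \<not> decidable_on (lin_instances ports itys)
        (\<lambda>(D, beta, phi). deadlock itys phi D beta) enc_dl \<and>
    \<not> decidable_on (reach_instances ports itys)
        (\<lambda>((D, beta, phi), q1). reach1 itys phi q1 D beta) enc_reach"
proof (intro exI conjI)
  show "sig_ok {..6} chain_itys" by (auto simp: sig_ok_def chain_itys_def)
qed (rule undecidable_deadlock undecidable_reach)+

end
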